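(* Let $1\le k\le n$ be integers and let $B_n/B_{n-k}$ be the homogeneous space of the Weyl group $B_n$ by its parabolic subgroup $B_{n-k}$. Then $$C(B_n/B_{n-k})\le k(4n-2k-1)\frac{|B_n|}{|B_{n-k}|}.$$
   Context: $B_n$ is the Weyl group of type $B_n$ (hyperoctahedral group) with simple reflections $s_1,\dots,s_n$, where the Dynkin diagram is the path $1,2,\dots,n$ with the double bond between $1$ and $2$; $B_i$ is the subgroup generated by $s_1,\dots,s_i$, giving a chain $B_n>B_{n-1}>\cdots>B_0=\{e\}$, with $|B_i|=2^i i!$. For a finite group $G$, a complex-valued function $h$ on $G$ and a set $R$ of complex matrix representations of $G$, the Fourier transform of $h$ on $R$ is $\mathcal F_R(h)=\bigoplus_{\rho\in R}\sum_{s\in G}h(s)\rho(s)$. Given a subgroup $K\le G$, a complete set $R$ of inequivalent irreducible matrix representations of $G$ is $K$-adapted if there is a complete set $R_K$ of inequivalent irreducible matrix representations of $K$ such that for every $\rho\in R$ the restriction of $\rho$ to $K$ is (as a matrix representation) a direct sum of not necessarily distinct members of $R_K$. For a complex-valued function $f$ on $G/K$, the Fourier transform of $f$ on a $K$-adapted set $R$ is $\mathcal F_R(\tilde f)$, where $\tilde f:G\to\mathbb C$ is the right $K$-invariant function $\tilde f(g)=\frac1{|K|}f(gK)$. The arithmetic complexity $T_{G/K}(R)$ is the minimum number of complex multiplications, or the minimum number of complex additions, whichever is larger, needed to compute the Fourier transform of $f$ on $R$ by a straight-line program (a list of instructions performing $\times,\div,+,-$ on inputs and precomputed values) for an arbitrary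 complex-valued function $f$ on $G/K$. The complexity of the homogeneous space is $C(G/K)=\min_R T_{G/K}(R)$, where $R$ ranges over all complete $K$-adapted sets of inequivalent irreducible matrix representations of $G$. *)

theory Defs
  imports
    "HOL-Algebra.Algebra"
    "HOL-Library.Extended_Real"
    "HOL-Combinatorics.Transposition"
    "Jordan_Normal_Form.VS_Connect"
begin

section \<open>Matrix representations\<close>

definition rep_degree :: "('g, 'm) monoid_scheme \<Rightarrow> ('g \<Rightarrow> complex mat) \<Rightarrow> nat" where
  "rep_degree G \<rho> = dim_row (\<rho> \<one>\<^bsub>G\<^esub>)"

definition matrix_rep :: "('g, 'm) monoid_scheme \<Rightarrow> ('g \<Rightarrow> complex mat) \<Rightarrow> bool" where
  "matrix_rep G \<rho> \<longleftrightarrow>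
     (\<forall>g\<in>carrier G. \<rho> g \<in> carrier_mat (rep_degree G \<rho>) (rep_degree G \<rho>)) \<and>
     \<rho> \<one>\<^bsub>G\<^esub> = 1\<^sub>m (rep_degree G \<rho>) \<and>
     (\<forall>g\<in>carrier G. \<forall>h\<in>carrier G. \<rho> (g \<otimes>\<^bsub>G\<^esub> h) = \<rho> g * \<rho> h)"

definition irreducible_rep :: "('g, 'm) monoid_scheme \<Rightarrow> ('g \<Rightarrow> complex mat) \<Rightarrow> bool" where
  "irreducible_rep G \<rho> \<longleftrightarrow>
     matrix_rep G \<rho> \<and> 0 < rep_degree G \<rho> \<and>
     (\<forall>W. subspace class_ring W (module_vec TYPE(complex) (rep_degree G \<rho>)) \<and>
          (\<forall>g\<in>carrier G. \<forall>w\<in>W. \<rho> g *\<^sub>v w \<in> W) \<longrightarrow>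
          W = {0\<^sub>v (rep_degree G \<rho>)} \<or> W = carrier_vec (rep_degree G \<rho>))"

definition equivalent_reps ::
  "('g, 'm) monoid_scheme \<Rightarrow> ('g \<Rightarrow> complex mat) \<Rightarrow> ('g \<Rightarrow> complex mat) \<Rightarrow> bool" where
  "equivalent_reps G \<rho> \<sigma> \<longleftrightarrow>
     (\<exists>P Q. \<forall>g\<in>carrier G. similar_mat_wit (\<rho> g) (\<sigma> g) P Q)"

text \<open>Representations are functions on the whole type, unconstrained outside
  \<open>carrier G\<close>. Two functions that agree on the carrier are equivalent, so a set as
  below contains exactly one function for every class of irreducible representations.\<close>

definition complete_irreps :: "('g, 'm) monoid_scheme \<Rightarrow> ('g \<Rightarrow> complex mat) set \<Rightarrow> bool" where
  "complete_irreps G R \<longleftrightarrow>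
     (\<forall>\<rho>\<in>R. irreducible_rep G \<rho>) \<and>
     (\<forall>\<rho>\<in>R. \<forall>\<sigma>\<in>R. equivalent_reps G \<rho> \<sigma> \<longrightarrow> \<rho> = \<sigma>) \<and>
     (\<forall>\<tau>. irreducible_rep G \<tau> \<longrightarrow> (\<exists>\<rho>\<in>R. equivalent_reps G \<tau> \<rho>))"

definition adapted_irreps ::
  "('g, 'm) monoid_scheme \<Rightarrow> 'g set \<Rightarrow> ('g \<Rightarrow> complex mat) set \<Rightarrow> bool" where
  "adapted_irreps G K R \<longleftrightarrow>
     complete_irreps G R \<and>
     (\<exists>RK. complete_irreps (G\<lparr>carrier := K\<rparr>) RK \<and>
        (\<forall>\<rho>\<in>R. \<exists>\<sigma>s. set \<sigma>s \<subseteq> RK \<and>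
           (\<forall>h\<in>K. \<rho> h = diag_block_mat (map (\<lambda>\<sigma>. \<sigma> h) \<sigma>s))))"


section \<open>Fourier transforms\<close>

text \<open>The direct sum over \<open>R\<close> is the family of its blocks, indexed by \<open>R\<close>.\<close>

definition fourier_transform ::
  "('g, 'm) monoid_scheme \<Rightarrow> ('g \<Rightarrow> complex mat) set \<Rightarrow> ('g \<Rightarrow> complex)
    \<Rightarrow> ('g \<Rightarrow> complex mat) \<Rightarrow> complex mat" where
  "fourier_transform G R h =
     (\<lambda>\<rho>\<in>R. mat (rep_degree G \<rho>) (rep_degree G \<rho>)
        (\<lambda>(i, j). \<Sum>s\<in>carrier G. h s * \<rho> s $$ (i, j)))"

definition coset_lift ::
  "('g, 'm) monoid_scheme \<Rightarrow> 'g set \<Rightarrow> ('g set \<Rightarrow> complex) \<Rightarrow> 'g \<Rightarrow> complex" where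
  "coset_lift G K f g = 1 / of_nat (card K) * f (g <#\<^bsub>G\<^esub> K)"


section \<open>Straight-line programs\<close>

text \<open>Operands are inputs, complex constants (which are free) and results of earlier
  instructions, numbered from 0. A run fails on an input outside \<open>I\<close>, on a reference
  to a result that is not yet available, and on division by zero.\<close>

datatype arith_op = Plus | Minus | Times | Divide

datatype 'i operand = Input 'i | Const complex | Result nat

datatype 'i instr = Instr (instr_op: arith_op) "'i operand" "'i operand"

fun operand_value ::
  "'i set \<Rightarrow> ('i \<Rightarrow> complex) \<Rightarrow> complex list \<Rightarrow> 'i operand \<Rightarrow> complex option" where
  "operand_value I x ws (Input i) = (if i \<in> I then Some (x i) else None)"
| "operand_value I x ws (Const c) = Some c"
| "operand_value I x ws (Result m) = (if m < length ws then Some (ws ! m) else None)"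

fun apply_op :: "arith_op \<Rightarrow> complex \<Rightarrow> complex \<Rightarrow> complex option" where
  "apply_op Plus u v = Some (u + v)"
| "apply_op Minus u v = Some (u - v)"
| "apply_op Times u v = Some (u * v)"
| "apply_op Divide u v = (if v = 0 then None else Some (u / v))"

fun instr_value ::
  "'i set \<Rightarrow> ('i \<Rightarrow> complex) \<Rightarrow> complex list \<Rightarrow> 'i instr \<Rightarrow> complex option" where
  "instr_value I x ws (Instr q a b) =
     Option.bind (operand_value I x ws a) (\<lambda>u.
     Option.bind (operand_value I x ws b) (\<lambda>v. apply_op q u v))"

fun run ::
  "'i set \<Rightarrow> ('i \<Rightarrow> complex) \<Rightarrow> 'i instr list \<Rightarrow> complex list \<Rightarrow> complex list option" where
  "run I x [] ws = Some ws"
| "run I x (c # p) ws = Option.bind (instr_value I x ws c) (\<lambda>w. run I x p (ws @ [w]))"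

text \<open>The program and the place where a target is found do not depend on the input \<open>x\<close>,
  and every run has to succeed.\<close>

definition computes :: "'i set \<Rightarrow> 'i instr list \<Rightarrow> (('i \<Rightarrow> complex) \<Rightarrow> complex) set \<Rightarrow> bool" where
  "computes I p \<Phi> \<longleftrightarrow>
     (\<forall>x. run I x p [] \<noteq> None) \<and>
     (\<forall>\<phi>\<in>\<Phi>. \<exists>a. \<forall>x. operand_value I x (the (run I x p [])) a = Some (\<phi> x))"

text \<open>Divisions count as multiplications, subtractions as additions.\<close>

definition mult_count :: "'i instr list \<Rightarrow> nat" where
  "mult_count p = length (filter (\<lambda>c. instr_op c \<in> {Times, Divide}) p)"

definition add_count :: "'i instr list \<Rightarrow> nat" where
  "add_count p = length (filter (\<lambda>c. instr_op c \<in> {Plus, Minus}) p)"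


section \<open>Complexity of homogeneous spaces\<close>

definition fourier_entries ::
  "('g, 'm) monoid_scheme \<Rightarrow> 'g set \<Rightarrow> ('g \<Rightarrow> complex mat) set
    \<Rightarrow> (('g set \<Rightarrow> complex) \<Rightarrow> complex) set" where
  "fourier_entries G K R =
     {\<lambda>f. fourier_transform G R (coset_lift G K f) \<rho> $$ (i, j) | \<rho> i j.
        \<rho> \<in> R \<and> i < rep_degree G \<rho> \<and> j < rep_degree G \<rho>}"

definition fourier_programs ::
  "('g, 'm) monoid_scheme \<Rightarrow> 'g set \<Rightarrow> ('g \<Rightarrow> complex mat) set \<Rightarrow> 'g set instr list set" where
  "fourier_programs G K R = {p. computes (lcosets\<^bsub>G\<^esub> K) p (fourier_entries G K R)}"

text \<open>The two minima are taken independently. All minima are infima in \<^typ>\<open>enat\<close>: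
  over a nonempty set they are attained, over the empty set they are \<open>\<infinity>\<close>.\<close>

definition arith_complexity ::
  "('g, 'm) monoid_scheme \<Rightarrow> 'g set \<Rightarrow> ('g \<Rightarrow> complex mat) set \<Rightarrow> enat" where
  "arith_complexity G K R =
     max (INF p\<in>fourier_programs G K R. enat (mult_count p))
         (INF p\<in>fourier_programs G K R. enat (add_count p))"

definition space_complexity :: "('g, 'm) monoid_scheme \<Rightarrow> 'g set \<Rightarrow> enat" where
  "space_complexity G K = (INF R\<in>{R. adapted_irreps G K R}. arith_complexity G K R)"


section \<open>The Weyl group of type B\<close>

text \<open>Signed permutations, as permutations \<open>\<pi>\<close> of the integers with
  \<open>\<pi> (- x) = - \<pi> x\<close>. The generator \<open>s\<^sub>1\<close> is the sign change \<open>1 \<mapsto> -1\<close>, and for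
  \<open>i \<ge> 2\<close> the generator \<open>s\<^sub>i\<close> exchanges \<open>i - 1\<close> and \<open>i\<close>, and accordingly \<open>-(i - 1)\<close>
  and \<open>-i\<close>. All groups \<open>B\<^sub>0 \<le> B\<^sub>1 \<le> \<dots>\<close> thus lie in one group.\<close>

definition simple_refl :: "nat \<Rightarrow> int \<Rightarrow> int" where
  "simple_refl i =
     (if i = 1 then Transposition.transpose 1 (- 1)
      else Transposition.transpose (int i - 1) (int i) \<circ>
           Transposition.transpose (- (int i - 1)) (- int i))"

definition weyl_B :: "nat \<Rightarrow> (int \<Rightarrow> int) monoid" where
  "weyl_B n = (BijGroup UNIV)
     \<lparr>carrier := generate (BijGroup UNIV) (simple_refl ` {1..n})\<rparr>"

lemma simple_refl_Bij: "simple_refl i \<in> carrier (BijGroup UNIV)"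
proof -
  have "bij (simple_refl i)"
    unfolding simple_refl_def by (simp add: bij_comp)
  then show ?thesis
    by (simp add: BijGroup_def Bij_def)
qed

lemma subgroup_weyl_B_BijGroup: "subgroup (carrier (weyl_B n)) (BijGroup UNIV)"
  using group.generate_is_subgroup[OF group_BijGroup, of "simple_refl ` {1..n}" UNIV]
    simple_refl_Bij
  by (simp add: weyl_B_def image_subset_iff)

lemma group_weyl_B: "group (weyl_B n)"
  using group.subgroup_imp_group[OF group_BijGroup subgroup_weyl_B_BijGroup, of n]
  by (simp add: weyl_B_def)

lemma subgroup_weyl_B:
  assumes "m \<le> n"
  shows "subgroup (carrier (weyl_B m)) (weyl_B n)"
proof -
  have "simple_refl ` {1..m} \<subseteq> simple_refl ` {1..n}"
    using assms by (intro image_mono) simp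
  then have "carrier (weyl_B m) \<subseteq> carrier (weyl_B n)"
    using group.mono_generate[OF group_BijGroup] by (simp add: weyl_B_def)
  with group.subgroup_incl[OF group_BijGroup subgroup_weyl_B_BijGroup subgroup_weyl_B_BijGroup,
      of m n]
  show ?thesis
    by (simp add: weyl_B_def)
qed

end

theory Submission
  imports Defs "Jordan_Normal_Form.Spectral_Radius"
begin

text \<open>Choose irreducible matrix representations adapted to the whole chain
  \<open>B\<^sub>0 < B\<^sub>1 < \<dots>\<close>. The transform on \<open>B\<^sub>m\<^sub>+\<^sub>1\<close> is assembled from the transforms on the \<open>2(m + 1)\<close>
  cosets of \<open>B\<^sub>m\<close>, and for each irreducible \<open>\<sigma>\<close> of \<open>B\<^sub>m\<close> and each column this amounts to decomposing
  the representation induced from \<open>\<sigma>\<close>. All cosets but two are represented by \<open>z s\<close>, where \<open>z\<close> runs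
  through the representatives one level below and \<open>s\<close> is the last simple reflection. So after
  the same decomposition has been carried out for the constituents \<open>\<mu>\<close> of the restriction of \<open>\<sigma>\<close>, only
  the matrix of \<open>s\<close> has to be applied, and its entries between the constituents \<open>\<nu>\<close> and \<open>\<sigma>\<close> are
  one scalar for each common constituent \<open>\<mu>\<close>. There is at most one such \<open>\<mu>\<close> unless \<open>\<nu> = \<sigma>\<close>; for \<open>\<nu> = \<sigma>\<close>
  their number \<open>r\<close> satisfies \<open>r (r + 2) \<le> 8 m\<close>, which yields the cost \<open>4 m + 1\<close> for each output of this step.

  The branching rules come from the Jucys-Murphy elements, as in the approach of Okounkov and
  Vershik: their commutation relation with \<open>s\<close> determines the matrix of \<open>s\<close>, hence all matrix
  coefficients of a representation inside a constituent, and it gives multiplicity-freeness. Taking traces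
  yields a secular equation with positive weights for the eigenvalues, so that between two
  boxes that can be added there is one that can be removed. This bounds \<open>r\<close>.\<close>

section \<open>Block diagonal matrices and subspaces\<close>

text \<open>Summing the cost \<open>4 * m + 1\<close> per output over the levels \<open>m\<close>
  from \<open>n - k\<close> to \<open>n - 1\<close> gives exactly
  \<open>k * (4 * n - 2 * k - 1)\<close>. The factor \<open>|B_n| / |B_{n-k}|\<close> bounds the
  number of outputs on each level, taken over all cosets: a right invariant function is seen only by
  the columns fixed by the small group, all other columns of its transform vanish, and the remaining
  entries are counted through dimensions of induced representations. The obstacle is the case
  \<open>\<nu> = \<sigma>\<close>. There an output needs \<open>r + 1\<close> additions, and up to
  \<open>r + 2\<close> representations above \<open>\<sigma>\<close> have such outputs, so
  \<open>(r + 1) * (r + 2)\<close> has to fit into the growth \<open>16 * m + 18\<close> of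
  \<open>2 * (m + 1) * (4 * m + 1)\<close> from level \<open>m\<close> to level
  \<open>m + 1\<close>. This forces a bound for \<open>r\<close> that grows only like the square
  root of the level. Bipartitions are never introduced: a box exists only as a pair of eigenvalues,
  a sign and a content, and statements about addable and removable boxes are statements about such
  pairs.\<close>

fun blk :: "nat list \<Rightarrow> nat \<Rightarrow> nat \<times> nat" where
  "blk [] j = (0, j)"
| "blk (d # ds) j =
     (if j < d then (0, j) else (Suc (fst (blk ds (j - d))), snd (blk ds (j - d))))"

text \<open>\<open>blk\<close> decodes a row of a block diagonal matrix with block sizes
  \<open>ds\<close> into the number of its block and the offset inside it; this lemma and
  \<open>blk_at\<close> make it inverse to \<open>sum_list (take t ds) + b\<close>.\<close>

lemma blk_bounds:
  assumes "j < sum_list ds"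
  shows "fst (blk ds j) < length ds" "snd (blk ds j) < ds ! fst (blk ds j)"
    "sum_list (take (fst (blk ds j)) ds) + snd (blk ds j) = j"
proof -
  have "fst (blk ds j) < length ds \<and> snd (blk ds j) < ds ! fst (blk ds j) \<and>
    sum_list (take (fst (blk ds j)) ds) + snd (blk ds j) = j"
    using assms
  proof (induction ds arbitrary: j)
    case (Cons d ds)
    show ?case
    proof (cases "j < d")
      case False
      then have "j - d < sum_list ds" using Cons.prems by auto
      from Cons.IH[OF this] False show ?thesis by (simp add: add.assoc)
    qed simp
  qed simp
  then show "fst (blk ds j) < length ds" "snd (blk ds j) < ds ! fst (blk ds j)"
    "sum_list (take (fst (blk ds j)) ds) + snd (blk ds j) = j" by auto
qed

lemma blk_at:
  assumes "t < length ds" "b < ds ! t"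
  shows "blk ds (sum_list (take t ds) + b) = (t, b)"
    "sum_list (take t ds) + b < sum_list ds"
proof -
  have "blk ds (sum_list (take t ds) + b) = (t, b) \<and> sum_list (take t ds) + b < sum_list ds"
    using assms
  proof (induction ds arbitrary: t)
    case (Cons d ds)
    then show ?case
      by (cases t) (auto simp: add.assoc)
  qed simp
  then show "blk ds (sum_list (take t ds) + b) = (t, b)"
    "sum_list (take t ds) + b < sum_list ds" by auto
qed

lemma diag_block_mat_blk:
  fixes As :: "'a :: zero mat list"
  assumes "\<forall>A\<in>set As. dim_col A = dim_row A"
    and "i < sum_list (map dim_row As)" "j < sum_list (map dim_row As)"
  shows "diag_block_mat As $$ (i, j) =
    (if fst (blk (map dim_row As) i) = fst (blk (map dim_row As) j)
     then (As ! fst (blk (map dim_row As) i)) $$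
       (snd (blk (map dim_row As) i), snd (blk (map dim_row As) j)) else 0)"
  using assms
proof (induction As arbitrary: i j)
  case (Cons A As)
  have *: "map dim_col As = map dim_row As" using Cons.prems by auto
  have "dim_row (diag_block_mat As) = sum_list (map dim_row As)"
    "dim_col (diag_block_mat As) = sum_list (map dim_row As)"
    by (simp_all only: dim_diag_block_mat *)
  moreover have "dim_col A = dim_row A" using Cons.prems by auto
  ultimately show ?case
    using Cons by (auto simp: Let_def)
qed simp

lemma index_mult_mat_sum:
  assumes "A \<in> carrier_mat m n" "B \<in> carrier_mat n k" "i < m" "j < k"
  shows "(A * B) $$ (i, j) = (\<Sum>l<n. A $$ (i, l) * B $$ (l, j))"
  using assms by (auto simp: scalar_prod_def atLeast0LessThan)

lemma index_mult_mat_vec_sum: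
  assumes "A \<in> carrier_mat m n" "v \<in> carrier_vec n" "i < m"
  shows "(A *\<^sub>v v) $ i = (\<Sum>l<n. A $$ (i, l) * v $ l)"
  using assms by (auto simp: scalar_prod_def atLeast0LessThan)

text \<open>Padding both factors with zeros to size \<open>m\<close> turns the one-sided inverse
  into a two-sided one, which the zero rows of the padded \<open>Q\<close> forbid. The comparisons
  of dimensions below rest on this, without any notion of rank.\<close>

lemma left_inverse_dim_le:
  fixes P :: "'a :: field mat"
  assumes P: "P \<in> carrier_mat m n" and Q: "Q \<in> carrier_mat n m" and PQ: "P * Q = 1\<^sub>m m"
  shows "m \<le> n"
proof (rule ccontr)
  assume "\<not> m \<le> n"
  then have lt: "n < m" by simp
  define P' where "P' = mat m m (\<lambda>(i, j). if j < n then P $$ (i, j) else 0)"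
  define Q' where "Q' = mat m m (\<lambda>(i, j). if i < n then Q $$ (i, j) else 0)"
  have car: "P' \<in> carrier_mat m m" "Q' \<in> carrier_mat m m" by (auto simp: P'_def Q'_def)
  have "P' * Q' = 1\<^sub>m m"
  proof (rule eq_matI)
    fix i j assume "i < dim_row (1\<^sub>m m :: 'a mat)" "j < dim_col (1\<^sub>m m :: 'a mat)"
    then have ij: "i < m" "j < m" by auto
    have "(P' * Q') $$ (i, j) = (\<Sum>l<m. if l < n then P $$ (i, l) * Q $$ (l, j) else 0)"
      using ij by (subst index_mult_mat_sum[OF car]) (auto simp: P'_def Q'_def intro!: sum.cong)
    also have "\<dots> = (\<Sum>l<n. P $$ (i, l) * Q $$ (l, j))"
      using lt by (intro sum.mono_neutral_cong_right) auto
    also have "\<dots> = (P * Q) $$ (i, j)" using ij by (simp add: index_mult_mat_sum[OF P Q])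
    finally show "(P' * Q') $$ (i, j) = 1\<^sub>m m $$ (i, j)" using PQ by simp
  qed (auto simp: P'_def Q'_def)
  then have "Q' * P' = 1\<^sub>m m" using mat_mult_left_right_inverse[OF car] by blast
  then have "(Q' * P') $$ (n, n) = 1" using lt by simp
  moreover have "(Q' * P') $$ (n, n) = 0"
    using lt by (subst index_mult_mat_sum[OF car(2,1)]) (auto simp: Q'_def)
  ultimately show False by simp
qed

definition vec_subspace :: "nat \<Rightarrow> complex vec set \<Rightarrow> bool" where
  "vec_subspace n W \<longleftrightarrow> W \<subseteq> carrier_vec n \<and> 0\<^sub>v n \<in> W \<and>
     (\<forall>v\<in>W. \<forall>w\<in>W. v + w \<in> W) \<and> (\<forall>c. \<forall>v\<in>W. c \<cdot>\<^sub>v v \<in> W)"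

lemma subspace_iff_vec_subspace:
  "subspace class_ring W (module_vec TYPE(complex) n) \<longleftrightarrow> vec_subspace n W"
proof -
  interpret vec_space "TYPE(complex)" n .
  have "subspace class_ring W V \<longleftrightarrow> submodule class_ring W V"
    by (auto simp: subspace_def intro: submodule_is_module vectorspace_axioms)
  also have "\<dots> \<longleftrightarrow> vec_subspace n W"
    unfolding submodule_def vec_subspace_def
    using module_axioms by (auto simp: module_vec_def class_ring_simps)
  finally show ?thesis .
qed

lemma vec_subspace_diff:
  assumes "vec_subspace n W" "v \<in> W" "w \<in> W"
  shows "v - w \<in> W"
proof -
  have "v \<in> carrier_vec n" "w \<in> carrier_vec n" using assms by (auto simp: vec_subspace_def)
  then have "v - w = v + (-1) \<cdot>\<^sub>v w" by (intro eq_vecI) auto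
  moreover have "(-1) \<cdot>\<^sub>v w \<in> W" using assms unfolding vec_subspace_def by blast
  ultimately show ?thesis using assms unfolding vec_subspace_def by auto
qed

text \<open>\<open>B * C\<close> is a projection onto \<open>W\<close>.\<close>

lemma vec_subspace_factorization:
  assumes W: "vec_subspace n W"
  obtains k B C where "B \<in> carrier_mat n k" "C \<in> carrier_mat k n" "C * B = 1\<^sub>m k"
    "\<And>v. v \<in> carrier_vec k \<Longrightarrow> B *\<^sub>v v \<in> W" "\<And>w. w \<in> W \<Longrightarrow> B *\<^sub>v (C *\<^sub>v w) = w"
proof -
  define good where "good k B C \<longleftrightarrow> B \<in> carrier_mat n k \<and> C \<in> carrier_mat k n \<and> C * B = 1\<^sub>m k \<and>
    (\<forall>v\<in>carrier_vec k. B *\<^sub>v v \<in> W)" for k B C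
  have bound: "k \<le> n" if "\<exists>B C. good k B C" for k
    using that left_inverse_dim_le unfolding good_def by blast
  have "good 0 (0\<^sub>m n 0) (0\<^sub>m 0 n)"
  proof -
    have "0\<^sub>m n 0 *\<^sub>v v = 0\<^sub>v n" if "v \<in> carrier_vec 0" for v :: "complex vec"
      using that by (intro eq_vecI) (auto simp: scalar_prod_def)
    then show ?thesis using W by (auto simp: good_def vec_subspace_def)
  qed
  \<comment> \<open>Take a pair with the greatest number \<open>k\<close> of columns. If it missed
    some \<open>w\<close> in \<open>W\<close>, the residue \<open>v\<close> of \<open>w\<close>,
    which \<open>C\<close> annihilates, could be appended to \<open>B\<close> as a new
    column.\<close>
  then obtain k where k: "\<exists>B C. good k B C" and max: "\<And>l. \<exists>B C. good l B C \<Longrightarrow> l \<le> k"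
    using GreatestI_nat[of "\<lambda>k. \<exists>B C. good k B C", OF _ bound]
      Greatest_le_nat[of "\<lambda>k. \<exists>B C. good k B C", OF _ bound] by blast
  obtain B C where "good k B C" using k by blast
  then have B: "B \<in> carrier_mat n k" and C: "C \<in> carrier_mat k n" and CB: "C * B = 1\<^sub>m k"
    and BW: "\<And>v. v \<in> carrier_vec k \<Longrightarrow> B *\<^sub>v v \<in> W" by (auto simp: good_def)
  have "B *\<^sub>v (C *\<^sub>v w) = w" if w: "w \<in> W" for w
  proof (rule ccontr)
    assume ne: "B *\<^sub>v (C *\<^sub>v w) \<noteq> w"
    have wn: "w \<in> carrier_vec n" using w W by (auto simp: vec_subspace_def)
    define v where "v = w - B *\<^sub>v (C *\<^sub>v w)"
    have vn: "v \<in> carrier_vec n" using wn B C by (auto simp: v_def)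
    have vW: "v \<in> W" unfolding v_def using vec_subspace_diff[OF W w BW] C wn by auto
    have BCw: "B *\<^sub>v (C *\<^sub>v w) \<in> carrier_vec n" using B C wn by auto
    have "C *\<^sub>v (B *\<^sub>v (C *\<^sub>v w)) = (C * B) *\<^sub>v (C *\<^sub>v w)"
      using B C wn by (intro assoc_mult_mat_vec[symmetric]) auto
    also have "\<dots> = C *\<^sub>v w" using CB C wn by auto
    finally have Cv: "C *\<^sub>v v = 0\<^sub>v k"
      unfolding v_def using C wn BCw by (subst mult_minus_distrib_mat_vec) auto
    have "\<exists>i<n. v $ i \<noteq> 0"
    proof (rule ccontr)
      assume "\<not> (\<exists>i<n. v $ i \<noteq> 0)"
      then have "\<forall>i<n. w $ i = (B *\<^sub>v (C *\<^sub>v w)) $ i" using B by (auto simp: v_def)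
      then have "w = B *\<^sub>v (C *\<^sub>v w)" using B wn by (intro eq_vecI) (auto simp del: index_mult_mat_vec)
      then show False using ne by simp
    qed
    then obtain i0 where i0: "i0 < n" "v $ i0 \<noteq> 0" by blast
    \<comment> \<open>a linear functional with \<open>f v = 1\<close> that vanishes on the columns of \<open>B\<close>\<close>
    define f where "f j = ((if j = i0 then 1 else 0) - (B * C) $$ (i0, j)) / v $ i0" for j
    define B' where "B' = mat n (Suc k) (\<lambda>(i, j). if j < k then B $$ (i, j) else v $ i)"
    define C' where "C' = mat (Suc k) n (\<lambda>(i, j). if i < k then C $$ (i, j) else f j)"
    have B': "B' \<in> carrier_mat n (Suc k)" and C': "C' \<in> carrier_mat (Suc k) n"
      by (auto simp: B'_def C'_def)
    have BC: "B * C \<in> carrier_mat n n" using B C by auto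
    have fsum: "(\<Sum>l<n. f l * g l) = (g i0 - (\<Sum>l<n. (B * C) $$ (i0, l) * g l)) / v $ i0" for g
    proof -
      have "(\<Sum>l<n. f l * g l) = (\<Sum>l<n. (if l = i0 then g l else 0) - (B * C) $$ (i0, l) * g l) / v $ i0"
        unfolding sum_divide_distrib by (intro sum.cong) (auto simp: f_def field_simps)
      then show ?thesis using i0 by (simp add: sum_subtractf)
    qed
    have "C' * B' = 1\<^sub>m (Suc k)"
    proof (rule eq_matI)
      fix i j assume "i < dim_row (1\<^sub>m (Suc k) :: complex mat)" "j < dim_col (1\<^sub>m (Suc k) :: complex mat)"
      then have ij: "i < Suc k" "j < Suc k" by auto
      have e: "(C' * B') $$ (i, j) = (\<Sum>l<n. C' $$ (i, l) * B' $$ (l, j))"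
        using ij by (simp add: index_mult_mat_sum[OF C' B'])
      consider "i < k" "j < k" | "i < k" "j = k" | "i = k" "j < k" | "i = k" "j = k"
        using ij by linarith
      then show "(C' * B') $$ (i, j) = 1\<^sub>m (Suc k) $$ (i, j)"
      proof cases
        case 1
        then have "(C' * B') $$ (i, j) = (C * B) $$ (i, j)"
          unfolding e by (subst index_mult_mat_sum[OF C B]) (auto simp: B'_def C'_def)
        then show ?thesis using CB 1 by auto
      next
        case 2
        then have "(C' * B') $$ (i, j) = (C *\<^sub>v v) $ i"
          unfolding e by (subst index_mult_mat_vec_sum[OF C vn]) (auto simp: B'_def C'_def)
        then show ?thesis using Cv 2 by auto
      next
        case 3
        have "(B * C * B) = B * (C * B)" using B C by (intro assoc_mult_mat) auto
        also have "\<dots> = B" using CB B by auto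
        finally have "(\<Sum>l<n. (B * C) $$ (i0, l) * B $$ (l, j)) = B $$ (i0, j)"
          using index_mult_mat_sum[OF BC B i0(1) 3(2)] by simp
        then have "(\<Sum>l<n. f l * B $$ (l, j)) = 0" unfolding fsum by simp
        then show ?thesis unfolding e using 3 by (simp add: B'_def C'_def)
      next
        case 4
        have "B * C *\<^sub>v v = B *\<^sub>v (C *\<^sub>v v)" using B C vn by (intro assoc_mult_mat_vec) auto
        also have "\<dots> = 0\<^sub>v n" using Cv B by (auto intro!: eq_vecI)
        finally have "(\<Sum>l<n. (B * C) $$ (i0, l) * v $ l) = 0"
          using index_mult_mat_vec_sum[OF BC vn i0(1)] i0(1) by simp
        then have "(\<Sum>l<n. f l * v $ l) = 1" unfolding fsum using i0 by simp
        then show ?thesis unfolding e using 4 by (simp add: B'_def C'_def)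
      qed
    qed (auto simp: B'_def C'_def)
    moreover have "B' *\<^sub>v x \<in> W" if x: "x \<in> carrier_vec (Suc k)" for x
    proof -
      define x' where "x' = vec k (\<lambda>i. x $ i)"
      have x': "x' \<in> carrier_vec k" by (simp add: x'_def)
      have "B' *\<^sub>v x = B *\<^sub>v x' + x $ k \<cdot>\<^sub>v v"
      proof (rule eq_vecI)
        fix i assume "i < dim_vec (B *\<^sub>v x' + x $ k \<cdot>\<^sub>v v)"
        then have i: "i < n" using vn by simp
        show "(B' *\<^sub>v x) $ i = (B *\<^sub>v x' + x $ k \<cdot>\<^sub>v v) $ i"
          using i B vn index_mult_mat_vec_sum[OF B' x i] index_mult_mat_vec_sum[OF B x' i]
          by (simp add: B'_def x'_def)
      qed (use B B' vn in auto)
      moreover have "x $ k \<cdot>\<^sub>v v \<in> W" using W vW unfolding vec_subspace_def by blast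
      ultimately show ?thesis using W BW[OF x'] unfolding vec_subspace_def by auto
    qed
    ultimately have "good (Suc k) B' C'" using B' C' by (auto simp: good_def)
    then show False using max[of "Suc k"] by auto
  qed
  then show thesis using that B C CB BW by blast
qed

section \<open>Schur's lemma\<close>

lemma mat_eqI_mult_vec:
  fixes M N :: "complex mat"
  assumes M: "M \<in> carrier_mat m n" and N: "N \<in> carrier_mat m n"
    and eq: "\<And>v. v \<in> carrier_vec n \<Longrightarrow> M *\<^sub>v v = N *\<^sub>v v"
  shows "M = N"
proof (rule eq_matI)
  fix i j assume ij: "i < dim_row N" "j < dim_col N"
  then have ij': "i < m" "j < n" using N by auto
  have "(M *\<^sub>v unit_vec n j) $ i = M $$ (i, j)" "(N *\<^sub>v unit_vec n j) $ i = N $$ (i, j)"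
    using ij' index_mult_mat_vec_sum[OF M _ ij'(1), of "unit_vec n j"]
      index_mult_mat_vec_sum[OF N _ ij'(1), of "unit_vec n j"]
    by (simp_all add: if_distrib cong: if_cong)
  then show "M $$ (i, j) = N $$ (i, j)" using eq[of "unit_vec n j"] by simp
qed (use M N in auto)

lemma vec_subspace_sum:
  assumes W: "vec_subspace n W" and "finite S" "\<And>g. g \<in> S \<Longrightarrow> u g \<in> W"
  shows "vec n (\<lambda>i. \<Sum>g\<in>S. u g $ i) \<in> W"
  using assms(2,3)
proof (induction S rule: finite_induct)
  case empty
  have "vec n (\<lambda>i. 0) = (0\<^sub>v n :: complex vec)" by (intro eq_vecI) auto
  then show ?case using W by (auto simp: vec_subspace_def)
next
  case (insert g S)
  have u: "u g \<in> W" "u g \<in> carrier_vec n" using insert W by (auto simp: vec_subspace_def)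
  have "vec n (\<lambda>i. \<Sum>g\<in>insert g S. u g $ i) = u g + vec n (\<lambda>i. \<Sum>g\<in>S. u g $ i)"
    using insert u by (intro eq_vecI) auto
  then show ?case using W u insert by (auto simp: vec_subspace_def)
qed

lemma irreducible_rep_iff:
  "irreducible_rep G \<rho> \<longleftrightarrow> matrix_rep G \<rho> \<and> 0 < rep_degree G \<rho> \<and>
     (\<forall>W. vec_subspace (rep_degree G \<rho>) W \<and> (\<forall>g\<in>carrier G. \<forall>w\<in>W. \<rho> g *\<^sub>v w \<in> W) \<longrightarrow>
        W = {0\<^sub>v (rep_degree G \<rho>)} \<or> W = carrier_vec (rep_degree G \<rho>))"
  unfolding irreducible_rep_def subspace_iff_vec_subspace by blast

locale finite_group = group G for G (structure) +
  assumes finite_carrier: "finite (carrier G)"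
begin

abbreviation "dg \<equiv> rep_degree G"

lemma rep_carrier: "matrix_rep G \<rho> \<Longrightarrow> g \<in> carrier G \<Longrightarrow> \<rho> g \<in> carrier_mat (dg \<rho>) (dg \<rho>)"
  by (auto simp: matrix_rep_def)

lemma rep_one: "matrix_rep G \<rho> \<Longrightarrow> \<rho> \<one> = 1\<^sub>m (dg \<rho>)"
  by (auto simp: matrix_rep_def)

lemma rep_mult:
  "matrix_rep G \<rho> \<Longrightarrow> g \<in> carrier G \<Longrightarrow> h \<in> carrier G \<Longrightarrow> \<rho> (g \<otimes> h) = \<rho> g * \<rho> h"
  by (auto simp: matrix_rep_def)

lemma rep_mult_index:
  assumes "matrix_rep G \<rho>" "g \<in> carrier G" "h \<in> carrier G" "i < dg \<rho>" "j < dg \<rho>"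
  shows "\<rho> (g \<otimes> h) $$ (i, j) = (\<Sum>k<dg \<rho>. \<rho> g $$ (i, k) * \<rho> h $$ (k, j))"
  using assms index_mult_mat_sum[OF rep_carrier rep_carrier] by (simp add: rep_mult)

lemma rep_one_index:
  "matrix_rep G \<rho> \<Longrightarrow> i < dg \<rho> \<Longrightarrow> j < dg \<rho> \<Longrightarrow> \<rho> \<one> $$ (i, j) = (if i = j then 1 else 0)"
  by (simp add: rep_one)

lemma irreducible_matrix_rep: "irreducible_rep G \<rho> \<Longrightarrow> matrix_rep G \<rho>"
  by (simp add: irreducible_rep_iff)

lemma irreducible_deg_pos: "irreducible_rep G \<rho> \<Longrightarrow> 0 < dg \<rho>"
  by (simp add: irreducible_rep_iff)

lemma irreducible_cases:
  assumes "irreducible_rep G \<rho>" "vec_subspace (dg \<rho>) W"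
    "\<And>g w. g \<in> carrier G \<Longrightarrow> w \<in> W \<Longrightarrow> \<rho> g *\<^sub>v w \<in> W"
  shows "W = {0\<^sub>v (dg \<rho>)} \<or> W = carrier_vec (dg \<rho>)"
  using assms by (auto simp: irreducible_rep_iff)

text \<open>The vectors whose images under all \<open>\<rho> g\<close> have zero \<open>i\<close>-th
  coordinate form an invariant subspace. The identity keeps the \<open>i\<close>-th unit vector out
  of it, so it is zero and cannot contain the \<open>j\<close>-th unit vector. Later proofs use this
  to obtain a group element that connects two prescribed constituents.\<close>

lemma irreducible_coefficient_nonzero:
  assumes irr: "irreducible_rep G \<rho>" and i: "i < dg \<rho>" and j: "j < dg \<rho>"
  shows "\<exists>g\<in>carrier G. \<rho> g $$ (i, j) \<noteq> 0"
proof (rule ccontr)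
  assume "\<not> ?thesis"
  then have z: "\<And>g. g \<in> carrier G \<Longrightarrow> \<rho> g $$ (i, j) = 0" by blast
  let ?n = "dg \<rho>"
  note rep = irreducible_matrix_rep[OF irr]
  note car = rep_carrier[OF rep]
  define W where "W = {v \<in> carrier_vec ?n. \<forall>g\<in>carrier G. (\<rho> g *\<^sub>v v) $ i = 0}"
  have unit: "(\<rho> g *\<^sub>v unit_vec ?n k) $ i = \<rho> g $$ (i, k)" if "g \<in> carrier G" "k < ?n" for g k
    using index_mult_mat_vec_sum[OF car[OF that(1)] _ i, of "unit_vec ?n k"] that
    by (simp add: if_distrib cong: if_cong)
  have idx: "(\<rho> g *\<^sub>v v) $ i = (\<Sum>l<?n. \<rho> g $$ (i, l) * v $ l)"
    if "g \<in> carrier G" "v \<in> carrier_vec ?n" for g v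
    using index_mult_mat_vec_sum[OF car[OF that(1)] that(2) i] .
  have "vec_subspace ?n W"
    unfolding vec_subspace_def W_def
  proof (intro conjI ballI allI)
    fix v w assume "v \<in> {v \<in> carrier_vec ?n. \<forall>g\<in>carrier G. (\<rho> g *\<^sub>v v) $ i = 0}"
      "w \<in> {v \<in> carrier_vec ?n. \<forall>g\<in>carrier G. (\<rho> g *\<^sub>v v) $ i = 0}"
    then have "v \<in> carrier_vec ?n" "w \<in> carrier_vec ?n"
      "\<And>g. g \<in> carrier G \<Longrightarrow> (\<rho> g *\<^sub>v v) $ i + (\<rho> g *\<^sub>v w) $ i = 0" by auto
    then show "v + w \<in> {v \<in> carrier_vec ?n. \<forall>g\<in>carrier G. (\<rho> g *\<^sub>v v) $ i = 0}"
      by (simp add: idx distrib_left sum.distrib del: index_mult_mat_vec)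
  next
    fix c v assume "v \<in> {v \<in> carrier_vec ?n. \<forall>g\<in>carrier G. (\<rho> g *\<^sub>v v) $ i = 0}"
    then have "v \<in> carrier_vec ?n"
      "\<And>g. g \<in> carrier G \<Longrightarrow> c * (\<rho> g *\<^sub>v v) $ i = 0" by auto
    then show "c \<cdot>\<^sub>v v \<in> {v \<in> carrier_vec ?n. \<forall>g\<in>carrier G. (\<rho> g *\<^sub>v v) $ i = 0}"
      by (simp add: idx sum_distrib_left mult.left_commute del: index_mult_mat_vec)
  qed (auto simp: idx simp del: index_mult_mat_vec)
  moreover have "\<rho> h *\<^sub>v w \<in> W" if h: "h \<in> carrier G" and w: "w \<in> W" for h w
  proof -
    have wc: "w \<in> carrier_vec ?n" using w by (auto simp: W_def)
    have "\<rho> g *\<^sub>v (\<rho> h *\<^sub>v w) = \<rho> (g \<otimes> h) *\<^sub>v w" if "g \<in> carrier G" for g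
      using assoc_mult_mat_vec[OF car car wc] rep_mult[OF rep] that h by metis
    then show ?thesis using w h car[OF h] wc
      by (auto simp: W_def simp del: index_mult_mat_vec)
  qed
  ultimately have "W = {0\<^sub>v ?n} \<or> W = carrier_vec ?n" by (rule irreducible_cases[OF irr])
  moreover have "unit_vec ?n j \<in> W" using z unit j by (auto simp: W_def)
  moreover have "unit_vec ?n j \<noteq> 0\<^sub>v ?n" using j by (metis index_unit_vec(2) index_zero_vec(1) zero_neq_one)
  moreover have "unit_vec ?n i \<notin> W"
    using i rep_one[OF rep] by (auto simp: W_def intro!: bexI[of _ \<one>])
  ultimately show False by auto
qed

text \<open>Kernel and image of \<open>T\<close> are invariant, so \<open>T\<close> is bijective.
  Its inverse is built column by column from preimages of the unit vectors.\<close>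

lemma schur_invertible:
  assumes rho: "irreducible_rep G \<rho>" and sig: "irreducible_rep G \<sigma>"
    and T: "T \<in> carrier_mat (dg \<sigma>) (dg \<rho>)"
    and comm: "\<And>g. g \<in> carrier G \<Longrightarrow> T * \<rho> g = \<sigma> g * T"
    and nz: "T \<noteq> 0\<^sub>m (dg \<sigma>) (dg \<rho>)"
  shows "equivalent_reps G \<sigma> \<rho>"
proof -
  let ?m = "dg \<sigma>" and ?n = "dg \<rho>"
  note rcar = rep_carrier[OF irreducible_matrix_rep[OF rho]]
  note scar = rep_carrier[OF irreducible_matrix_rep[OF sig]]
  have step: "T *\<^sub>v (\<rho> g *\<^sub>v v) = \<sigma> g *\<^sub>v (T *\<^sub>v v)" if "g \<in> carrier G" "v \<in> carrier_vec ?n" for g v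
    using comm[OF that(1)] assoc_mult_mat_vec[OF T rcar[OF that(1)] that(2)]
      assoc_mult_mat_vec[OF scar[OF that(1)] T that(2)] by simp
  define K where "K = {v \<in> carrier_vec ?n. T *\<^sub>v v = 0\<^sub>v ?m}"
  define I where "I = (\<lambda>v. T *\<^sub>v v) ` carrier_vec ?n"
  have T0: "T *\<^sub>v 0\<^sub>v ?n = 0\<^sub>v ?m" using T by (auto intro!: eq_vecI)
  have "vec_subspace ?n K"
    unfolding vec_subspace_def K_def using T T0
    by (auto simp: mult_add_distrib_mat_vec mult_mat_vec)
  moreover have "\<rho> g *\<^sub>v w \<in> K" if "g \<in> carrier G" "w \<in> K" for g w
    using that step rcar[OF that(1)] scar[OF that(1)] by (auto simp: K_def intro!: eq_vecI)
  ultimately have K: "K = {0\<^sub>v ?n} \<or> K = carrier_vec ?n" by (rule irreducible_cases[OF rho])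
  have nzv: "\<exists>v\<in>carrier_vec ?n. T *\<^sub>v v \<noteq> 0\<^sub>v ?m"
  proof (rule ccontr)
    assume "\<not> ?thesis"
    then have "T = 0\<^sub>m ?m ?n"
      by (intro mat_eqI_mult_vec[OF T]) (auto intro!: eq_vecI)
    with nz show False by simp
  qed
  then have inj: "K = {0\<^sub>v ?n}" using K by (auto simp: K_def)
  have "vec_subspace ?m I"
    unfolding vec_subspace_def I_def
  proof (intro conjI ballI allI)
    show "0\<^sub>v ?m \<in> (\<lambda>v. T *\<^sub>v v) ` carrier_vec ?n" using T0 by (metis imageI zero_carrier_vec)
    show "(\<lambda>v. T *\<^sub>v v) ` carrier_vec ?n \<subseteq> carrier_vec ?m" using T by auto
  next
    fix v w assume "v \<in> (\<lambda>v. T *\<^sub>v v) ` carrier_vec ?n" "w \<in> (\<lambda>v. T *\<^sub>v v) ` carrier_vec ?n"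
    then show "v + w \<in> (\<lambda>v. T *\<^sub>v v) ` carrier_vec ?n"
      using mult_add_distrib_mat_vec[OF T, symmetric] by auto
  next
    fix c v assume "v \<in> (\<lambda>v. T *\<^sub>v v) ` carrier_vec ?n"
    then show "c \<cdot>\<^sub>v v \<in> (\<lambda>v. T *\<^sub>v v) ` carrier_vec ?n"
      using mult_mat_vec[OF T, symmetric] by auto
  qed
  moreover have "\<sigma> g *\<^sub>v w \<in> I" if "g \<in> carrier G" "w \<in> I" for g w
  proof -
    from that obtain v where v: "v \<in> carrier_vec ?n" "w = T *\<^sub>v v" by (auto simp: I_def)
    then have "\<sigma> g *\<^sub>v w = T *\<^sub>v (\<rho> g *\<^sub>v v)" using step that by simp
    then show ?thesis unfolding I_def using v rcar[OF that(1)] by auto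
  qed
  ultimately have "I = {0\<^sub>v ?m} \<or> I = carrier_vec ?m" by (rule irreducible_cases[OF sig])
  with nzv have surj: "I = carrier_vec ?m" by (auto simp: I_def)
  define f where "f j = (SOME v. v \<in> carrier_vec ?n \<and> T *\<^sub>v v = unit_vec ?m j)" for j
  have f: "f j \<in> carrier_vec ?n \<and> T *\<^sub>v f j = unit_vec ?m j" for j
  proof -
    have "unit_vec ?m j \<in> I" using surj by simp
    then have "\<exists>v. v \<in> carrier_vec ?n \<and> T *\<^sub>v v = unit_vec ?m j" by (force simp: I_def)
    then show ?thesis unfolding f_def by (rule someI_ex)
  qed
  define Q where "Q = mat ?n ?m (\<lambda>(i, j). f j $ i)"
  have Q: "Q \<in> carrier_mat ?n ?m" by (simp add: Q_def)
  have TQ: "T * Q = 1\<^sub>m ?m"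
  proof (rule eq_matI)
    fix i j assume "i < dim_row (1\<^sub>m ?m :: complex mat)" "j < dim_col (1\<^sub>m ?m :: complex mat)"
    then have ij: "i < ?m" "j < ?m" by auto
    have "(T * Q) $$ (i, j) = (T *\<^sub>v f j) $ i"
      using index_mult_mat_sum[OF T Q ij] index_mult_mat_vec_sum[OF T _ ij(1), of "f j"] f[of j] ij
      by (simp add: Q_def del: index_mult_mat_vec index_mult_mat)
    then show "(T * Q) $$ (i, j) = 1\<^sub>m ?m $$ (i, j)" using f[of j] ij by simp
  qed (use T Q in auto)
  have QT: "Q * T = 1\<^sub>m ?n"
  proof (rule mat_eqI_mult_vec)
    fix v :: "complex vec" assume v: "v \<in> carrier_vec ?n"
    have w: "Q *\<^sub>v (T *\<^sub>v v) \<in> carrier_vec ?n" using Q T v by auto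
    have "T *\<^sub>v (Q *\<^sub>v (T *\<^sub>v v)) = (T * Q) *\<^sub>v (T *\<^sub>v v)"
      using T Q v by (intro assoc_mult_mat_vec[symmetric]) auto
    also have "\<dots> = T *\<^sub>v v" using TQ T v by auto
    finally have "T *\<^sub>v (Q *\<^sub>v (T *\<^sub>v v) - v) = 0\<^sub>v ?m"
      using T v w by (subst mult_minus_distrib_mat_vec) auto
    then have "Q *\<^sub>v (T *\<^sub>v v) - v \<in> K" using v w by (auto simp: K_def)
    then have "Q *\<^sub>v (T *\<^sub>v v) - v = 0\<^sub>v ?n" using inj by auto
    then have "(Q *\<^sub>v (T *\<^sub>v v)) $ i - v $ i = 0" if "i < ?n" for i
      using v that by (metis carrier_vecD index_minus_vec(1) index_zero_vec(1))
    then have "Q *\<^sub>v (T *\<^sub>v v) = v" using v w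
      by (intro eq_vecI) (use Q in \<open>auto simp del: index_mult_mat_vec\<close>)
    then show "Q * T *\<^sub>v v = 1\<^sub>m ?n *\<^sub>v v" using assoc_mult_mat_vec[OF Q T v] v by simp
  qed (use T Q in auto)
  have mn: "?m = ?n" using left_inverse_dim_le[OF T Q TQ] left_inverse_dim_le[OF Q T QT] by simp
  have "similar_mat_wit (\<sigma> g) (\<rho> g) T Q" if g: "g \<in> carrier G" for g
  proof (rule similar_mat_witI[OF TQ[unfolded mn] QT])
    have "T * \<rho> g * Q = \<sigma> g * T * Q" using comm[OF g] by simp
    also have "\<dots> = \<sigma> g * (T * Q)" using scar[OF g] T Q by (intro assoc_mult_mat)
    finally show "\<sigma> g = T * \<rho> g * Q" using TQ scar[OF g] by simp
  qed (use T Q mn rcar[OF g] scar[OF g] in auto)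
  then show ?thesis unfolding equivalent_reps_def by blast
qed

lemma schur_zero_index:
  assumes rho: "irreducible_rep G \<rho>" and sig: "irreducible_rep G \<sigma>"
    and ne: "\<not> equivalent_reps G \<sigma> \<rho>"
    and comm: "\<And>g i j. g \<in> carrier G \<Longrightarrow> i < dg \<sigma> \<Longrightarrow> j < dg \<rho> \<Longrightarrow>
      (\<Sum>k<dg \<rho>. F i k * \<rho> g $$ (k, j)) = (\<Sum>k<dg \<sigma>. \<sigma> g $$ (i, k) * F k j)"
    and ij: "i < dg \<sigma>" "j < dg \<rho>"
  shows "F i j = 0"
proof -
  define T where "T = mat (dg \<sigma>) (dg \<rho>) (\<lambda>(i, j). F i j)"
  have T: "T \<in> carrier_mat (dg \<sigma>) (dg \<rho>)" by (simp add: T_def)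
  note rcar = rep_carrier[OF irreducible_matrix_rep[OF rho]]
  note scar = rep_carrier[OF irreducible_matrix_rep[OF sig]]
  have "T * \<rho> g = \<sigma> g * T" if g: "g \<in> carrier G" for g
  proof (rule eq_matI)
    fix i j assume "i < dim_row (\<sigma> g * T)" "j < dim_col (\<sigma> g * T)"
    then have ij: "i < dg \<sigma>" "j < dg \<rho>" using scar[OF g] T by auto
    have "(T * \<rho> g) $$ (i, j) = (\<Sum>k<dg \<rho>. F i k * \<rho> g $$ (k, j))"
      using ij by (subst index_mult_mat_sum[OF T rcar[OF g]]) (auto simp: T_def)
    also have "\<dots> = (\<Sum>k<dg \<sigma>. \<sigma> g $$ (i, k) * F k j)" using comm[OF g ij] .
    also have "\<dots> = (\<sigma> g * T) $$ (i, j)"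
      using ij by (subst index_mult_mat_sum[OF scar[OF g] T]) (auto simp: T_def)
    finally show "(T * \<rho> g) $$ (i, j) = (\<sigma> g * T) $$ (i, j)" .
  qed (use T rcar[OF g] scar[OF g] in auto)
  then have "T = 0\<^sub>m (dg \<sigma>) (dg \<rho>)" using schur_invertible[OF rho sig T] ne by blast
  moreover have "F i j = T $$ (i, j)" using ij by (simp add: T_def)
  ultimately show ?thesis using ij by simp
qed

text \<open>Over the complex numbers \<open>F\<close> has an eigenvalue, and the eigenspace is
  invariant, hence everything. Naming the scalar \<open>F 0 0\<close> avoids an existential
  quantifier in later uses.\<close>

lemma schur_scalar_index:
  assumes rho: "irreducible_rep G \<rho>"
    and comm: "\<And>g i j. g \<in> carrier G \<Longrightarrow> i < dg \<rho> \<Longrightarrow> j < dg \<rho> \<Longrightarrow>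
      (\<Sum>k<dg \<rho>. F i k * \<rho> g $$ (k, j)) = (\<Sum>k<dg \<rho>. \<rho> g $$ (i, k) * F k j)"
    and ij: "i < dg \<rho>" "j < dg \<rho>"
  shows "F i j = (if i = j then F 0 0 else 0)"
proof -
  let ?n = "dg \<rho>"
  define T where "T = mat ?n ?n (\<lambda>(i, j). F i j)"
  have T: "T \<in> carrier_mat ?n ?n" by (simp add: T_def)
  note car = rep_carrier[OF irreducible_matrix_rep[OF rho]]
  have Tg: "T * \<rho> g = \<rho> g * T" if g: "g \<in> carrier G" for g
  proof (rule eq_matI)
    fix i j assume "i < dim_row (\<rho> g * T)" "j < dim_col (\<rho> g * T)"
    then have ij: "i < ?n" "j < ?n" using car[OF g] T by auto
    have "(T * \<rho> g) $$ (i, j) = (\<Sum>k<?n. F i k * \<rho> g $$ (k, j))"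
      using ij by (subst index_mult_mat_sum[OF T car[OF g]]) (auto simp: T_def)
    also have "\<dots> = (\<Sum>k<?n. \<rho> g $$ (i, k) * F k j)" using comm[OF g ij] .
    also have "\<dots> = (\<rho> g * T) $$ (i, j)"
      using ij by (subst index_mult_mat_sum[OF car[OF g] T]) (auto simp: T_def)
    finally show "(T * \<rho> g) $$ (i, j) = (\<rho> g * T) $$ (i, j)" .
  qed (use T car[OF g] in auto)
  obtain c where "eigenvalue T c"
    using spectrum_non_empty[OF T] irreducible_deg_pos[OF rho] by (auto simp: spectrum_def)
  then obtain v where v: "v \<in> carrier_vec ?n" "v \<noteq> 0\<^sub>v ?n" "T *\<^sub>v v = c \<cdot>\<^sub>v v"
    using T by (auto simp: eigenvalue_def eigenvector_def)
  define W where "W = {v \<in> carrier_vec ?n. T *\<^sub>v v = c \<cdot>\<^sub>v v}"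
  have "vec_subspace ?n W"
    unfolding vec_subspace_def W_def using T
    by (auto simp: mult_add_distrib_mat_vec mult_mat_vec smult_add_distrib_vec[of _ ?n]
        smult_smult_assoc mult.commute intro!: eq_vecI)
  moreover have "\<rho> g *\<^sub>v w \<in> W" if "g \<in> carrier G" "w \<in> W" for g w
  proof -
    have w: "w \<in> carrier_vec ?n" "T *\<^sub>v w = c \<cdot>\<^sub>v w" using that by (auto simp: W_def)
    have "T *\<^sub>v (\<rho> g *\<^sub>v w) = \<rho> g *\<^sub>v (T *\<^sub>v w)"
      using Tg[OF that(1)] assoc_mult_mat_vec[OF T car[OF that(1)] w(1)]
        assoc_mult_mat_vec[OF car[OF that(1)] T w(1)] by simp
    then show ?thesis using w car[OF that(1)] by (auto simp: W_def mult_mat_vec)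
  qed
  ultimately have "W = {0\<^sub>v ?n} \<or> W = carrier_vec ?n" by (rule irreducible_cases[OF rho])
  moreover have "v \<in> W" using v by (simp add: W_def)
  ultimately have W: "W = carrier_vec ?n" using v by auto
  have "T = c \<cdot>\<^sub>m 1\<^sub>m ?n"
  proof (rule mat_eqI_mult_vec[OF T])
    fix v :: "complex vec" assume v: "v \<in> carrier_vec ?n"
    then have "v \<in> W" using W by simp
    moreover have "c \<cdot>\<^sub>m 1\<^sub>m ?n *\<^sub>v v = c \<cdot>\<^sub>v v"
    proof (rule eq_vecI)
      fix i assume "i < dim_vec (c \<cdot>\<^sub>v v)"
      then have i: "i < ?n" using v by simp
      have "(c \<cdot>\<^sub>m 1\<^sub>m ?n *\<^sub>v v) $ i = (\<Sum>l<?n. (c \<cdot>\<^sub>m 1\<^sub>m ?n) $$ (i, l) * v $ l)"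
        by (rule index_mult_mat_vec_sum[OF _ v i]) simp
      also have "\<dots> = (\<Sum>l<?n. (if l = i then c * v $ l else 0))"
        by (intro sum.cong refl) (use i in auto)
      finally have "(c \<cdot>\<^sub>m 1\<^sub>m ?n *\<^sub>v v) $ i = (\<Sum>l<?n. (if l = i then c * v $ l else 0))" .
      then show "(c \<cdot>\<^sub>m 1\<^sub>m ?n *\<^sub>v v) $ i = (c \<cdot>\<^sub>v v) $ i" using i v by simp
    qed (use v in auto)
    ultimately show "T *\<^sub>v v = c \<cdot>\<^sub>m 1\<^sub>m ?n *\<^sub>v v" by (simp add: W_def)
  qed simp
  then have "F i j = (if i = j then c else 0)" if "i < ?n" "j < ?n" for i j
    using that by (auto simp: T_def dest!: arg_cong[where f = "\<lambda>M. M $$ (i, j)"])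
  then show ?thesis using ij irreducible_deg_pos[OF rho] by auto
qed


section \<open>Averaging over the group: orthogonality relations and invariant projections\<close>

lemma sum_left_translate:
  "h \<in> carrier G \<Longrightarrow> (\<Sum>g\<in>carrier G. f (h \<otimes> g)) = (\<Sum>g\<in>carrier G. f g)"
  by (rule sum.reindex_bij_witness[where i = "\<lambda>g. inv h \<otimes> g" and j = "\<lambda>g. h \<otimes> g"])
    (auto simp: m_assoc[symmetric])

text \<open>For fixed \<open>j\<close> and \<open>k\<close> the inner sums are entries of the sum of
  \<open>\<rho> g * E * \<sigma> (inv g)\<close> over the group, with \<open>E\<close> the matrix
  unit at \<open>(j, k)\<close>. Substituting \<open>h \<otimes> g\<close> for \<open>g\<close>
  moves \<open>h\<close> from one side to the other.\<close>

lemma average_intertwines: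
  assumes rho: "matrix_rep G \<rho>" and sig: "matrix_rep G \<sigma>" and h: "h \<in> carrier G"
    and ij: "i < dg \<rho>" "j < dg \<rho>" and kl: "k < dg \<sigma>" "l < dg \<sigma>"
  shows "(\<Sum>m<dg \<sigma>. (\<Sum>g\<in>carrier G. \<rho> g $$ (i, j) * \<sigma> (inv g) $$ (k, m)) * \<sigma> h $$ (m, l)) =
    (\<Sum>m<dg \<rho>. \<rho> h $$ (i, m) * (\<Sum>g\<in>carrier G. \<rho> g $$ (m, j) * \<sigma> (inv g) $$ (k, l)))"
proof -
  define \<phi> where "\<phi> g = \<rho> g $$ (i, j) * \<sigma> (inv g \<otimes> h) $$ (k, l)" for g
  have "(\<Sum>m<dg \<sigma>. (\<Sum>g\<in>carrier G. \<rho> g $$ (i, j) * \<sigma> (inv g) $$ (k, m)) * \<sigma> h $$ (m, l))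
      = (\<Sum>g\<in>carrier G. \<phi> g)"
    unfolding \<phi>_def sum_distrib_right
    by (subst sum.swap) (auto simp: rep_mult_index[OF sig _ h kl] sum_distrib_left mult.assoc intro!: sum.cong)
  also have "\<dots> = (\<Sum>g\<in>carrier G. \<phi> (h \<otimes> g))"
    by (rule sum_left_translate[OF h, symmetric])
  also have "\<dots> = (\<Sum>g\<in>carrier G. \<rho> (h \<otimes> g) $$ (i, j) * \<sigma> (inv g) $$ (k, l))"
    unfolding \<phi>_def by (intro sum.cong refl) (use h in \<open>simp add: inv_mult_group m_assoc\<close>)
  also have "\<dots> = (\<Sum>m<dg \<rho>. \<rho> h $$ (i, m) * (\<Sum>g\<in>carrier G. \<rho> g $$ (m, j) * \<sigma> (inv g) $$ (k, l)))"
    unfolding sum_distrib_left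
    by (subst sum.swap) (auto simp: rep_mult_index[OF rho h _ ij] sum_distrib_right mult.assoc intro!: sum.cong)
  finally show ?thesis .
qed

lemma orthogonality_inequivalent:
  assumes rho: "irreducible_rep G \<rho>" and sig: "irreducible_rep G \<sigma>"
    and ne: "\<not> equivalent_reps G \<rho> \<sigma>"
    and ij: "i < dg \<rho>" "j < dg \<rho>" and kl: "k < dg \<sigma>" "l < dg \<sigma>"
  shows "(\<Sum>g\<in>carrier G. \<rho> g $$ (i, j) * \<sigma> (inv g) $$ (k, l)) = 0"
  by (rule schur_zero_index[OF sig rho ne,
        where F = "\<lambda>i l. \<Sum>g\<in>carrier G. \<rho> g $$ (i, j) * \<sigma> (inv g) $$ (k, l)"])
    (use ij kl average_intertwines[OF irreducible_matrix_rep[OF rho] irreducible_matrix_rep[OF sig]]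
      in auto)

text \<open>Schur's lemma leaves one unknown scalar. Summing the entries with \<open>i = l\<close>,
  that is taking the trace, collapses the product to \<open>\<rho> (inv g \<otimes> g)\<close> and
  determines it.\<close>

lemma orthogonality_same:
  assumes rho: "irreducible_rep G \<rho>"
    and ij: "i < dg \<rho>" "j < dg \<rho>" and kl: "k < dg \<rho>" "l < dg \<rho>"
  shows "(\<Sum>g\<in>carrier G. \<rho> g $$ (i, j) * \<rho> (inv g) $$ (k, l)) =
    (if i = l \<and> j = k then of_nat (card (carrier G)) / of_nat (dg \<rho>) else 0)"
proof -
  note rep = irreducible_matrix_rep[OF rho]
  define F where "F i l = (\<Sum>g\<in>carrier G. \<rho> g $$ (i, j) * \<rho> (inv g) $$ (k, l))" for i l
  have F: "F i l = (if i = l then F 0 0 else 0)" if "i < dg \<rho>" "l < dg \<rho>" for i l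
    by (rule schur_scalar_index[OF rho]) (use ij kl that average_intertwines[OF rep rep] in \<open>auto simp: F_def\<close>)
  have "(\<Sum>i<dg \<rho>. F i i) = (\<Sum>i<dg \<rho>. F 0 0)"
    by (rule sum.cong[OF refl]) (use F in \<open>metis lessThan_iff\<close>)
  then have "of_nat (dg \<rho>) * F 0 0 = (\<Sum>i<dg \<rho>. F i i)" by simp
  also have "\<dots> = (\<Sum>g\<in>carrier G. \<rho> (inv g \<otimes> g) $$ (k, j))"
    unfolding F_def
  proof (subst sum.swap, intro sum.cong refl)
    fix g assume g: "g \<in> carrier G"
    show "(\<Sum>i<dg \<rho>. \<rho> g $$ (i, j) * \<rho> (inv g) $$ (k, i)) = \<rho> (inv g \<otimes> g) $$ (k, j)"
      using rep_mult_index[OF rep inv_closed[OF g] g kl(1) ij(2)] by (simp add: mult.commute del: l_inv)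
  qed
  also have "\<dots> = (\<Sum>g\<in>carrier G. if j = k then 1 else 0)"
    by (intro sum.cong refl) (use ij kl in \<open>simp add: rep_one[OF rep]\<close>)
  finally have "of_nat (dg \<rho>) * F 0 0 = (if j = k then of_nat (card (carrier G)) else 0)" by simp
  then have "F 0 0 = (if j = k then of_nat (card (carrier G)) / of_nat (dg \<rho>) else 0)"
    using irreducible_deg_pos[OF rho] by (auto simp: field_simps split: if_splits)
  moreover have "F i l = (if i = l then F 0 0 else 0)" by (rule F) (use ij kl in auto)
  ultimately show ?thesis unfolding F_def[of i l] by auto
qed

text \<open>\<open>B\<close> and \<open>C\<close> are coordinates for the image of the projection
  \<open>B * C\<close>; as this commutes with the group, the image is a subrepresentation.\<close>

lemma compress_rep:
  assumes rep: "matrix_rep G \<rho>" and B: "B \<in> carrier_mat (dg \<rho>) k" and C: "C \<in> carrier_mat k (dg \<rho>)"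
    and CB: "C * B = 1\<^sub>m k"
    and comm: "\<And>g. g \<in> carrier G \<Longrightarrow> \<rho> g * (B * C) = (B * C) * \<rho> g"
  shows "matrix_rep G (\<lambda>g. C * \<rho> g * B)" "dg (\<lambda>g. C * \<rho> g * B) = k"
    "\<And>g. g \<in> carrier G \<Longrightarrow> \<rho> g * B = B * (C * \<rho> g * B)"
proof -
  let ?n = "dg \<rho>"
  note car = rep_carrier[OF rep]
  show dg: "dg (\<lambda>g. C * \<rho> g * B) = k" using C by (simp add: rep_degree_def)
  show *: "\<rho> g * B = B * (C * \<rho> g * B)" if g: "g \<in> carrier G" for g
  proof -
    have "B * (C * \<rho> g * B) = B * C * \<rho> g * B"
      using B C car[OF g] by (simp add: assoc_mult_mat[of _ ?n k _ ?n _ k] assoc_mult_mat[of _ ?n k _ ?n _ ?n]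
          assoc_mult_mat[of _ k ?n _ ?n _ k] assoc_mult_mat[of _ ?n ?n _ ?n _ k])
    also have "\<dots> = \<rho> g * (B * C) * B" using comm[OF g] by simp
    also have "\<dots> = \<rho> g * (B * (C * B))"
      using B C car[OF g] by (simp add: assoc_mult_mat[of _ ?n k _ ?n _ k]
          assoc_mult_mat[of _ ?n ?n _ ?n _ k])
    finally show ?thesis using CB B by simp
  qed
  have m: "C * \<rho> (g \<otimes> h) * B = C * \<rho> g * B * (C * \<rho> h * B)"
    if g: "g \<in> carrier G" and h: "h \<in> carrier G" for g h
  proof -
    have "C * \<rho> g * B * (C * \<rho> h * B) = C * \<rho> g * (B * (C * \<rho> h * B))"
      using B C car[OF g] car[OF h] by (intro assoc_mult_mat) auto
    also have "\<dots> = C * \<rho> g * (\<rho> h * B)" using *[OF h] by simp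
    also have "\<dots> = C * (\<rho> g * \<rho> h) * B"
      using B C car[OF g] car[OF h] by (simp add: assoc_mult_mat[of _ k ?n _ ?n _ k]
          assoc_mult_mat[of _ ?n ?n _ ?n _ k])
    finally show ?thesis using rep_mult[OF rep g h] by simp
  qed
  show "matrix_rep G (\<lambda>g. C * \<rho> g * B)"
    unfolding matrix_rep_def dg using m B C car CB rep_one[OF rep] by auto
qed

text \<open>Maschke's averaging: a projection \<open>P\<close> onto \<open>W\<close> is replaced by
  the mean of its conjugates \<open>\<rho> g * P * \<rho> (inv g)\<close>. The mean still maps into
  \<open>W\<close> and fixes \<open>W\<close>, and translating the summation variable shows that it
  commutes with the group.\<close>

lemma invariant_projection:
  assumes rep: "matrix_rep G \<rho>" and W: "vec_subspace (dg \<rho>) W"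
    and inv: "\<And>g w. g \<in> carrier G \<Longrightarrow> w \<in> W \<Longrightarrow> \<rho> g *\<^sub>v w \<in> W"
  obtains E where "E \<in> carrier_mat (dg \<rho>) (dg \<rho>)"
    "\<And>v. v \<in> carrier_vec (dg \<rho>) \<Longrightarrow> E *\<^sub>v v \<in> W" "\<And>w. w \<in> W \<Longrightarrow> E *\<^sub>v w = w"
    "\<And>g. g \<in> carrier G \<Longrightarrow> \<rho> g * E = E * \<rho> g"
proof -
  let ?n = "dg \<rho>"
  note car = rep_carrier[OF rep]
  obtain k B C where B: "B \<in> carrier_mat ?n k" and C: "C \<in> carrier_mat k ?n"
    and BW: "\<And>v. v \<in> carrier_vec k \<Longrightarrow> B *\<^sub>v v \<in> W" and fix_W: "\<And>w. w \<in> W \<Longrightarrow> B *\<^sub>v (C *\<^sub>v w) = w"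
    using vec_subspace_factorization[OF W] by metis
  have Wc: "\<And>w. w \<in> W \<Longrightarrow> w \<in> carrier_vec ?n" using W by (auto simp: vec_subspace_def)
  define P where "P = B * C"
  have P: "P \<in> carrier_mat ?n ?n" using B C by (auto simp: P_def)
  have PW: "P *\<^sub>v v \<in> W" if "v \<in> carrier_vec ?n" for v
    using BW[of "C *\<^sub>v v"] that C by (auto simp: P_def assoc_mult_mat_vec[OF B C])
  have Pfix: "P *\<^sub>v w = w" if "w \<in> W" for w
    using fix_W[OF that] Wc[OF that] by (auto simp: P_def assoc_mult_mat_vec[OF B C])
  define N where "N = (of_nat (card (carrier G)) :: complex)"
  have N: "N \<noteq> 0" using finite_carrier one_closed by (auto simp: N_def card_eq_0_iff)
  define M where "M g = \<rho> g * P * \<rho> (inv g)" for g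
  have M: "M g \<in> carrier_mat ?n ?n" if "g \<in> carrier G" for g
    using car[OF that] car[OF inv_closed[OF that]] P by (auto simp: M_def)
  have Mv: "M g *\<^sub>v v = \<rho> g *\<^sub>v (P *\<^sub>v (\<rho> (inv g) *\<^sub>v v))" if "g \<in> carrier G" "v \<in> carrier_vec ?n" for g v
    using car[OF that(1)] car[OF inv_closed[OF that(1)]] P that
    by (simp add: M_def assoc_mult_mat_vec[of _ ?n ?n _ ?n])
  define E where "E = mat ?n ?n (\<lambda>(i, j). (\<Sum>g\<in>carrier G. M g $$ (i, j)) / N)"
  have E: "E \<in> carrier_mat ?n ?n" by (simp add: E_def)
  have Ev: "E *\<^sub>v v = (1 / N) \<cdot>\<^sub>v vec ?n (\<lambda>i. \<Sum>g\<in>carrier G. (M g *\<^sub>v v) $ i)"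
    if v: "v \<in> carrier_vec ?n" for v
  proof (rule eq_vecI)
    fix i assume "i < dim_vec ((1 / N) \<cdot>\<^sub>v vec ?n (\<lambda>i. \<Sum>g\<in>carrier G. (M g *\<^sub>v v) $ i))"
    then have i: "i < ?n" by simp
    have "(E *\<^sub>v v) $ i = (\<Sum>l<?n. (\<Sum>g\<in>carrier G. M g $$ (i, l)) / N * v $ l)"
      by (subst index_mult_mat_vec_sum[OF E v i]) (use i in \<open>auto simp: E_def\<close>)
    also have "\<dots> = (\<Sum>g\<in>carrier G. \<Sum>l<?n. M g $$ (i, l) * v $ l) / N"
      by (subst sum.swap) (simp add: sum_distrib_right sum_divide_distrib)
    also have "\<dots> = (\<Sum>g\<in>carrier G. (M g *\<^sub>v v) $ i) / N"
      using index_mult_mat_vec_sum[OF M v i] by simp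
    finally show "(E *\<^sub>v v) $ i = ((1 / N) \<cdot>\<^sub>v vec ?n (\<lambda>i. \<Sum>g\<in>carrier G. (M g *\<^sub>v v) $ i)) $ i"
      using i by simp
  qed (use E in auto)
  have "E *\<^sub>v v \<in> W" if v: "v \<in> carrier_vec ?n" for v
  proof -
    have "vec ?n (\<lambda>i. \<Sum>g\<in>carrier G. (M g *\<^sub>v v) $ i) \<in> W"
      proof (rule vec_subspace_sum[OF W finite_carrier])
      fix g assume g: "g \<in> carrier G"
      have "\<rho> (inv g) *\<^sub>v v \<in> carrier_vec ?n" using car[OF inv_closed[OF g]] v by auto
      then show "M g *\<^sub>v v \<in> W" using Mv[OF g v] inv[OF g PW] by simp
    qed
    then show ?thesis using W unfolding Ev[OF v] vec_subspace_def by blast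
  qed
  moreover have "E *\<^sub>v w = w" if w: "w \<in> W" for w
  proof -
    have "M g *\<^sub>v w = w" if g: "g \<in> carrier G" for g
    proof -
      have "P *\<^sub>v (\<rho> (inv g) *\<^sub>v w) = \<rho> (inv g) *\<^sub>v w" using Pfix inv w g by simp
      then have "M g *\<^sub>v w = (\<rho> g * \<rho> (inv g)) *\<^sub>v w"
        using Mv[OF g Wc[OF w]] assoc_mult_mat_vec[OF car[OF g] car[OF inv_closed[OF g]] Wc[OF w]] by simp
      also have "\<rho> g * \<rho> (inv g) = 1\<^sub>m ?n"
        using rep_mult[OF rep g inv_closed[OF g]] g rep_one[OF rep] by simp
      finally show ?thesis using Wc[OF w] by simp
    qed
    then show ?thesis unfolding Ev[OF Wc[OF w]]
      using Wc[OF w] N by (intro eq_vecI) (auto simp: N_def)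
  qed
  moreover have "\<rho> h * E = E * \<rho> h" if h: "h \<in> carrier G" for h
  proof (rule eq_matI)
    have tr: "M (h \<otimes> g) * \<rho> h = \<rho> h * M g" if g: "g \<in> carrier G" for g
    proof -
      have "\<rho> (inv (h \<otimes> g)) * \<rho> h = \<rho> (inv g)"
        using g h by (simp add: rep_mult[OF rep, symmetric] inv_mult_group m_assoc)
      moreover have "M (h \<otimes> g) * \<rho> h = \<rho> h * \<rho> g * P * (\<rho> (inv (h \<otimes> g)) * \<rho> h)"
        using car[OF g] car[OF h] P car[of "inv (h \<otimes> g)"] g h
        by (simp add: M_def rep_mult[OF rep] assoc_mult_mat[of _ ?n ?n _ ?n _ ?n])
      ultimately show ?thesis using car[OF g] car[OF h] P car[of "inv g"] g h
        by (simp add: M_def assoc_mult_mat[of _ ?n ?n _ ?n _ ?n])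
    qed
    fix i j assume "i < dim_row (E * \<rho> h)" "j < dim_col (E * \<rho> h)"
    then have ij: "i < ?n" "j < ?n" using E car[OF h] by auto
    have "(E * \<rho> h) $$ (i, j) = (\<Sum>l<?n. (\<Sum>g\<in>carrier G. M g $$ (i, l)) / N * \<rho> h $$ (l, j))"
      by (subst index_mult_mat_sum[OF E car[OF h] ij]) (use ij in \<open>auto simp: E_def\<close>)
    also have "\<dots> = (\<Sum>g\<in>carrier G. \<Sum>l<?n. M g $$ (i, l) * \<rho> h $$ (l, j)) / N"
      by (subst sum.swap) (simp add: sum_distrib_right sum_divide_distrib)
    also have "(\<Sum>g\<in>carrier G. \<Sum>l<?n. M g $$ (i, l) * \<rho> h $$ (l, j)) =
        (\<Sum>g\<in>carrier G. (M g * \<rho> h) $$ (i, j))"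
      using index_mult_mat_sum[OF M car[OF h] ij] by simp
    also have "\<dots> = (\<Sum>g\<in>carrier G. (M (h \<otimes> g) * \<rho> h) $$ (i, j))"
      using sum_left_translate[OF h, of "\<lambda>g. (M g * \<rho> h) $$ (i, j)"] by simp
    also have "\<dots> = (\<Sum>g\<in>carrier G. (\<rho> h * M g) $$ (i, j))"
      using tr by simp
    also have "\<dots> = (\<Sum>g\<in>carrier G. \<Sum>l<?n. \<rho> h $$ (i, l) * M g $$ (l, j))"
      using index_mult_mat_sum[OF car[OF h] M ij] by simp
    also have "\<dots> / N = (\<Sum>l<?n. \<rho> h $$ (i, l) * ((\<Sum>g\<in>carrier G. M g $$ (l, j)) / N))"
      by (subst sum.swap) (simp add: sum_distrib_left sum_divide_distrib)
    also have "\<dots> = (\<rho> h * E) $$ (i, j)"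
      by (subst index_mult_mat_sum[OF car[OF h] E ij]) (use ij in \<open>auto simp: E_def\<close>)
    finally show "(\<rho> h * E) $$ (i, j) = (E * \<rho> h) $$ (i, j)" by simp
  qed (use E car[OF h] in auto)
  ultimately show thesis using that E by blast
qed

end

section \<open>Complete reducibility\<close>

context finite_group
begin

lemma maschke_split:
  assumes rep: "matrix_rep G \<rho>" and pos: "0 < dg \<rho>" and red: "\<not> irreducible_rep G \<rho>"
  obtains k l \<rho>1 \<rho>2 P Q where "0 < k" "0 < l" "k + l = dg \<rho>"
    "matrix_rep G \<rho>1" "dg \<rho>1 = k" "matrix_rep G \<rho>2" "dg \<rho>2 = l"
    "P \<in> carrier_mat (dg \<rho>) (dg \<rho>)" "Q \<in> carrier_mat (dg \<rho>) (dg \<rho>)"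
    "P * Q = 1\<^sub>m (dg \<rho>)" "Q * P = 1\<^sub>m (dg \<rho>)"
    "\<And>g. g \<in> carrier G \<Longrightarrow>
      \<rho> g * P = P * four_block_mat (\<rho>1 g) (0\<^sub>m k l) (0\<^sub>m l k) (\<rho>2 g)"
proof -
  let ?n = "dg \<rho>"
  note car = rep_carrier[OF rep]
  obtain W where W: "vec_subspace ?n W" and inv: "\<And>g w. g \<in> carrier G \<Longrightarrow> w \<in> W \<Longrightarrow> \<rho> g *\<^sub>v w \<in> W"
    and W0: "W \<noteq> {0\<^sub>v ?n}" and W1: "W \<noteq> carrier_vec ?n"
    using red rep pos unfolding irreducible_rep_iff by blast
  have Wc: "\<And>w. w \<in> W \<Longrightarrow> w \<in> carrier_vec ?n" using W by (auto simp: vec_subspace_def)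
  obtain E where E: "E \<in> carrier_mat ?n ?n" and EW: "\<And>v. v \<in> carrier_vec ?n \<Longrightarrow> E *\<^sub>v v \<in> W"
    and Efix: "\<And>w. w \<in> W \<Longrightarrow> E *\<^sub>v w = w" and Ecomm: "\<And>g. g \<in> carrier G \<Longrightarrow> \<rho> g * E = E * \<rho> g"
    using invariant_projection[OF rep W inv] by blast
  define F where "F = 1\<^sub>m ?n - E"
  have F: "F \<in> carrier_mat ?n ?n" using E by (auto simp: F_def)
  have Fv: "F *\<^sub>v v = v - E *\<^sub>v v" if "v \<in> carrier_vec ?n" for v
    using that E by (simp add: F_def minus_mult_distrib_mat_vec[of _ ?n ?n])
  \<comment> \<open>The complement of \<open>W\<close>: the kernel of the invariant projection,
    which is also the image of \<open>F\<close>.\<close>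
  define U where "U = {v \<in> carrier_vec ?n. E *\<^sub>v v = 0\<^sub>v ?n}"
  have E0: "E *\<^sub>v 0\<^sub>v ?n = 0\<^sub>v ?n" using E by (auto intro!: eq_vecI)
  have U: "vec_subspace ?n U"
    unfolding vec_subspace_def U_def using E E0
    by (auto simp: mult_add_distrib_mat_vec mult_mat_vec)
  have FU: "F *\<^sub>v v \<in> U" if v: "v \<in> carrier_vec ?n" for v
  proof -
    have Evc: "E *\<^sub>v v \<in> carrier_vec ?n" using E v by auto
    have "E *\<^sub>v (v - E *\<^sub>v v) = E *\<^sub>v v - E *\<^sub>v (E *\<^sub>v v)"
      using mult_minus_distrib_mat_vec[OF E v Evc] .
    also have "\<dots> = 0\<^sub>v ?n" using Efix[OF EW[OF v]] Evc by simp
    finally show ?thesis using v Evc Fv[OF v] by (auto simp: U_def)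
  qed
  have Ffix: "F *\<^sub>v u = u" if "u \<in> U" for u
    using that Fv[of u] by (auto simp: U_def)
  have Fcomm: "\<rho> g * F = F * \<rho> g" if g: "g \<in> carrier G" for g
    using car[OF g] E Ecomm[OF g]
    by (simp add: F_def minus_mult_distrib_mat[of _ ?n ?n]
        mult_minus_distrib_mat[OF car[OF g] one_carrier_mat E])
  obtain k B C0 where B: "B \<in> carrier_mat ?n k" and C0: "C0 \<in> carrier_mat k ?n" and C0B: "C0 * B = 1\<^sub>m k"
    and BW: "\<And>v. v \<in> carrier_vec k \<Longrightarrow> B *\<^sub>v v \<in> W" and BC0: "\<And>w. w \<in> W \<Longrightarrow> B *\<^sub>v (C0 *\<^sub>v w) = w"
    using vec_subspace_factorization[OF W] by metis
  obtain l D D0 where D: "D \<in> carrier_mat ?n l" and D0: "D0 \<in> carrier_mat l ?n" and D0D: "D0 * D = 1\<^sub>m l"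
    and DU: "\<And>v. v \<in> carrier_vec l \<Longrightarrow> D *\<^sub>v v \<in> U" and DD0: "\<And>w. w \<in> U \<Longrightarrow> D *\<^sub>v (D0 *\<^sub>v w) = w"
    using vec_subspace_factorization[OF U] by metis
  have EB: "E * B = B"
    by (rule mat_eqI_mult_vec) (use E B BW Efix in \<open>auto simp: assoc_mult_mat_vec[OF E B]\<close>)
  have FD: "F * D = D"
    by (rule mat_eqI_mult_vec) (use F D DU Ffix in \<open>auto simp: assoc_mult_mat_vec[OF F D]\<close>)
  have FB: "F * B = 0\<^sub>m ?n k"
    using E B EB by (simp add: F_def minus_mult_distrib_mat[of _ ?n ?n])
  have ED: "E * D = 0\<^sub>m ?n l"
  proof (rule mat_eqI_mult_vec)
    fix v :: "complex vec" assume v: "v \<in> carrier_vec l"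
    then have "E *\<^sub>v (D *\<^sub>v v) = 0\<^sub>v ?n" using DU by (auto simp: U_def)
    then show "E * D *\<^sub>v v = 0\<^sub>m ?n l *\<^sub>v v"
      using v by (auto simp: assoc_mult_mat_vec[OF E D] intro!: eq_vecI)
  qed (use E D in auto)
  define C where "C = C0 * E"
  define C' where "C' = D0 * F"
  have C: "C \<in> carrier_mat k ?n" using C0 E by (auto simp: C_def)
  have C': "C' \<in> carrier_mat l ?n" using D0 F by (auto simp: C'_def)
  have BC: "B * C = E"
  proof (rule mat_eqI_mult_vec)
    fix v :: "complex vec" assume v: "v \<in> carrier_vec ?n"
    have "B * C *\<^sub>v v = B *\<^sub>v (C0 *\<^sub>v (E *\<^sub>v v))"
      using assoc_mult_mat_vec[OF B C v] assoc_mult_mat_vec[OF C0 E v] by (simp add: C_def)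
    then show "B * C *\<^sub>v v = E *\<^sub>v v" using BC0[OF EW[OF v]] by simp
  qed (use B C E in auto)
  have DC': "D * C' = F"
  proof (rule mat_eqI_mult_vec)
    fix v :: "complex vec" assume v: "v \<in> carrier_vec ?n"
    have "D * C' *\<^sub>v v = D *\<^sub>v (D0 *\<^sub>v (F *\<^sub>v v))"
      using assoc_mult_mat_vec[OF D C' v] assoc_mult_mat_vec[OF D0 F v] by (simp add: C'_def)
    then show "D * C' *\<^sub>v v = F *\<^sub>v v" using DD0[OF FU[OF v]] by simp
  qed (use D C' F in auto)
  have CB: "C * B = 1\<^sub>m k" using assoc_mult_mat[OF C0 E B] EB C0B by (simp add: C_def)
  have C'D: "C' * D = 1\<^sub>m l" using assoc_mult_mat[OF D0 F D] FD D0D by (simp add: C'_def)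
  have CD: "C * D = 0\<^sub>m k l" using assoc_mult_mat[OF C0 E D] ED C0 by (simp add: C_def)
  have C'B: "C' * B = 0\<^sub>m l k" using assoc_mult_mat[OF D0 F B] FB D0 by (simp add: C'_def)
  \<comment> \<open>Blocks of height or width zero make \<open>four_block_mat\<close> a plain
    concatenation: \<open>P\<close> puts the bases of \<open>W\<close> and \<open>U\<close> side by
    side, \<open>Q\<close> stacks their coordinate maps.\<close>
  define P where "P = four_block_mat B D (0\<^sub>m 0 k) (0\<^sub>m 0 l)"
  define Q where "Q = four_block_mat C (0\<^sub>m k 0) C' (0\<^sub>m l 0)"
  have P': "P \<in> carrier_mat (?n + 0) (k + l)" and Q': "Q \<in> carrier_mat (k + l) (?n + 0)"
    unfolding P_def Q_def using B D C C' by (auto intro!: four_block_carrier_mat)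
  have "P * Q = four_block_mat (B * C + D * C') (B * 0\<^sub>m k 0 + D * 0\<^sub>m l 0)
      (0\<^sub>m 0 k * C + 0\<^sub>m 0 l * C') (0\<^sub>m 0 k * 0\<^sub>m k 0 + 0\<^sub>m 0 l * 0\<^sub>m l 0)"
    unfolding P_def Q_def by (rule mult_four_block_mat) (use B D C C' in auto)
  also have "\<dots> = 1\<^sub>m ?n"
    unfolding BC DC' using E F by (intro eq_matI) (auto simp: F_def)
  finally have PQ: "P * Q = 1\<^sub>m ?n" .
  have "Q * P = four_block_mat (C * B + 0\<^sub>m k 0 * 0\<^sub>m 0 k) (C * D + 0\<^sub>m k 0 * 0\<^sub>m 0 l)
      (C' * B + 0\<^sub>m l 0 * 0\<^sub>m 0 k) (C' * D + 0\<^sub>m l 0 * 0\<^sub>m 0 l)"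
    unfolding P_def Q_def by (rule mult_four_block_mat) (use B D C C' in auto)
  also have "\<dots> = 1\<^sub>m (k + l)"
    unfolding CB CD C'B C'D by (intro eq_matI) auto
  finally have QP: "Q * P = 1\<^sub>m (k + l)" .
  have kl: "k + l = ?n"
    using left_inverse_dim_le[of P ?n "k + l" Q] left_inverse_dim_le[of Q "k + l" ?n P] P' Q' PQ QP by simp
  have "k \<noteq> 0"
  proof
    assume k: "k = 0"
    have "w = 0\<^sub>v ?n" if "w \<in> W" for w
    proof -
      have "B *\<^sub>v (C0 *\<^sub>v w) = 0\<^sub>v ?n" using B C0 k by (intro eq_vecI) (auto simp: scalar_prod_def)
      then show ?thesis using BC0[OF that] by simp
    qed
    then show False using W0 W by (auto simp: vec_subspace_def)
  qed
  moreover have "l \<noteq> 0"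
  proof
    assume l: "l = 0"
    have "v \<in> W" if v: "v \<in> carrier_vec ?n" for v
    proof -
      have "D *\<^sub>v (D0 *\<^sub>v (F *\<^sub>v v)) = 0\<^sub>v ?n" using D D0 l by (intro eq_vecI) (auto simp: scalar_prod_def)
      then have "v - E *\<^sub>v v = 0\<^sub>v ?n" using DD0[OF FU[OF v]] Fv[OF v] by simp
      then have "(v - E *\<^sub>v v) $ i = 0" if "i < ?n" for i using that by simp
      then have "v = E *\<^sub>v v" using E v by (intro eq_vecI) (auto simp del: index_mult_mat_vec)
      then show ?thesis using EW[OF v] by simp
    qed
    then show False using W1 Wc by auto
  qed
  moreover have "matrix_rep G (\<lambda>g. C * \<rho> g * B)" "dg (\<lambda>g. C * \<rho> g * B) = k"
    and r1: "\<And>g. g \<in> carrier G \<Longrightarrow> \<rho> g * B = B * (C * \<rho> g * B)"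
    using compress_rep[OF rep B C CB] Ecomm BC by auto
  moreover have "matrix_rep G (\<lambda>g. C' * \<rho> g * D)" "dg (\<lambda>g. C' * \<rho> g * D) = l"
    and r2: "\<And>g. g \<in> carrier G \<Longrightarrow> \<rho> g * D = D * (C' * \<rho> g * D)"
    using compress_rep[OF rep D C' C'D] Fcomm DC' by auto
  moreover have "\<rho> g * P = P * four_block_mat (C * \<rho> g * B) (0\<^sub>m k l) (0\<^sub>m l k) (C' * \<rho> g * D)"
    if g: "g \<in> carrier G" for g
  proof -
    have c: "C * \<rho> g * B \<in> carrier_mat k k" "C' * \<rho> g * D \<in> carrier_mat l l"
      using B C D C' car[OF g] by auto
    have "P * four_block_mat (C * \<rho> g * B) (0\<^sub>m k l) (0\<^sub>m l k) (C' * \<rho> g * D) =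
        four_block_mat (B * (C * \<rho> g * B) + D * 0\<^sub>m l k) (B * 0\<^sub>m k l + D * (C' * \<rho> g * D))
          (0\<^sub>m 0 k * (C * \<rho> g * B) + 0\<^sub>m 0 l * 0\<^sub>m l k) (0\<^sub>m 0 k * 0\<^sub>m k l + 0\<^sub>m 0 l * (C' * \<rho> g * D))"
      unfolding P_def by (rule mult_four_block_mat[OF B D zero_carrier_mat zero_carrier_mat
            c(1) zero_carrier_mat zero_carrier_mat c(2)])
    also have "\<dots> = four_block_mat (\<rho> g * B) (\<rho> g * D) (0\<^sub>m 0 k) (0\<^sub>m 0 l)"
    proof (rule cong_four_block_mat)
      show "B * (C * \<rho> g * B) + D * 0\<^sub>m l k = \<rho> g * B"
        using r1[OF g] right_mult_zero_mat[OF D] right_add_zero_mat[OF mult_carrier_mat[OF B c(1)]] by simp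
      show "B * 0\<^sub>m k l + D * (C' * \<rho> g * D) = \<rho> g * D"
        using r2[OF g] right_mult_zero_mat[OF B] left_add_zero_mat[OF mult_carrier_mat[OF D c(2)]] by simp
      show "0\<^sub>m 0 k * (C * \<rho> g * B) + 0\<^sub>m 0 l * 0\<^sub>m l k = 0\<^sub>m 0 k"
        using c by (intro eq_matI) auto
      show "0\<^sub>m 0 k * 0\<^sub>m k l + 0\<^sub>m 0 l * (C' * \<rho> g * D) = 0\<^sub>m 0 l"
        using c by (intro eq_matI) auto
    qed
    also have "\<dots> = four_block_mat (\<rho> g * B + 0\<^sub>m ?n 0 * 0\<^sub>m 0 k) (\<rho> g * D + 0\<^sub>m ?n 0 * 0\<^sub>m 0 l)
        (0\<^sub>m 0 ?n * B + 0\<^sub>m 0 0 * 0\<^sub>m 0 k) (0\<^sub>m 0 ?n * D + 0\<^sub>m 0 0 * 0\<^sub>m 0 l)"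
      using B D car[OF g] by (intro cong_four_block_mat) auto
    also have "\<dots> = four_block_mat (\<rho> g) (0\<^sub>m ?n 0) (0\<^sub>m 0 ?n) (0\<^sub>m 0 0) * P"
      unfolding P_def by (rule mult_four_block_mat[OF car[OF g] zero_carrier_mat zero_carrier_mat
            zero_carrier_mat B D zero_carrier_mat zero_carrier_mat, symmetric])
    also have "four_block_mat (\<rho> g) (0\<^sub>m ?n 0) (0\<^sub>m 0 ?n) (0\<^sub>m 0 0) = \<rho> g"
      using car[OF g] by (intro eq_matI) auto
    finally show ?thesis by simp
  qed
  ultimately show thesis using that[of k l "\<lambda>g. C * \<rho> g * B" "\<lambda>g. C' * \<rho> g * D" P Q] kl P' Q' PQ QP by auto
qed

text \<open>Induction on the degree, splitting by \<open>maschke_split\<close>; degree zero is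
  covered by the empty list. One conjugating matrix serves all \<open>g\<close>, and the blocks are
  literally members of \<open>R\<close>, as adaptedness demands.\<close>

lemma complete_reducibility:
  assumes R: "complete_irreps G R" and rep: "matrix_rep G \<rho>"
  shows "\<exists>\<sigma>s P Q. set \<sigma>s \<subseteq> R \<and> P \<in> carrier_mat (dg \<rho>) (dg \<rho>) \<and> Q \<in> carrier_mat (dg \<rho>) (dg \<rho>) \<and>
    P * Q = 1\<^sub>m (dg \<rho>) \<and> Q * P = 1\<^sub>m (dg \<rho>) \<and>
    (\<forall>g\<in>carrier G. diag_block_mat (map (\<lambda>\<sigma>. \<sigma> g) \<sigma>s) \<in> carrier_mat (dg \<rho>) (dg \<rho>) \<and>
      \<rho> g * P = P * diag_block_mat (map (\<lambda>\<sigma>. \<sigma> g) \<sigma>s))"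
  using rep
proof (induction "dg \<rho>" arbitrary: \<rho> rule: less_induct)
  case less
  let ?n = "dg \<rho>"
  note car = rep_carrier[OF less.prems]
  consider "?n = 0" | "irreducible_rep G \<rho>" | "0 < ?n" "\<not> irreducible_rep G \<rho>" by blast
  then show ?case
  proof cases
    case 1
    then have "dim_row (\<rho> g) = 0" "dim_col (\<rho> g) = 0" if "g \<in> carrier G" for g
      using car[OF that] by auto
    then show ?thesis using 1
      by (intro exI[of _ "[]"] exI[of _ "1\<^sub>m 0"]) (auto intro!: eq_matI)
  next
    case 2
    then obtain \<sigma> where \<sigma>: "\<sigma> \<in> R" "equivalent_reps G \<rho> \<sigma>" using R by (auto simp: complete_irreps_def)
    then obtain P Q where PQ: "\<And>g. g \<in> carrier G \<Longrightarrow> similar_mat_wit (\<rho> g) (\<sigma> g) P Q"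
      by (auto simp: equivalent_reps_def)
    have w: "P \<in> carrier_mat ?n ?n" "Q \<in> carrier_mat ?n ?n" "P * Q = 1\<^sub>m ?n" "Q * P = 1\<^sub>m ?n"
      "\<sigma> g \<in> carrier_mat ?n ?n" "\<rho> g = P * \<sigma> g * Q" if "g \<in> carrier G" for g
      using similar_mat_witD2[OF car[OF that] PQ[OF that]] by auto
    have "\<rho> g * P = P * \<sigma> g" if g: "g \<in> carrier G" for g
    proof -
      have "\<rho> g * P = P * \<sigma> g * (Q * P)"
        using assoc_mult_mat[OF mult_carrier_mat[OF w(1,5)] w(2,1)] w(6) g by simp
      then show ?thesis using w(4)[OF g] right_mult_one_mat[OF mult_carrier_mat[OF w(1,5)]] g by simp
    qed
    then have 3: "\<forall>g\<in>carrier G. diag_block_mat (map (\<lambda>\<sigma>. \<sigma> g) [\<sigma>]) \<in> carrier_mat ?n ?n \<and>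
      \<rho> g * P = P * diag_block_mat (map (\<lambda>\<sigma>. \<sigma> g) [\<sigma>])"
      using w(5) unfolding list.map diag_block_mat_singleton by blast
    show ?thesis
    proof (rule exI[of _ "[\<sigma>]"], rule exI[of _ P], rule exI[of _ Q], intro conjI)
      show "set [\<sigma>] \<subseteq> R" using \<sigma> by simp
    qed (fact w(1-4)[OF one_closed] 3)+
  next
    case 3
    obtain k l \<rho>1 \<rho>2 P Q where kl: "0 < k" "0 < l" "k + l = ?n"
      and r1: "matrix_rep G \<rho>1" "dg \<rho>1 = k" and r2: "matrix_rep G \<rho>2" "dg \<rho>2 = l"
      and P: "P \<in> carrier_mat ?n ?n" and Q: "Q \<in> carrier_mat ?n ?n"
      and PQ: "P * Q = 1\<^sub>m ?n" and QP: "Q * P = 1\<^sub>m ?n"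
      and split: "\<And>g. g \<in> carrier G \<Longrightarrow>
        \<rho> g * P = P * four_block_mat (\<rho>1 g) (0\<^sub>m k l) (0\<^sub>m l k) (\<rho>2 g)"
      using maschke_split[OF less.prems 3] by metis
    obtain s1 P1 Q1 where s1: "set s1 \<subseteq> R" and P1: "P1 \<in> carrier_mat k k" and Q1: "Q1 \<in> carrier_mat k k"
      and PQ1: "P1 * Q1 = 1\<^sub>m k" "Q1 * P1 = 1\<^sub>m k"
      and D1: "\<And>g. g \<in> carrier G \<Longrightarrow> diag_block_mat (map (\<lambda>\<sigma>. \<sigma> g) s1) \<in> carrier_mat k k"
        "\<And>g. g \<in> carrier G \<Longrightarrow> \<rho>1 g * P1 = P1 * diag_block_mat (map (\<lambda>\<sigma>. \<sigma> g) s1)"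
      using less.hyps[of \<rho>1] r1 kl by auto
    obtain s2 P2 Q2 where s2: "set s2 \<subseteq> R" and P2: "P2 \<in> carrier_mat l l" and Q2: "Q2 \<in> carrier_mat l l"
      and PQ2: "P2 * Q2 = 1\<^sub>m l" "Q2 * P2 = 1\<^sub>m l"
      and D2: "\<And>g. g \<in> carrier G \<Longrightarrow> diag_block_mat (map (\<lambda>\<sigma>. \<sigma> g) s2) \<in> carrier_mat l l"
        "\<And>g. g \<in> carrier G \<Longrightarrow> \<rho>2 g * P2 = P2 * diag_block_mat (map (\<lambda>\<sigma>. \<sigma> g) s2)"
      using less.hyps[of \<rho>2] r2 kl by auto
    have fb: "four_block_mat A (0\<^sub>m k l) (0\<^sub>m l k) B * four_block_mat A' (0\<^sub>m k l) (0\<^sub>m l k) B' =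
        four_block_mat (A * A') (0\<^sub>m k l) (0\<^sub>m l k) (B * B')"
      if "A \<in> carrier_mat k k" "A' \<in> carrier_mat k k" "B \<in> carrier_mat l l" "B' \<in> carrier_mat l l"
      for A A' B B' :: "complex mat"
    proof -
      have "four_block_mat A (0\<^sub>m k l) (0\<^sub>m l k) B * four_block_mat A' (0\<^sub>m k l) (0\<^sub>m l k) B' =
        four_block_mat (A * A' + 0\<^sub>m k l * 0\<^sub>m l k) (A * 0\<^sub>m k l + 0\<^sub>m k l * B')
          (0\<^sub>m l k * A' + B * 0\<^sub>m l k) (0\<^sub>m l k * 0\<^sub>m k l + B * B')"
        by (rule mult_four_block_mat) (use that in auto)
      also have "\<dots> = four_block_mat (A * A') (0\<^sub>m k l) (0\<^sub>m l k) (B * B')"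
        using that by (intro cong_four_block_mat) auto
      finally show ?thesis .
    qed
    let ?P' = "four_block_mat P1 (0\<^sub>m k l) (0\<^sub>m l k) P2"
    let ?Q' = "four_block_mat Q1 (0\<^sub>m k l) (0\<^sub>m l k) Q2"
    have P'c: "?P' \<in> carrier_mat ?n ?n" and Q'c: "?Q' \<in> carrier_mat ?n ?n"
      using P1 P2 Q1 Q2 kl by (auto intro: four_block_carrier_mat)
    have PQ': "?P' * ?Q' = 1\<^sub>m ?n" "?Q' * ?P' = 1\<^sub>m ?n"
      using fb[OF P1 Q1 P2 Q2] fb[OF Q1 P1 Q2 P2] PQ1 PQ2 kl by simp_all
    let ?PP = "P * ?P'" and ?QQ = "?Q' * Q"
    have "?P' * ?QQ = Q" using assoc_mult_mat[OF P'c Q'c Q] left_mult_one_mat[OF Q]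
      unfolding PQ'(1) by simp
    then have 1: "?PP * ?QQ = 1\<^sub>m ?n"
      using assoc_mult_mat[OF P P'c mult_carrier_mat[OF Q'c Q]] PQ by simp
    have "Q * ?PP = ?P'" using assoc_mult_mat[OF Q P P'c] left_mult_one_mat[OF P'c]
      unfolding QP by simp
    then have 2: "?QQ * ?PP = 1\<^sub>m ?n"
      using assoc_mult_mat[OF Q'c Q mult_carrier_mat[OF P P'c]] PQ' by simp
    have "diag_block_mat (map (\<lambda>\<sigma>. \<sigma> g) (s1 @ s2)) \<in> carrier_mat ?n ?n \<and>
      \<rho> g * ?PP = ?PP * diag_block_mat (map (\<lambda>\<sigma>. \<sigma> g) (s1 @ s2))" if g: "g \<in> carrier G" for g
    proof -
      let ?D1 = "diag_block_mat (map (\<lambda>\<sigma>. \<sigma> g) s1)" and ?D2 = "diag_block_mat (map (\<lambda>\<sigma>. \<sigma> g) s2)"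
      have D: "diag_block_mat (map (\<lambda>\<sigma>. \<sigma> g) (s1 @ s2)) = four_block_mat ?D1 (0\<^sub>m k l) (0\<^sub>m l k) ?D2"
        using D1(1)[OF g] D2(1)[OF g] by (simp add: diag_block_mat_append Let_def)
      have Dc: "four_block_mat ?D1 (0\<^sub>m k l) (0\<^sub>m l k) ?D2 \<in> carrier_mat ?n ?n"
        using D1(1)[OF g] D2(1)[OF g] kl by (auto intro: four_block_carrier_mat)
      have r1c: "\<rho>1 g \<in> carrier_mat k k" and r2c: "\<rho>2 g \<in> carrier_mat l l"
        using rep_carrier[OF r1(1) g] rep_carrier[OF r2(1) g] r1 r2 by auto
      let ?M = "four_block_mat (\<rho>1 g) (0\<^sub>m k l) (0\<^sub>m l k) (\<rho>2 g)"
      have M: "?M \<in> carrier_mat ?n ?n"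
        using r1c r2c kl by (auto intro: four_block_carrier_mat)
      have "\<rho> g * ?PP = \<rho> g * P * ?P'" using assoc_mult_mat[OF car[OF g] P P'c] by simp
      also have "\<dots> = P * ?M * ?P'" using split[OF g] by simp
      also have "\<dots> = P * (?M * ?P')" using assoc_mult_mat[OF P M P'c] .
      also have "?M * ?P' = ?P' * four_block_mat ?D1 (0\<^sub>m k l) (0\<^sub>m l k) ?D2"
        using fb[OF r1c P1 r2c P2] fb[OF P1 D1(1)[OF g] P2 D2(1)[OF g]] D1(2)[OF g] D2(2)[OF g] by simp
      also have "P * \<dots> = ?PP * four_block_mat ?D1 (0\<^sub>m k l) (0\<^sub>m l k) ?D2"
        using assoc_mult_mat[OF P P'c Dc] by simp
      finally show ?thesis using D Dc by simp
    qed
    then have 3: "\<forall>g\<in>carrier G. diag_block_mat (map (\<lambda>\<sigma>. \<sigma> g) (s1 @ s2)) \<in> carrier_mat ?n ?n \<and>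
      \<rho> g * ?PP = ?PP * diag_block_mat (map (\<lambda>\<sigma>. \<sigma> g) (s1 @ s2))" by blast
    show ?thesis
    proof (rule exI[of _ "s1 @ s2"], rule exI[of _ ?PP], rule exI[of _ ?QQ], intro conjI)
      show "set (s1 @ s2) \<subseteq> R" using s1 s2 by simp
      show "?PP \<in> carrier_mat ?n ?n" by (rule mult_carrier_mat[OF P P'c])
      show "?QQ \<in> carrier_mat ?n ?n" by (rule mult_carrier_mat[OF Q'c Q])
    qed (fact 1 2 3)+
  qed
qed

end

section \<open>Adapted sets of irreducible representations\<close>

lemma equivalent_reps_refl: "matrix_rep G \<rho> \<Longrightarrow> equivalent_reps G \<rho> \<rho>"
  unfolding equivalent_reps_def matrix_rep_def
  by (intro exI[of _ "1\<^sub>m (rep_degree G \<rho>)"]) (auto intro!: similar_mat_wit_refl)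

lemma equivalent_reps_sym: "equivalent_reps G \<rho> \<sigma> \<Longrightarrow> equivalent_reps G \<sigma> \<rho>"
  unfolding equivalent_reps_def using similar_mat_wit_sym by blast

lemma equivalent_reps_trans:
  "equivalent_reps G \<rho> \<sigma> \<Longrightarrow> equivalent_reps G \<sigma> \<tau> \<Longrightarrow> equivalent_reps G \<rho> \<tau>"
  unfolding equivalent_reps_def using similar_mat_wit_trans by meson

lemma rep_degree_restrict [simp]: "rep_degree (G\<lparr>carrier := H\<rparr>) = rep_degree G"
  by (auto simp: rep_degree_def)

lemma matrix_rep_restrict:
  "matrix_rep G \<rho> \<Longrightarrow> H \<subseteq> carrier G \<Longrightarrow> matrix_rep (G\<lparr>carrier := H\<rparr>) \<rho>"
  by (auto simp: matrix_rep_def)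

definition restricts_to ::
  "'g set \<Rightarrow> ('g \<Rightarrow> complex mat) \<Rightarrow> ('g \<Rightarrow> complex mat) list \<Rightarrow> bool" where
  "restricts_to H \<rho> \<sigma>s \<longleftrightarrow> (\<forall>h\<in>H. \<rho> h = diag_block_mat (map (\<lambda>\<sigma>. \<sigma> h) \<sigma>s))"

context finite_group
begin

lemma conjugate_irreducible:
  assumes rho: "irreducible_rep G \<rho>"
    and P: "P \<in> carrier_mat (dg \<rho>) (dg \<rho>)" and Q: "Q \<in> carrier_mat (dg \<rho>) (dg \<rho>)"
    and PQ: "P * Q = 1\<^sub>m (dg \<rho>)" and QP: "Q * P = 1\<^sub>m (dg \<rho>)"
  shows "irreducible_rep G (\<lambda>g. Q * \<rho> g * P)" "equivalent_reps G \<rho> (\<lambda>g. Q * \<rho> g * P)"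
proof -
  let ?n = "dg \<rho>" and ?\<sigma> = "\<lambda>g. Q * \<rho> g * P"
  note rep = irreducible_matrix_rep[OF rho]
  note car = rep_carrier[OF rep]
  have com: "\<rho> g * (P * Q) = (P * Q) * \<rho> g" if "g \<in> carrier G" for g using PQ car[OF that] by simp
  have c: "matrix_rep G ?\<sigma>" "dg ?\<sigma> = ?n"
    "\<And>g. g \<in> carrier G \<Longrightarrow> \<rho> g * P = P * ?\<sigma> g"
    using compress_rep[OF rep P Q QP] com by blast+
  have "similar_mat_wit (\<rho> g) (?\<sigma> g) P Q" if g: "g \<in> carrier G" for g
  proof (rule similar_mat_witI[OF PQ QP])
    have "P * ?\<sigma> g * Q = \<rho> g * P * Q" using c(3)[OF g] by simp
    also have "\<dots> = \<rho> g * (P * Q)" using assoc_mult_mat[OF car[OF g] P Q] .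
    finally show "\<rho> g = P * ?\<sigma> g * Q" using PQ car[OF g] by simp
  qed (use P Q car[OF g] in auto)
  then show "equivalent_reps G \<rho> ?\<sigma>" unfolding equivalent_reps_def by blast
  show "irreducible_rep G ?\<sigma>"
    unfolding irreducible_rep_iff c(2)
  proof (intro conjI allI impI c(1))
    show "0 < ?n" using irreducible_deg_pos[OF rho] .
    fix W assume W: "vec_subspace ?n W \<and> (\<forall>g\<in>carrier G. \<forall>w\<in>W. ?\<sigma> g *\<^sub>v w \<in> W)"
    then have Ws: "vec_subspace ?n W" by simp
    have Wc: "w \<in> carrier_vec ?n" if "w \<in> W" for w using that Ws by (auto simp: vec_subspace_def)
    have QPv: "Q *\<^sub>v (P *\<^sub>v v) = v" "P *\<^sub>v (Q *\<^sub>v v) = v" if "v \<in> carrier_vec ?n" for v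
      using that PQ QP assoc_mult_mat_vec[OF Q P that] assoc_mult_mat_vec[OF P Q that] by auto
    \<comment> \<open>The image of \<open>W\<close> under \<open>P\<close>, written as a preimage
      under the inverse \<open>Q\<close>.\<close>
    define W' where "W' = {v \<in> carrier_vec ?n. Q *\<^sub>v v \<in> W}"
    have Q0: "Q *\<^sub>v 0\<^sub>v ?n = 0\<^sub>v ?n" using Q by (auto intro!: eq_vecI)
    have "vec_subspace ?n W'"
      using Ws Q0 unfolding vec_subspace_def W'_def
      by (auto simp: mult_add_distrib_mat_vec[OF Q] mult_mat_vec[OF Q])
    moreover have "\<rho> g *\<^sub>v w \<in> W'" if g: "g \<in> carrier G" and w: "w \<in> W'" for g w
    proof -
      have wc: "w \<in> carrier_vec ?n" and Qw: "Q *\<^sub>v w \<in> W" using w by (auto simp: W'_def)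
      have "?\<sigma> g *\<^sub>v (Q *\<^sub>v w) = Q *\<^sub>v (\<rho> g *\<^sub>v (P *\<^sub>v (Q *\<^sub>v w)))"
        using Q P car[OF g] wc
        by (simp add: assoc_mult_mat_vec[of _ ?n ?n _ ?n])
      also have "\<dots> = Q *\<^sub>v (\<rho> g *\<^sub>v w)" using QPv wc by simp
      finally have "Q *\<^sub>v (\<rho> g *\<^sub>v w) \<in> W" using W Qw g by metis
      then show ?thesis using wc car[OF g] by (auto simp: W'_def)
    qed
    ultimately have "W' = {0\<^sub>v ?n} \<or> W' = carrier_vec ?n" by (rule irreducible_cases[OF rho])
    then show "W = {0\<^sub>v ?n} \<or> W = carrier_vec ?n"
    proof
      assume *: "W' = {0\<^sub>v ?n}"
      have "w = 0\<^sub>v ?n" if w: "w \<in> W" for w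
      proof -
        have "P *\<^sub>v w \<in> W'" using w Wc QPv P by (auto simp: W'_def)
        then show ?thesis using * QPv(1)[OF Wc[OF w]] Q0 by auto
      qed
      then show ?thesis using Ws by (auto simp: vec_subspace_def)
    next
      assume *: "W' = carrier_vec ?n"
      have "v \<in> W" if v: "v \<in> carrier_vec ?n" for v
      proof -
        have "P *\<^sub>v v \<in> W'" using * P v by auto
        then show ?thesis using QPv(1)[OF v] by (auto simp: W'_def)
      qed
      then show ?thesis using Wc by auto
    qed
  qed
qed

text \<open>The change of basis that makes the restriction to \<open>H\<close> block diagonal is
  applied to \<open>\<tau>\<close> on the whole group.\<close>

lemma adapted_form:
  assumes H: "subgroup H G" and RH: "complete_irreps (G\<lparr>carrier := H\<rparr>) RH"
    and tau: "irreducible_rep G \<tau>"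
  obtains \<rho> \<sigma>s where "irreducible_rep G \<rho>" "equivalent_reps G \<tau> \<rho>" "set \<sigma>s \<subseteq> RH"
    "restricts_to H \<rho> \<sigma>s"
proof -
  have HG: "H \<subseteq> carrier G" using H by (rule subgroup.subset)
  interpret H: finite_group "G\<lparr>carrier := H\<rparr>"
    using subgroup_imp_group[OF H] finite_subset[OF HG finite_carrier]
    by (simp add: finite_group_def finite_group_axioms_def)
  note rep = irreducible_matrix_rep[OF tau]
  obtain \<sigma>s P Q where s: "set \<sigma>s \<subseteq> RH"
    and P: "P \<in> carrier_mat (dg \<tau>) (dg \<tau>)" and Q: "Q \<in> carrier_mat (dg \<tau>) (dg \<tau>)"
    and PQ: "P * Q = 1\<^sub>m (dg \<tau>)" "Q * P = 1\<^sub>m (dg \<tau>)"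
    and D: "\<And>h. h \<in> H \<Longrightarrow> diag_block_mat (map (\<lambda>\<sigma>. \<sigma> h) \<sigma>s) \<in> carrier_mat (dg \<tau>) (dg \<tau>)"
      "\<And>h. h \<in> H \<Longrightarrow> \<tau> h * P = P * diag_block_mat (map (\<lambda>\<sigma>. \<sigma> h) \<sigma>s)"
    using H.complete_reducibility[OF RH matrix_rep_restrict[OF rep HG]] by auto
  have "restricts_to H (\<lambda>g. Q * \<tau> g * P) \<sigma>s"
    unfolding restricts_to_def
  proof
    fix h assume h: "h \<in> H"
    have tc: "\<tau> h \<in> carrier_mat (dg \<tau>) (dg \<tau>)" using rep_carrier[OF rep] h HG by auto
    have "Q * \<tau> h * P = Q * (P * diag_block_mat (map (\<lambda>\<sigma>. \<sigma> h) \<sigma>s))"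
      using assoc_mult_mat[OF Q tc P] D(2)[OF h] by simp
    also have "\<dots> = diag_block_mat (map (\<lambda>\<sigma>. \<sigma> h) \<sigma>s)"
      using assoc_mult_mat[OF Q P D(1)[OF h]] PQ D(1)[OF h] by simp
    finally show "Q * \<tau> h * P = diag_block_mat (map (\<lambda>\<sigma>. \<sigma> h) \<sigma>s)" .
  qed
  then show thesis using that conjugate_irreducible[OF tau P Q PQ] s by blast
qed

text \<open>Choose a member of \<open>A\<close> for each irreducible representation. Equivalent
  representations have the same candidates, so \<open>SOME\<close> picks the same one for both, and
  the image contains exactly one member per class.\<close>

lemma complete_irreps_from_forms:
  assumes A: "\<And>\<rho>. \<rho> \<in> A \<Longrightarrow> irreducible_rep G \<rho>"
    and forms: "\<And>\<tau>. irreducible_rep G \<tau> \<Longrightarrow> \<exists>\<rho>\<in>A. equivalent_reps G \<tau> \<rho>"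
  obtains R where "R \<subseteq> A" "complete_irreps G R"
proof -
  define c where "c \<tau> = (SOME \<rho>. \<rho> \<in> A \<and> equivalent_reps G \<tau> \<rho>)" for \<tau>
  have c: "c \<tau> \<in> A \<and> equivalent_reps G \<tau> (c \<tau>)" if "irreducible_rep G \<tau>" for \<tau>
    unfolding c_def using forms[OF that]
    by (intro someI_ex[of "\<lambda>\<rho>. \<rho> \<in> A \<and> equivalent_reps G \<tau> \<rho>"]) blast
  have c_eq: "c \<rho> = c \<sigma>" if "equivalent_reps G \<rho> \<sigma>" for \<rho> \<sigma>
  proof -
    have "equivalent_reps G \<rho> \<tau> \<longleftrightarrow> equivalent_reps G \<sigma> \<tau>" for \<tau>
      using that equivalent_reps_trans equivalent_reps_sym by meson
    then show ?thesis by (simp add: c_def)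
  qed
  have "complete_irreps G (c ` A)"
    unfolding complete_irreps_def
  proof (intro conjI ballI allI impI)
    fix \<rho> \<sigma> assume "\<rho> \<in> c ` A" "\<sigma> \<in> c ` A" and eq: "equivalent_reps G \<rho> \<sigma>"
    then obtain \<rho>' \<sigma>' where "\<rho>' \<in> A" "\<rho> = c \<rho>'" "\<sigma>' \<in> A" "\<sigma> = c \<sigma>'" by blast
    then show "\<rho> = \<sigma>"
      using eq c[OF A, of \<rho>'] c[OF A, of \<sigma>'] c_eq equivalent_reps_trans equivalent_reps_sym by metis
  next
    fix \<tau> assume "irreducible_rep G \<tau>"
    then show "\<exists>\<rho>\<in>c ` A. equivalent_reps G \<tau> \<rho>"
      using c[of \<tau>] c_eq A c equivalent_reps_trans by (metis imageI)
  qed (use A c in auto)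
  then show thesis using that[of "c ` A"] A c by blast
qed

lemma ex_complete_irreps: "\<exists>R. complete_irreps G R"
  using complete_irreps_from_forms[of "{\<rho>. irreducible_rep G \<rho>}"] equivalent_reps_refl irreducible_matrix_rep
  by (metis mem_Collect_eq)

lemma ex_adapted_irreps:
  assumes H: "subgroup H G" and RH: "complete_irreps (G\<lparr>carrier := H\<rparr>) RH"
  shows "\<exists>R. complete_irreps G R \<and> (\<forall>\<rho>\<in>R. \<exists>\<sigma>s. set \<sigma>s \<subseteq> RH \<and> restricts_to H \<rho> \<sigma>s)"
proof -
  let ?A = "{\<rho>. irreducible_rep G \<rho> \<and> (\<exists>\<sigma>s. set \<sigma>s \<subseteq> RH \<and> restricts_to H \<rho> \<sigma>s)}"
  have "\<exists>\<rho>\<in>?A. equivalent_reps G \<tau> \<rho>" if "irreducible_rep G \<tau>" for \<tau>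
    using adapted_form[OF H RH that] by (metis (mono_tags, lifting) mem_Collect_eq)
  then obtain R where "R \<subseteq> ?A" "complete_irreps G R"
    using complete_irreps_from_forms[of ?A] by blast
  then show ?thesis by blast
qed

end

section \<open>Signed permutations\<close>

definition flip :: "int \<Rightarrow> int \<Rightarrow> int" where
  "flip i = Transposition.transpose i (- i)"

definition swap :: "int \<Rightarrow> int \<Rightarrow> int \<Rightarrow> int" where
  "swap i j = Transposition.transpose i j \<circ> Transposition.transpose (- i) (- j)"

definition signed_perms :: "nat \<Rightarrow> (int \<Rightarrow> int) set" where
  "signed_perms n = {\<pi>. bij \<pi> \<and> (\<forall>x. \<pi> (- x) = - \<pi> x) \<and> (\<forall>x. int n < \<bar>x\<bar> \<longrightarrow> \<pi> x = x)}"

abbreviation signed_range :: "nat \<Rightarrow> int set" where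
  "signed_range n \<equiv> {x. x \<noteq> 0 \<and> \<bar>x\<bar> \<le> int n}"

lemma signed_permsD:
  assumes "\<pi> \<in> signed_perms n"
  shows "bij \<pi>" "inj \<pi>" "\<pi> (- x) = - \<pi> x" "int n < \<bar>x\<bar> \<Longrightarrow> \<pi> x = x"
  using assms by (auto simp: signed_perms_def bij_is_inj)

lemma signed_perms_id [simp]: "id \<in> signed_perms n"
  by (simp add: signed_perms_def)

lemma signed_perms_comp:
  "\<pi> \<in> signed_perms n \<Longrightarrow> \<sigma> \<in> signed_perms n \<Longrightarrow> \<pi> \<circ> \<sigma> \<in> signed_perms n"
  by (auto simp: signed_perms_def intro: bij_comp)

lemma signed_perms_mono: "m \<le> n \<Longrightarrow> signed_perms m \<subseteq> signed_perms n"
  by (auto simp: signed_perms_def)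

lemma signed_perms_inv:
  assumes p: "\<pi> \<in> signed_perms n"
  shows "inv_into UNIV \<pi> \<in> signed_perms n"
proof -
  let ?i = "inv_into UNIV \<pi>"
  note d = signed_permsD[OF p]
  have i: "?i (\<pi> x) = x" "\<pi> (?i x) = x" for x
    using d by (simp_all add: bij_is_surj surj_f_inv_f)
  have "?i (- x) = - ?i x" for x using i d(3) by metis
  moreover have "?i x = x" if "int n < \<bar>x\<bar>" for x using i d(4)[OF that] by metis
  ultimately show ?thesis using d(1) by (auto simp: signed_perms_def bij_imp_bij_inv)
qed

lemma signed_perms_zero: "\<pi> \<in> signed_perms n \<Longrightarrow> \<pi> 0 = 0"
  using signed_permsD(3)[of \<pi> n 0] by simp

lemma signed_perms_range:
  assumes "\<pi> \<in> signed_perms n" "x \<in> signed_range n"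
  shows "\<pi> x \<in> signed_range n"
proof -
  note d = signed_permsD[OF assms(1)]
  have "\<pi> x \<noteq> 0" using d(2) signed_perms_zero[OF assms(1)] assms(2) by (metis (mono_tags) injD mem_Collect_eq)
  moreover have "\<bar>\<pi> x\<bar> \<le> int n"
  proof (rule ccontr)
    assume "\<not> \<bar>\<pi> x\<bar> \<le> int n"
    then have "\<pi> (\<pi> x) = \<pi> x" using d(4) by auto
    then have "\<pi> x = x" using d(2) by (auto dest: injD)
    then show False using \<open>\<not> \<bar>\<pi> x\<bar> \<le> int n\<close> assms(2) by auto
  qed
  ultimately show ?thesis by simp
qed

lemma signed_perms_predecessor:
  assumes p: "\<pi> \<in> signed_perms (Suc n)" and fix_top: "\<pi> (int (Suc n)) = int (Suc n)"
  shows "\<pi> \<in> signed_perms n"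
proof -
  have "\<pi> x = x" if "int n < \<bar>x\<bar>" for x
  proof -
    have "int (Suc n) < \<bar>x\<bar> \<or> x = int (Suc n) \<or> x = - int (Suc n)" using that by auto
    then consider "int (Suc n) < \<bar>x\<bar>" | "x = int (Suc n)" | "x = - int (Suc n)" by blast
    then show ?thesis
      using signed_permsD(3)[OF p, of "int (Suc n)"] signed_permsD(4)[OF p] fix_top by cases auto
  qed
  then show ?thesis using p by (auto simp: signed_perms_def)
qed

lemma finite_signed_perms: "finite (signed_perms n)"
proof (rule finite_subset)
  show "signed_perms n \<subseteq> {\<pi>. \<forall>x. (x \<in> {- int n..int n} \<longrightarrow> \<pi> x \<in> {- int n..int n}) \<and>
      (x \<notin> {- int n..int n} \<longrightarrow> \<pi> x = x)}"
  proof safe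
    fix \<pi> x assume p: "\<pi> \<in> signed_perms n" and x: "x \<in> {- int n..int n}"
    show "\<pi> x \<in> {- int n..int n}"
      using signed_perms_range[OF p, of x] signed_perms_zero[OF p] x
      by (cases "x = 0") (auto simp: abs_le_iff)
  next
    fix \<pi> x assume p: "\<pi> \<in> signed_perms n" and x: "x \<notin> {- int n..int n}"
    then show "\<pi> x = x" using signed_permsD(4)[OF p, of x] by auto
  qed
  have "finite {\<pi>. (\<forall>x. x \<in> {- int n..int n} \<longrightarrow> \<pi> x \<in> {- int n..int n}) \<and>
      (\<forall>x. x \<notin> {- int n..int n} \<longrightarrow> \<pi> x = id x)}"
  proof (rule finite_subset)
    show "{\<pi>. (\<forall>x. x \<in> {- int n..int n} \<longrightarrow> \<pi> x \<in> {- int n..int n}) \<and>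
        (\<forall>x. x \<notin> {- int n..int n} \<longrightarrow> \<pi> x = id x)} \<subseteq>
      (\<lambda>f x. if x \<in> {- int n..int n} then f x else x) `
        ({- int n..int n} \<rightarrow>\<^sub>E {- int n..int n})"
    proof
      fix \<pi> assume "\<pi> \<in> {\<pi>. (\<forall>x. x \<in> {- int n..int n} \<longrightarrow> \<pi> x \<in> {- int n..int n}) \<and>
        (\<forall>x. x \<notin> {- int n..int n} \<longrightarrow> \<pi> x = id x)}"
      then show "\<pi> \<in> (\<lambda>f x. if x \<in> {- int n..int n} then f x else x) `
        ({- int n..int n} \<rightarrow>\<^sub>E {- int n..int n})"
        by (intro image_eqI[of _ _ "restrict \<pi> {- int n..int n}"]) auto
    qed
  qed (intro finite_imageI finite_PiE, auto)
  then show "finite {\<pi>. \<forall>x. (x \<in> {- int n..int n} \<longrightarrow> \<pi> x \<in> {- int n..int n}) \<and>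
      (x \<notin> {- int n..int n} \<longrightarrow> \<pi> x = x)}"
    by (rule rev_finite_subset) auto
qed

lemma flip_apply: "flip i x = (if x = i then - i else if x = - i then i else x)"
  by (simp add: flip_def Transposition.transpose_def)

lemma swap_apply:
  assumes "i \<noteq> 0" "j \<noteq> 0" "\<bar>i\<bar> \<noteq> \<bar>j\<bar>"
  shows "swap i j x = (if x = i then j else if x = j then i else if x = - i then - j
    else if x = - j then - i else x)"
  using assms by (auto simp: swap_def Transposition.transpose_def)

lemma flip_in: "i \<in> signed_range n \<Longrightarrow> flip i \<in> signed_perms n"
  unfolding signed_perms_def by (auto simp: flip_apply) (auto simp: flip_def)

lemma swap_in:
  assumes "i \<in> signed_range n" "j \<in> signed_range n" "\<bar>i\<bar> \<noteq> \<bar>j\<bar>"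
  shows "swap i j \<in> signed_perms n"
proof -
  have "bij (swap i j)" unfolding swap_def by (intro bij_comp) auto
  then show ?thesis using assms by (auto simp: signed_perms_def swap_apply)
qed

lemma flip_uminus: "flip (- i) = flip i"
  by (auto simp: flip_apply fun_eq_iff)

lemma flip_flip: "flip i \<circ> flip i = id"
  by (auto simp: flip_apply fun_eq_iff)

lemma swap_commute: "swap i j = swap j i"
  by (simp add: swap_def transpose_commute)

lemma swap_uminus:
  assumes "i \<noteq> 0" "j \<noteq> 0" "\<bar>i\<bar> \<noteq> \<bar>j\<bar>"
  shows "swap (- i) (- j) = swap i j"
  using assms by (auto simp: swap_apply fun_eq_iff)

lemma swap_swap:
  assumes "i \<noteq> 0" "j \<noteq> 0" "\<bar>i\<bar> \<noteq> \<bar>j\<bar>"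
  shows "swap i j \<circ> swap i j = id"
  using assms by (auto simp: swap_apply fun_eq_iff)

lemma transpose_conj: "inj f \<Longrightarrow> f \<circ> Transposition.transpose a b = Transposition.transpose (f a) (f b) \<circ> f"
  by (auto simp: fun_eq_iff Transposition.transpose_def inj_eq)

text \<open>Conjugation is phrased as a commutation rule \<open>g \<circ> r = r' \<circ> g\<close>,
  which keeps inverse functions out of the calculations with reflections.\<close>

lemma flip_conj: "g \<in> signed_perms n \<Longrightarrow> g \<circ> flip i = flip (g i) \<circ> g"
  using transpose_conj[OF signed_permsD(2), of g n i "- i"] signed_permsD(3)[of g n i]
  by (simp add: flip_def)

lemma swap_conj:
  assumes "g \<in> signed_perms n"
  shows "g \<circ> swap i j = swap (g i) (g j) \<circ> g"
proof -
  note t = transpose_conj[OF signed_permsD(2)[OF assms]]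
  have "g \<circ> swap i j = (g \<circ> Transposition.transpose i j) \<circ> Transposition.transpose (- i) (- j)"
    by (simp add: swap_def comp_assoc)
  also have "\<dots> = Transposition.transpose (g i) (g j) \<circ> (g \<circ> Transposition.transpose (- i) (- j))"
    by (simp add: t comp_assoc)
  also have "\<dots> = swap (g i) (g j) \<circ> g"
    using signed_permsD(3)[OF assms] by (simp add: t swap_def comp_assoc)
  finally show ?thesis .
qed

lemma subgroup_signed_perms: "subgroup (signed_perms n) (BijGroup UNIV)"
proof (rule group.subgroupI[OF group_BijGroup])
  show "signed_perms n \<subseteq> carrier (BijGroup UNIV)"
    by (auto simp: signed_perms_def BijGroup_def Bij_def)
  show "signed_perms n \<noteq> {}" using signed_perms_id by blast
next
  fix a assume a: "a \<in> signed_perms n"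
  then have "a \<in> Bij UNIV" by (auto simp: signed_perms_def Bij_def)
  then have "inv\<^bsub>BijGroup UNIV\<^esub> a = inv_into UNIV a" by (simp add: inv_BijGroup restrict_def)
  then show "inv\<^bsub>BijGroup UNIV\<^esub> a \<in> signed_perms n" using signed_perms_inv[OF a] by simp
next
  fix a b assume ab: "a \<in> signed_perms n" "b \<in> signed_perms n"
  then have "a \<in> Bij UNIV" "b \<in> Bij UNIV" by (auto simp: signed_perms_def Bij_def)
  then have "a \<otimes>\<^bsub>BijGroup UNIV\<^esub> b = a \<circ> b"
    by (auto simp: BijGroup_def compose_def fun_eq_iff)
  then show "a \<otimes>\<^bsub>BijGroup UNIV\<^esub> b \<in> signed_perms n" using signed_perms_comp[OF ab] by simp
qed

section \<open>The simple reflections generate all signed permutations\<close>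

lemma simple_refl_1: "simple_refl 1 = flip 1"
  by (simp add: simple_refl_def flip_def)

lemma simple_refl_Suc: "0 < i \<Longrightarrow> simple_refl (Suc i) = swap (int i) (int (Suc i))"
  by (simp add: simple_refl_def swap_def)

lemma weyl_generators_closed:
  assumes "g \<in> carrier (weyl_B n)" "h \<in> carrier (weyl_B n)"
  shows "g \<circ> h \<in> carrier (weyl_B n)"
proof -
  have "g \<in> carrier (BijGroup UNIV)" "h \<in> carrier (BijGroup UNIV)"
    using assms subgroup.subset[OF subgroup_weyl_B_BijGroup] by blast+
  then have "g \<otimes>\<^bsub>BijGroup UNIV\<^esub> h = g \<circ> h"
    by (auto simp: BijGroup_def compose_def fun_eq_iff)
  then show ?thesis using subgroup.m_closed[OF subgroup_weyl_B_BijGroup assms] by simp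
qed

lemma simple_refl_in: "1 \<le> i \<Longrightarrow> i \<le> n \<Longrightarrow> simple_refl i \<in> carrier (weyl_B n)"
  by (simp add: weyl_B_def generate.incl)

text \<open>Conjugation by the simple reflection that exchanges \<open>i\<close> and
  \<open>i + 1\<close> moves the sign change up by one place; \<open>swap_pos_in_weyl\<close> climbs
  in the same way.\<close>

lemma flip_in_weyl: "1 \<le> i \<Longrightarrow> i \<le> n \<Longrightarrow> flip (int i) \<in> carrier (weyl_B n)"
proof (induction i rule: nat_induct_at_least)
  case base
  then show ?case using simple_refl_in[of 1 n] simple_refl_1 by simp
next
  case (Suc i)
  let ?s = "swap (int i) (int (Suc i))"
  have s: "?s \<in> carrier (weyl_B n)" using simple_refl_in[of "Suc i" n] simple_refl_Suc Suc by simp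
  have "?s \<in> signed_perms (Suc i)" using Suc by (intro swap_in) auto
  then have "?s \<circ> flip (int i) \<circ> ?s = flip (int (Suc i)) \<circ> (?s \<circ> ?s)"
    using Suc by (simp add: flip_conj swap_apply comp_assoc)
  also have "\<dots> = flip (int (Suc i))" using Suc by (subst swap_swap) auto
  finally show ?case using weyl_generators_closed[OF weyl_generators_closed[OF s Suc.IH] s] Suc by simp
qed

lemma swap_pos_in_weyl: "1 \<le> i \<Longrightarrow> i < j \<Longrightarrow> j \<le> n \<Longrightarrow> swap (int i) (int j) \<in> carrier (weyl_B n)"
proof (induction j rule: less_induct)
  case (less j)
  then obtain k where j: "j = Suc k" by (cases j) auto
  show ?case
  proof (cases "i = k")
    case True
    then show ?thesis using simple_refl_in[of j n] simple_refl_Suc[of k] less j by simp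
  next
    case False
    let ?s = "swap (int k) (int j)"
    have s: "?s \<in> carrier (weyl_B n)" using simple_refl_in[of j n] simple_refl_Suc[of k] less j by simp
    have IH: "swap (int i) (int k) \<in> carrier (weyl_B n)" using less False j by simp
    have "?s \<in> signed_perms j" using less j by (intro swap_in) auto
    then have "?s \<circ> swap (int i) (int k) \<circ> ?s = swap (int i) (int j) \<circ> (?s \<circ> ?s)"
      using less j False by (simp add: swap_conj swap_apply comp_assoc)
    also have "\<dots> = swap (int i) (int j)" using less j by (subst swap_swap) auto
    finally show ?thesis using weyl_generators_closed[OF weyl_generators_closed[OF s IH] s] by simp
  qed
qed

lemma swap_in_weyl:
  assumes "i \<in> signed_range n" "j \<in> signed_range n" "\<bar>i\<bar> \<noteq> \<bar>j\<bar>"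
  shows "swap i j \<in> carrier (weyl_B n)"
proof -
  have pos: "swap (int a) (int b) \<in> carrier (weyl_B n)" if "1 \<le> a" "1 \<le> b" "a \<noteq> b" "a \<le> n" "b \<le> n" for a b
    using that swap_pos_in_weyl[of a b n] swap_pos_in_weyl[of b a n] swap_commute[of "int a" "int b"]
    by (cases "a < b") auto
  have neg: "swap (- int a) (int b) \<in> carrier (weyl_B n)"
    if ab: "1 \<le> a" "1 \<le> b" "a \<noteq> b" "a \<le> n" "b \<le> n" for a b
  proof -
    have "flip (int a) \<in> signed_perms n" using ab by (intro flip_in) auto
    then have "flip (int a) \<circ> swap (int a) (int b) \<circ> flip (int a) =
        swap (- int a) (int b) \<circ> (flip (int a) \<circ> flip (int a))"
      using ab by (simp add: swap_conj flip_apply comp_assoc)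
    then show ?thesis
      using weyl_generators_closed[OF weyl_generators_closed[OF flip_in_weyl[of a n] pos[of a b]]
          flip_in_weyl[of a n]] ab
      by (simp add: flip_flip)
  qed
  define a b where "a = nat \<bar>i\<bar>" and "b = nat \<bar>j\<bar>"
  then have ab: "i = int a \<or> i = - int a" "j = int b \<or> j = - int b" by auto
  then have ab': "1 \<le> a" "1 \<le> b" "a \<noteq> b" "a \<le> n" "b \<le> n" using assms by auto
  have "swap (int a) (- int b) = swap (- int a) (int b)" "swap (- int a) (- int b) = swap (int a) (int b)"
    using swap_uminus[of "- int a" "int b"] swap_uminus[of "int a" "int b"] ab' by auto
  then show ?thesis using ab pos[OF ab'] neg[OF ab'] by auto
qed

text \<open>For the inclusion from right to left, a flip or swap brings the image of the top point
  back to that point; what remains fixes it and lies in the group one level below.\<close>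

lemma carrier_weyl_B: "carrier (weyl_B n) = signed_perms n"
proof
  have "simple_refl i \<in> signed_perms n" if "1 \<le> i" "i \<le> n" for i
  proof (cases "i = 1")
    case True
    then show ?thesis using flip_in[of 1 n] that simple_refl_1 by auto
  next
    case False
    then obtain k where "i = Suc k" "0 < k" using \<open>1 \<le> i\<close> by (cases i) auto
    then show ?thesis using that simple_refl_Suc[of k] swap_in[of "int k" n "int i"] by auto
  qed
  then have "simple_refl ` {1..n} \<subseteq> signed_perms n" by auto
  then show "carrier (weyl_B n) \<subseteq> signed_perms n"
    using group.generate_subgroup_incl[OF group_BijGroup _ subgroup_signed_perms]
    by (simp add: weyl_B_def)
  show "signed_perms n \<subseteq> carrier (weyl_B n)"
  proof (induction n)
    case 0
    have "\<pi> = id" if "\<pi> \<in> signed_perms 0" for \<pi>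
    proof
      fix x show "\<pi> x = id x"
        using signed_permsD(4)[OF that, of x] signed_perms_zero[OF that] by (cases "x = 0") auto
    qed
    moreover have "id \<in> carrier (weyl_B 0)"
      using subgroup.one_closed[OF subgroup_weyl_B_BijGroup, of 0] by (simp add: BijGroup_def id_def restrict_def)
    ultimately show ?case by blast
  next
    case (Suc n)
    let ?N = "int (Suc n)"
    have up: "\<pi> \<in> carrier (weyl_B (Suc n))" if "\<pi> \<in> signed_perms n" for \<pi>
      using that Suc subgroup.subset[OF subgroup_weyl_B[of n "Suc n"]] by auto
    show ?case
    proof
      fix \<pi> assume p: "\<pi> \<in> signed_perms (Suc n)"
      define j where "j = \<pi> ?N"
      have j: "j \<in> signed_range (Suc n)" using signed_perms_range[OF p, of ?N] by (simp add: j_def)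
      consider "j = ?N" | "j = - ?N" | "\<bar>j\<bar> \<noteq> ?N" by linarith
      then show "\<pi> \<in> carrier (weyl_B (Suc n))"
      proof cases
        case 1
        then show ?thesis using signed_perms_predecessor[OF p] up by (simp add: j_def)
      next
        case 2
        have f: "flip ?N \<in> signed_perms (Suc n)" by (intro flip_in) auto
        have "(flip ?N \<circ> \<pi>) ?N = ?N" using 2 by (simp add: j_def flip_apply)
        then have "flip ?N \<circ> \<pi> \<in> carrier (weyl_B (Suc n))"
          using signed_perms_predecessor[OF signed_perms_comp[OF f p]] up by simp
        then have "flip ?N \<circ> (flip ?N \<circ> \<pi>) \<in> carrier (weyl_B (Suc n))"
          using flip_in_weyl[of "Suc n" "Suc n"] weyl_generators_closed by simp
        then show ?thesis by (simp add: comp_assoc[symmetric] flip_flip)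
      next
        case 3
        have sc: "swap j ?N \<in> carrier (weyl_B (Suc n))" and s: "swap j ?N \<in> signed_perms (Suc n)"
          using 3 j by (auto intro!: swap_in swap_in_weyl)
        have "(swap j ?N \<circ> \<pi>) ?N = swap j ?N j" by (simp add: j_def)
        also have "\<dots> = ?N" by (subst swap_apply) (use 3 j in auto)
        finally have "(swap j ?N \<circ> \<pi>) ?N = ?N" .
        then have "swap j ?N \<circ> \<pi> \<in> carrier (weyl_B (Suc n))"
          using signed_perms_predecessor[OF signed_perms_comp[OF s p]] up by simp
        then have "swap j ?N \<circ> (swap j ?N \<circ> \<pi>) \<in> carrier (weyl_B (Suc n))"
          using sc weyl_generators_closed by simp
        then show ?thesis using 3 j by (subst (asm) comp_assoc[symmetric], subst (asm) swap_swap) auto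
      qed
    qed
  qed
qed

lemma weyl_B_mult:
  assumes "g \<in> signed_perms n" "h \<in> signed_perms n"
  shows "g \<otimes>\<^bsub>weyl_B n\<^esub> h = g \<circ> h"
proof -
  have "g \<in> Bij UNIV" "h \<in> Bij UNIV" using assms by (auto simp: signed_perms_def Bij_def)
  then show ?thesis by (auto simp: weyl_B_def BijGroup_def compose_def fun_eq_iff)
qed

lemma weyl_B_one: "\<one>\<^bsub>weyl_B n\<^esub> = id"
  by (auto simp: weyl_B_def BijGroup_def fun_eq_iff)

lemma weyl_B_restrict: "weyl_B n\<lparr>carrier := signed_perms m\<rparr> = weyl_B m"
  by (simp add: weyl_B_def carrier_weyl_B[of m, unfolded weyl_B_def, simplified])

lemma finite_group_weyl_B: "finite_group (weyl_B n)"
  using group_weyl_B finite_signed_perms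
  by (simp add: finite_group_def finite_group_axioms_def carrier_weyl_B)

section \<open>Cosets and reflections\<close>

text \<open>\<open>hi m\<close> is the point moved by \<open>B\<^sub>m\<^sub>+\<^sub>1\<close> but not by \<open>B\<^sub>m\<close>, \<open>adj m\<close> is the last simple
  reflection of \<open>B\<^sub>m\<^sub>+\<^sub>2\<close>, and \<open>coset_reps m\<close> represents the left cosets of \<open>B\<^sub>m\<close> in \<open>B\<^sub>m\<^sub>+\<^sub>1\<close>.\<close>

abbreviation hi :: "nat \<Rightarrow> int" where
  "hi m \<equiv> int (Suc m)"

definition adj :: "nat \<Rightarrow> int \<Rightarrow> int" where
  "adj m = swap (hi m) (hi (Suc m))"

fun coset_reps :: "nat \<Rightarrow> (int \<Rightarrow> int) set" where
  "coset_reps 0 = {id, flip (hi 0)}"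
| "coset_reps (Suc m) = {id, flip (hi (Suc m))} \<union> (\<lambda>z. z \<circ> adj m) ` coset_reps m"

lemma adj_in: "adj m \<in> signed_perms (Suc (Suc m))"
  unfolding adj_def by (intro swap_in) auto

lemma adj_adj: "adj m \<circ> adj m = id"
  unfolding adj_def by (rule swap_swap) auto

lemma adj_apply:
  "adj m (hi m) = hi (Suc m)" "adj m (hi (Suc m)) = hi m" "\<bar>x\<bar> \<le> int m \<Longrightarrow> adj m x = x"
  by (auto simp: adj_def swap_apply)

lemma flip_top_in: "flip (hi m) \<in> signed_perms (Suc m)"
  by (intro flip_in) auto

lemma coset_reps_subset: "coset_reps m \<subseteq> signed_perms (Suc m)"
proof (induction m)
  case 0
  then show ?case using flip_top_in[of 0] by auto
next
  case (Suc m)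
  have "z \<circ> adj m \<in> signed_perms (Suc (Suc m))" if "z \<in> coset_reps m" for z
    using that Suc signed_perms_mono[of "Suc m" "Suc (Suc m)"] adj_in
    by (intro signed_perms_comp) auto
  then show ?case using flip_top_in[of "Suc m"] by auto
qed

lemma finite_coset_reps: "finite (coset_reps m)"
  using coset_reps_subset finite_signed_perms by (rule finite_subset)

text \<open>Elements of \<open>B_m\<close> fix \<open>hi m\<close>, so a left coset is known by the
  image of this point. Composed with \<open>adj m\<close>, the old representatives send the new top
  point to where they sent the old one; \<open>id\<close> and the flip supply the two new
  images.\<close>

lemma bij_betw_coset_reps: "bij_betw (\<lambda>y. y (hi m)) (coset_reps m) (signed_range (Suc m))"
proof (induction m)
  case 0
  have "id \<noteq> flip 1" by (auto simp: fun_eq_iff flip_apply intro!: exI[of _ 1])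
  moreover have "{x. x \<noteq> 0 \<and> \<bar>x\<bar> \<le> (1 :: int)} = {1, - 1}" by auto
  ultimately show ?case by (auto simp: bij_betw_def flip_apply)
next
  case (Suc m)
  let ?N = "hi (Suc m)"
  have r: "signed_range (Suc (Suc m)) = {?N, - ?N} \<union> signed_range (Suc m)" by auto
  have inj: "inj_on (\<lambda>z. z \<circ> adj m) (coset_reps m)"
  proof (rule inj_onI)
    fix y z :: "int \<Rightarrow> int" assume "y \<circ> adj m = z \<circ> adj m"
    then have "y \<circ> adj m \<circ> adj m = z \<circ> adj m \<circ> adj m" by simp
    then show "y = z" by (simp add: comp_assoc adj_adj)
  qed
  have "bij_betw (\<lambda>y. y ?N) ((\<lambda>z. z \<circ> adj m) ` coset_reps m) (signed_range (Suc m))"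
  proof (rule bij_betw_imageI)
    show "inj_on (\<lambda>y. y ?N) ((\<lambda>z. z \<circ> adj m) ` coset_reps m)"
      using Suc by (auto simp: inj_on_def bij_betw_def adj_apply simp del: of_nat_Suc)
    show "(\<lambda>y. y ?N) ` (\<lambda>z. z \<circ> adj m) ` coset_reps m = signed_range (Suc m)"
      using Suc by (simp add: bij_betw_def image_image adj_apply del: of_nat_Suc)
  qed
  moreover have "bij_betw (\<lambda>y. y ?N) {id, flip ?N} {?N, - ?N}"
    by (auto simp: bij_betw_def flip_apply)
  ultimately show ?case unfolding coset_reps.simps r
    by (intro bij_betw_combine) auto
qed

lemma card_signed_range: "card (signed_range n) = 2 * n"
proof -
  have *: "signed_range n = int ` {1..n} \<union> (\<lambda>i. - int i) ` {1..n}"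
  proof (intro equalityI subsetI)
    fix x assume "x \<in> signed_range n"
    then show "x \<in> int ` {1..n} \<union> (\<lambda>i. - int i) ` {1..n}"
      by (cases "0 < x") (auto intro!: image_eqI[of _ _ "nat \<bar>x\<bar>"])
  qed auto
  have "card (signed_range n) = card (int ` {1..n}) + card ((\<lambda>i. - int i) ` {1..n})"
    unfolding * by (rule card_Un_disjoint) auto
  also have "card (int ` {1..n}) = n" by (simp add: card_image inj_on_def)
  also have "card ((\<lambda>i. - int i) ` {1..n}) = n" by (simp add: card_image inj_on_def)
  finally show ?thesis by simp
qed

lemma card_coset_reps: "card (coset_reps m) = 2 * Suc m"
  using bij_betw_same_card[OF bij_betw_coset_reps] card_signed_range by metis

lemma signed_perms_fix_top: "h \<in> signed_perms m \<Longrightarrow> h (hi m) = hi m"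
  by (auto intro: signed_permsD(4))

lemma coset_decomposition:
  assumes g: "g \<in> signed_perms (Suc m)" and y: "y \<in> signed_perms (Suc m)" and eq: "y (hi m) = g (hi m)"
  shows "\<exists>h\<in>signed_perms m. g = y \<circ> h"
proof -
  let ?h = "inv_into UNIV y \<circ> g"
  have "?h (hi m) = hi m" using eq[symmetric] signed_permsD(2)[OF y] by simp
  then have "?h \<in> signed_perms m"
    using signed_perms_predecessor[OF signed_perms_comp[OF signed_perms_inv[OF y] g]] by simp
  moreover have "g = y \<circ> ?h" using signed_permsD(1)[OF y] by (simp add: fun_eq_iff bij_is_surj surj_f_inv_f)
  ultimately show ?thesis by blast
qed

lemma bij_betw_cosets:
  "bij_betw (\<lambda>(y, h). y \<circ> h) (coset_reps m \<times> signed_perms m) (signed_perms (Suc m))"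
proof (rule bij_betw_imageI)
  show "inj_on (\<lambda>(y, h). y \<circ> h) (coset_reps m \<times> signed_perms m)"
  proof (rule inj_onI, clarify)
    fix y h y' h' assume y: "y \<in> coset_reps m" "y' \<in> coset_reps m"
      and h: "h \<in> signed_perms m" "h' \<in> signed_perms m" and eq: "y \<circ> h = y' \<circ> h'"
    have "y (hi m) = y' (hi m)" using fun_cong[OF eq, of "hi m"] h by (simp add: signed_perms_fix_top del: of_nat_Suc)
    then have "y = y'" using y bij_betw_coset_reps[of m] by (auto simp: bij_betw_def dest: inj_onD)
    moreover have "inj y" using y coset_reps_subset signed_permsD(2) by blast
    moreover have "y \<circ> h = y \<circ> h'" using eq \<open>y = y'\<close> by simp
    then have "h = h'" using \<open>inj y\<close> by (simp add: fun_eq_iff inj_eq)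
    ultimately show "y = y' \<and> h = h'" by simp
  qed
  show "(\<lambda>(y, h). y \<circ> h) ` (coset_reps m \<times> signed_perms m) = signed_perms (Suc m)"
  proof (intro equalityI subsetI)
    fix g assume "g \<in> (\<lambda>(y, h). y \<circ> h) ` (coset_reps m \<times> signed_perms m)"
    then show "g \<in> signed_perms (Suc m)"
      using coset_reps_subset signed_perms_mono[of m "Suc m"] by (auto intro: signed_perms_comp)
  next
    fix g assume g: "g \<in> signed_perms (Suc m)"
    have "g (hi m) \<in> signed_range (Suc m)" using signed_perms_range[OF g, of "hi m"] by simp
    then obtain y where y: "y \<in> coset_reps m" "y (hi m) = g (hi m)"
      using bij_betw_coset_reps[of m] unfolding bij_betw_def by (metis (no_types, lifting) imageE)
    then obtain h where "h \<in> signed_perms m" "g = y \<circ> h"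
      using coset_decomposition[OF g] coset_reps_subset by blast
    then show "g \<in> (\<lambda>(y, h). y \<circ> h) ` (coset_reps m \<times> signed_perms m)" using y by auto
  qed
qed

lemma sum_cosets:
  "(\<Sum>g\<in>signed_perms (Suc m). f g) = (\<Sum>y\<in>coset_reps m. \<Sum>h\<in>signed_perms m. f (y \<circ> h))"
  using sum.reindex_bij_betw[OF bij_betw_cosets, of f m]
  by (simp add: sum.cartesian_product case_prod_unfold)

lemma card_signed_perms_Suc: "card (signed_perms (Suc m)) = 2 * Suc m * card (signed_perms m)"
  using bij_betw_same_card[OF bij_betw_cosets, of m] by (simp add: card_cartesian_product card_coset_reps)

text \<open>The transform lives on this splitting: the representatives
  \<open>z \<circ> adj m\<close> share the factor \<open>z\<close> with the stage below, and the two
  others act diagonally in an adapted basis.\<close>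

lemma sum_coset_reps_Suc:
  "(\<Sum>y\<in>coset_reps (Suc m). f y) =
    f id + f (flip (hi (Suc m))) + (\<Sum>z\<in>coset_reps m. f (z \<circ> adj m))"
proof -
  let ?N = "hi (Suc m)" and ?I = "(\<lambda>z. z \<circ> adj m) ` coset_reps m"
  have range: "(z \<circ> adj m) ?N \<in> signed_range (Suc m)" if "z \<in> coset_reps m" for z
    using that bij_betw_coset_reps[of m] by (auto simp: bij_betw_def adj_apply simp del: of_nat_Suc)
  have out: "\<bar>y ?N\<bar> \<noteq> ?N" if y: "y \<in> ?I" for y
  proof -
    have "y ?N \<in> signed_range (Suc m)" using y range by blast
    then show ?thesis by simp
  qed
  have "\<bar>id ?N\<bar> = ?N" "\<bar>flip ?N ?N\<bar> = ?N" by (simp_all add: flip_apply)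
  then have "id \<notin> ?I" "flip ?N \<notin> ?I" using out by blast+
  moreover have "id \<noteq> flip ?N" by (auto simp: fun_eq_iff flip_apply intro!: exI[of _ ?N])
  moreover have "inj_on (\<lambda>z. z \<circ> adj m) (coset_reps m)"
  proof (rule inj_onI)
    fix y z :: "int \<Rightarrow> int" assume "y \<circ> adj m = z \<circ> adj m"
    then have "y \<circ> adj m \<circ> adj m = z \<circ> adj m \<circ> adj m" by simp
    then show "y = z" by (simp add: comp_assoc adj_adj)
  qed
  ultimately show ?thesis
    using finite_coset_reps[of m] by (simp add: sum.reindex add.assoc del: of_nat_Suc)
qed

text \<open>Questions about all matrices of the large group thereby reduce to the matrix of
  \<open>adj m\<close>: those of the smaller group are block diagonal in an adapted basis, and that
  of the top flip is diagonal.\<close>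

lemma double_coset:
  assumes g: "g \<in> signed_perms (Suc (Suc m))"
  obtains "g \<in> signed_perms (Suc m)"
  | h where "h \<in> signed_perms (Suc m)" "g = flip (hi (Suc m)) \<circ> h"
  | h h' where "h \<in> signed_perms (Suc m)" "h' \<in> signed_perms (Suc m)" "g = h \<circ> adj m \<circ> h'"
proof -
  have "g \<in> (\<lambda>(y, h). y \<circ> h) ` (coset_reps (Suc m) \<times> signed_perms (Suc m))"
    using bij_betw_cosets[of "Suc m"] g by (simp add: bij_betw_def)
  then obtain y h where yh: "y \<in> coset_reps (Suc m)" "h \<in> signed_perms (Suc m)" "g = y \<circ> h" by auto
  consider "y = id" | "y = flip (hi (Suc m))" | z where "z \<in> coset_reps m" "y = z \<circ> adj m"
    using yh(1) by auto
  then show thesis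
  proof cases
    case 1
    then show thesis using that(1) yh by simp
  next
    case 2
    then show thesis using that(2) yh by simp
  next
    case 3
    then show thesis using that(3)[of z h] yh coset_reps_subset[of m] by auto
  qed
qed

section \<open>The two kinds of reflections, and those that are new on a level\<close>

definition reflections :: "nat \<Rightarrow> (int \<Rightarrow> int) set" where
  "reflections n = {swap i j |i j. i \<in> signed_range n \<and> j \<in> signed_range n \<and> \<bar>i\<bar> \<noteq> \<bar>j\<bar>}"

text \<open>The sum of these elements is a Jucys-Murphy element: the difference of the sums over all
  \<open>swap\<close> reflections on two successive levels.\<close>

definition new_reflections :: "nat \<Rightarrow> (int \<Rightarrow> int) set" where
  "new_reflections m = (\<lambda>j. swap j (hi m)) ` signed_range m"

definition flips :: "nat \<Rightarrow> (int \<Rightarrow> int) set" where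
  "flips n = flip ` signed_range n"

lemma reflections_subset: "reflections n \<subseteq> signed_perms n"
  by (auto simp: reflections_def intro!: swap_in)

lemma flips_subset: "flips n \<subseteq> signed_perms n"
  by (auto simp: flips_def intro!: flip_in)

lemma new_reflections_subset: "new_reflections m \<subseteq> signed_perms (Suc m)"
  by (auto simp: new_reflections_def intro!: swap_in)

lemma reflections_conj:
  assumes g: "g \<in> signed_perms n"
  shows "r \<in> reflections n \<Longrightarrow> \<exists>r'\<in>reflections n. g \<circ> r = r' \<circ> g"
proof -
  assume "r \<in> reflections n"
  then obtain i j where ij: "i \<in> signed_range n" "j \<in> signed_range n" "\<bar>i\<bar> \<noteq> \<bar>j\<bar>" "r = swap i j"
    by (auto simp: reflections_def)
  have "\<bar>g i\<bar> \<noteq> \<bar>g j\<bar>"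
  proof
    assume "\<bar>g i\<bar> = \<bar>g j\<bar>"
    then have "g i = g j \<or> g i = g (- j)" using signed_permsD(3)[OF g] by (auto simp: abs_eq_iff)
    then have "i = j \<or> i = - j" using signed_permsD(2)[OF g] by (auto dest: injD)
    then show False using ij by auto
  qed
  then have "swap (g i) (g j) \<in> reflections n"
    using signed_perms_range[OF g] ij unfolding reflections_def by blast
  then show ?thesis using swap_conj[OF g] ij by blast
qed

lemma flips_conj:
  assumes g: "g \<in> signed_perms n"
  shows "r \<in> flips n \<Longrightarrow> \<exists>r'\<in>flips n. g \<circ> r = r' \<circ> g"
  using signed_perms_range[OF g] flip_conj[OF g] by (auto simp: flips_def)

lemma new_reflections_disjoint: "reflections m \<inter> new_reflections m = {}"
proof -
  have "swap j (hi m) (hi m) \<noteq> hi m" if "j \<in> signed_range m" for j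
    using that by (auto simp: swap_apply)
  then show ?thesis
    using reflections_subset[of m] signed_perms_fix_top unfolding new_reflections_def by blast
qed

lemma reflections_Suc: "reflections (Suc m) = reflections m \<union> new_reflections m"
proof (intro equalityI subsetI)
  fix r assume "r \<in> reflections (Suc m)"
  then obtain i j where ij: "i \<in> signed_range (Suc m)" "j \<in> signed_range (Suc m)" "\<bar>i\<bar> \<noteq> \<bar>j\<bar>" "r = swap i j"
    by (auto simp: reflections_def)
  have new: "swap a b \<in> new_reflections m" if ab: "a \<in> signed_range m" "\<bar>b\<bar> = hi m" for a b
  proof -
    from ab have "b = hi m \<or> b = - hi m" by auto
    then show ?thesis
    proof
      assume "b = - hi m"
      then have "swap a b = swap (- a) (hi m)" using swap_uminus[of "- a" "hi m"] ab by auto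
      then show ?thesis using ab unfolding new_reflections_def by auto
    qed (use ab in \<open>auto simp: new_reflections_def\<close>)
  qed
  have "\<bar>i\<bar> \<le> int m \<or> \<bar>i\<bar> = hi m" "\<bar>j\<bar> \<le> int m \<or> \<bar>j\<bar> = hi m" using ij by auto
  then consider "i \<in> signed_range m" "j \<in> signed_range m" | "i \<in> signed_range m" "\<bar>j\<bar> = hi m"
    | "j \<in> signed_range m" "\<bar>i\<bar> = hi m"
    using ij by auto
  then show "r \<in> reflections m \<union> new_reflections m"
  proof cases
    case 1
    then show ?thesis using ij unfolding reflections_def by blast
  next
    case 2
    then show ?thesis using new ij by auto
  next
    case 3
    then show ?thesis using new[of j i] ij swap_commute[of i j] by auto
  qed
next
  fix r assume "r \<in> reflections m \<union> new_reflections m"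
  then show "r \<in> reflections (Suc m)"
  proof
    assume "r \<in> reflections m"
    then show ?thesis unfolding reflections_def by fastforce
  next
    assume "r \<in> new_reflections m"
    then obtain j where "r = swap j (hi m)" "j \<in> signed_range m" by (auto simp: new_reflections_def)
    moreover have "hi m \<in> signed_range (Suc m)" "j \<in> signed_range (Suc m)" "\<bar>j\<bar> \<noteq> \<bar>hi m\<bar>"
      using calculation by auto
    ultimately show ?thesis unfolding reflections_def by blast
  qed
qed

lemma flips_Suc: "flips (Suc m) = insert (flip (hi m)) (flips m)"
proof -
  have "signed_range (Suc m) = {hi m, - hi m} \<union> signed_range m" by auto
  then have "flips (Suc m) = flip ` {hi m, - hi m} \<union> flip ` signed_range m"
    unfolding flips_def by (simp only: image_Un)
  then show ?thesis by (simp add: flips_def flip_uminus[of "hi m"] del: of_nat_Suc)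
qed

lemma flip_top_notin_flips: "flip (hi m) \<notin> flips m"
proof
  assume "flip (hi m) \<in> flips m"
  then have "flip (hi m) (hi m) = hi m" using flips_subset signed_perms_fix_top by blast
  then show False by (simp add: flip_apply)
qed

lemma inj_on_new_reflections: "inj_on (\<lambda>j. swap j (hi m)) (signed_range m)"
proof (rule inj_onI)
  fix i j assume "i \<in> signed_range m" "j \<in> signed_range m" "swap i (hi m) = swap j (hi m)"
  then show "i = j" by (auto simp: swap_apply dest!: fun_cong[of _ _ "hi m"] split: if_splits)
qed

lemma card_new_reflections: "card (new_reflections m) = 2 * m"
  unfolding new_reflections_def using card_image[OF inj_on_new_reflections, of m] card_signed_range[of m]
  by (simp del: of_nat_Suc)

text \<open>Recursion of the Jucys-Murphy elements: conjugation by \<open>adj m\<close> lifts one to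
  the next level, except for the two reflections that exchange the two top points up to sign.
  Multiplied by \<open>adj m\<close>, these two become the identity and, by \<open>swap_adj\<close>,
  the product of two flips.\<close>

lemma adj_conj_new_reflections:
  "(\<lambda>r. adj m \<circ> r \<circ> adj m) ` new_reflections m \<union> {adj m, swap (- hi m) (hi (Suc m))} =
    new_reflections (Suc m)"
  "adj m \<notin> (\<lambda>r. adj m \<circ> r \<circ> adj m) ` new_reflections m"
  "swap (- hi m) (hi (Suc m)) \<notin> (\<lambda>r. adj m \<circ> r \<circ> adj m) ` new_reflections m"
  "adj m \<noteq> swap (- hi m) (hi (Suc m))"
proof -
  have c: "adj m \<circ> swap j (hi m) \<circ> adj m = swap j (hi (Suc m))" if "j \<in> signed_range m" for j
    using that by (simp add: swap_conj[OF adj_in] adj_apply comp_assoc adj_adj del: of_nat_Suc)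
  then have im: "(\<lambda>r. adj m \<circ> r \<circ> adj m) ` new_reflections m = (\<lambda>j. swap j (hi (Suc m))) ` signed_range m"
    unfolding new_reflections_def image_image by (intro image_cong) auto
  have r: "signed_range (Suc m) = signed_range m \<union> {hi m, - hi m}" by auto
  show "(\<lambda>r. adj m \<circ> r \<circ> adj m) ` new_reflections m \<union> {adj m, swap (- hi m) (hi (Suc m))} =
    new_reflections (Suc m)"
    unfolding im unfolding new_reflections_def r image_Un by (simp add: adj_def)
  have ne: "swap a (hi (Suc m)) \<noteq> swap j (hi (Suc m))"
    if "a \<in> signed_range (Suc m)" "j \<in> signed_range (Suc m)" "a \<noteq> j" for a j
    using inj_onD[OF inj_on_new_reflections[of "Suc m"]] that by blast
  show "adj m \<notin> (\<lambda>r. adj m \<circ> r \<circ> adj m) ` new_reflections m"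
    unfolding im unfolding adj_def
  proof
    assume "swap (hi m) (hi (Suc m)) \<in> (\<lambda>j. swap j (hi (Suc m))) ` signed_range m"
    then obtain j where "j \<in> signed_range m" "swap (hi m) (hi (Suc m)) = swap j (hi (Suc m))" by blast
    then show False using ne[of "hi m" j] by fastforce
  qed
  show "swap (- hi m) (hi (Suc m)) \<notin> (\<lambda>r. adj m \<circ> r \<circ> adj m) ` new_reflections m"
    unfolding im
  proof
    assume "swap (- hi m) (hi (Suc m)) \<in> (\<lambda>j. swap j (hi (Suc m))) ` signed_range m"
    then obtain j where "j \<in> signed_range m" "swap (- hi m) (hi (Suc m)) = swap j (hi (Suc m))" by blast
    then show False using ne[of "- hi m" j] by fastforce
  qed
  show "adj m \<noteq> swap (- hi m) (hi (Suc m))"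
    unfolding adj_def using ne[of "hi m" "- hi m"] by simp
qed

lemma swap_adj: "swap (- hi m) (hi (Suc m)) \<circ> adj m = flip (hi m) \<circ> flip (hi (Suc m))"
  by (auto simp: adj_def swap_apply flip_apply fun_eq_iff)

lemma flip_adj: "flip (hi (Suc m)) \<circ> adj m = adj m \<circ> flip (hi m)"
  by (simp add: flip_conj[OF adj_in] adj_apply del: of_nat_Suc)

text \<open>The conjugating \<open>z\<close> lies in the smaller group and hence preserves the
  constituents of a restriction. In \<open>secular\<close> this gives all new reflections the same
  trace on a constituent.\<close>

lemma new_reflection_conj:
  assumes "r \<in> new_reflections (Suc m)"
  obtains z where "z \<in> signed_perms (Suc m)" "z \<circ> adj m = r \<circ> z"
proof -
  obtain j where j: "r = swap j (hi (Suc m))" "j \<in> signed_range (Suc m)"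
    using assms by (auto simp: new_reflections_def)
  then obtain z where z: "z \<in> coset_reps m" "z (hi m) = j"
    using bij_betw_coset_reps[of m] unfolding bij_betw_def by (metis (no_types, lifting) imageE)
  then have zs: "z \<in> signed_perms (Suc m)" using coset_reps_subset by blast
  have "z \<circ> adj m = r \<circ> z"
    unfolding adj_def using swap_conj[OF zs] z j signed_perms_fix_top[OF zs] by (simp del: of_nat_Suc)
  then show thesis using that zs by blast
qed

section \<open>Cost of straight-line programs\<close>

lemma run_append:
  "run I x (p @ q) ws = Option.bind (run I x p ws) (\<lambda>us. run I x q us)"
  by (induction p arbitrary: ws) (auto split: bind_split)

lemma operand_value_append:
  "operand_value I x ws a = Some v \<Longrightarrow> operand_value I x (ws @ us) a = Some v"
  by (cases a) (auto simp: nth_append split: if_splits)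

lemma run_length: "run I x p ws = Some us \<Longrightarrow> length us = length ws + length p"
  by (induction p arbitrary: ws) (auto split: bind_splits)

definition computable ::
  "'i set \<Rightarrow> nat \<Rightarrow> nat \<Rightarrow> (('i \<Rightarrow> complex) \<Rightarrow> complex) set \<Rightarrow> bool" where
  "computable I a m \<Phi> \<longleftrightarrow> (\<exists>p. computes I p \<Phi> \<and> add_count p \<le> a \<and> mult_count p \<le> m)"

lemma computable_inputs: "computable I 0 0 ((\<lambda>i x. x i) ` I)"
  unfolding computable_def
  by (intro exI[of _ "[]"]) (auto simp: computes_def add_count_def mult_count_def intro!: exI[of _ "Input _"])

lemma computable_insert_const: "computable I a m \<Phi> \<Longrightarrow> computable I a m (insert (\<lambda>x. c) \<Phi>)"
proof -
  assume "computable I a m \<Phi>"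
  then obtain p where p: "computes I p \<Phi>" "add_count p \<le> a" "mult_count p \<le> m"
    by (auto simp: computable_def)
  have "computes I p (insert (\<lambda>x. c) \<Phi>)"
    using p(1) unfolding computes_def by (metis insert_iff operand_value.simps(2))
  then show ?thesis using p unfolding computable_def by blast
qed

lemma computable_subset: "computable I a m \<Phi> \<Longrightarrow> \<Psi> \<subseteq> \<Phi> \<Longrightarrow> computable I a m \<Psi>"
  unfolding computable_def computes_def by blast

lemma computable_mono: "computable I a m \<Phi> \<Longrightarrow> a \<le> a' \<Longrightarrow> m \<le> m' \<Longrightarrow> computable I a' m' \<Phi>"
  unfolding computable_def by (meson order_trans)

lemma computes_step:
  assumes p: "computes I p \<Phi>" and "\<phi> \<in> \<Phi>" "\<psi> \<in> \<Phi>"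
    and q: "\<And>x. apply_op q (\<phi> x) (\<psi> x) = Some (\<chi> x)"
  obtains a b where "computes I (p @ [Instr q a b]) (insert \<chi> \<Phi>)"
proof -
  obtain a b where a: "\<And>x. operand_value I x (the (run I x p [])) a = Some (\<phi> x)"
    and b: "\<And>x. operand_value I x (the (run I x p [])) b = Some (\<psi> x)"
    using p assms(2,3) unfolding computes_def by meson
  have r: "run I x (p @ [Instr q a b]) [] = Some (the (run I x p []) @ [\<chi> x])" for x
  proof -
    obtain ws where "run I x p [] = Some ws" using p unfolding computes_def by blast
    then show ?thesis using a[of x] b[of x] q[of x] by (simp add: run_append)
  qed
  have len: "length (the (run I x p [])) = length p" for x
  proof -
    obtain ws where "run I x p [] = Some ws" using p unfolding computes_def by blast
    then show ?thesis using run_length by fastforce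
  qed
  have "computes I (p @ [Instr q a b]) (insert \<chi> \<Phi>)"
    unfolding computes_def r
  proof (intro conjI allI ballI)
    fix \<theta> assume "\<theta> \<in> insert \<chi> \<Phi>"
    then consider "\<theta> = \<chi>" | "\<theta> \<in> \<Phi>" by blast
    then show "\<exists>c. \<forall>x. operand_value I x (the (Some (the (run I x p []) @ [\<chi> x]))) c = Some (\<theta> x)"
    proof cases
      case 1
      then show ?thesis using len by (intro exI[of _ "Result (length p)"]) (simp add: nth_append)
    next
      case 2
      then obtain c where "\<And>x. operand_value I x (the (run I x p [])) c = Some (\<theta> x)"
        using p unfolding computes_def by meson
      then show ?thesis using operand_value_append by fastforce
    qed
  qed simp
  then show thesis by (rule that)
qed

lemma computable_plus:
  assumes "computable I a m \<Phi>" "\<phi> \<in> \<Phi>" "\<psi> \<in> \<Phi>"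
  shows "computable I (Suc a) m (insert (\<lambda>x. \<phi> x + \<psi> x) \<Phi>)"
proof -
  obtain p where p: "computes I p \<Phi>" "add_count p \<le> a" "mult_count p \<le> m"
    using assms(1) by (auto simp: computable_def)
  obtain b c where "computes I (p @ [Instr Plus b c]) (insert (\<lambda>x. \<phi> x + \<psi> x) \<Phi>)"
    using computes_step[OF p(1) assms(2,3), of Plus "\<lambda>x. \<phi> x + \<psi> x"] by auto
  then show ?thesis unfolding computable_def
    using p by (intro exI[of _ "p @ [Instr Plus b c]"]) (auto simp: add_count_def mult_count_def)
qed

lemma computable_minus:
  assumes "computable I a m \<Phi>" "\<phi> \<in> \<Phi>" "\<psi> \<in> \<Phi>"
  shows "computable I (Suc a) m (insert (\<lambda>x. \<phi> x - \<psi> x) \<Phi>)"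
proof -
  obtain p where p: "computes I p \<Phi>" "add_count p \<le> a" "mult_count p \<le> m"
    using assms(1) by (auto simp: computable_def)
  obtain b c where "computes I (p @ [Instr Minus b c]) (insert (\<lambda>x. \<phi> x - \<psi> x) \<Phi>)"
    using computes_step[OF p(1) assms(2,3), of Minus "\<lambda>x. \<phi> x - \<psi> x"] by auto
  then show ?thesis unfolding computable_def
    using p by (intro exI[of _ "p @ [Instr Minus b c]"]) (auto simp: add_count_def mult_count_def)
qed

lemma computable_scale:
  assumes "computable I a m \<Phi>" "\<phi> \<in> \<Phi>"
  shows "computable I a (Suc m) (insert (\<lambda>x. c * \<phi> x) \<Phi>)"
proof -
  obtain p where p: "computes I p (insert (\<lambda>x. c) \<Phi>)" "add_count p \<le> a" "mult_count p \<le> m"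
    using computable_insert_const[OF assms(1)] by (auto simp: computable_def)
  obtain b d where "computes I (p @ [Instr Times b d]) (insert (\<lambda>x. c * \<phi> x) (insert (\<lambda>x. c) \<Phi>))"
    using computes_step[OF p(1), of "\<lambda>x. c" \<phi> Times "\<lambda>x. c * \<phi> x"] assms(2) by auto
  then have "computable I a (Suc m) (insert (\<lambda>x. c * \<phi> x) (insert (\<lambda>x. c) \<Phi>))"
    unfolding computable_def
    using p by (intro exI[of _ "p @ [Instr Times b d]"]) (auto simp: add_count_def mult_count_def)
  then show ?thesis by (rule computable_subset) auto
qed

text \<open>The quantifier over every larger \<open>\<Phi>0\<close> makes the cost incremental: a
  program that already holds \<open>\<Phi>\<close> is prolonged and keeps whatever else it holds.
  Costs therefore add up under \<open>extends_trans\<close> and \<open>extends_UN\<close>, and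
  intermediate results are shared.\<close>

definition extends :: "'i set \<Rightarrow> (('i \<Rightarrow> complex) \<Rightarrow> complex) set \<Rightarrow>
    (('i \<Rightarrow> complex) \<Rightarrow> complex) set \<Rightarrow> nat \<Rightarrow> nat \<Rightarrow> bool" where
  "extends I \<Phi> \<Psi> a m \<longleftrightarrow> (\<forall>a0 m0 \<Phi>0. \<Phi> \<subseteq> \<Phi>0 \<longrightarrow> computable I a0 m0 \<Phi>0 \<longrightarrow>
     computable I (a0 + a) (m0 + m) (\<Phi>0 \<union> \<Psi>))"

lemma extendsD:
  "extends I \<Phi> \<Psi> a m \<Longrightarrow> \<Phi> \<subseteq> \<Phi>0 \<Longrightarrow> computable I a0 m0 \<Phi>0 \<Longrightarrow>
    computable I (a0 + a) (m0 + m) (\<Phi>0 \<union> \<Psi>)"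
  by (auto simp: extends_def)

lemma extends_mono:
  assumes "extends I \<Phi> \<Psi> a m" "\<Phi> \<subseteq> \<Phi>'" "\<Psi>' \<subseteq> \<Psi>" "a \<le> a'" "m \<le> m'"
  shows "extends I \<Phi>' \<Psi>' a' m'"
  unfolding extends_def
proof (intro allI impI)
  fix a0 m0 \<Phi>0 assume "\<Phi>' \<subseteq> \<Phi>0" "computable I a0 m0 \<Phi>0"
  then have "computable I (a0 + a) (m0 + m) (\<Phi>0 \<union> \<Psi>)"
    using assms(2) by (intro extendsD[OF assms(1)]) auto
  then have "computable I (a0 + a) (m0 + m) (\<Phi>0 \<union> \<Psi>')"
    by (rule computable_subset) (use assms(3) in auto)
  then show "computable I (a0 + a') (m0 + m') (\<Phi>0 \<union> \<Psi>')"
    by (rule computable_mono) (use assms(4,5) in auto)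
qed

lemma extends_trans:
  assumes "extends I \<Phi> \<Psi> a m" "extends I (\<Phi> \<union> \<Psi>) \<Psi>' a' m'"
  shows "extends I \<Phi> (\<Psi> \<union> \<Psi>') (a + a') (m + m')"
  unfolding extends_def
proof (intro allI impI)
  fix a0 m0 \<Phi>0 assume sub: "\<Phi> \<subseteq> \<Phi>0" and "computable I a0 m0 \<Phi>0"
  then have "computable I (a0 + a) (m0 + m) (\<Phi>0 \<union> \<Psi>)" by (rule extendsD[OF assms(1)])
  then have "computable I (a0 + a + a') (m0 + m + m') (\<Phi>0 \<union> \<Psi> \<union> \<Psi>')"
    by (rule extendsD[OF assms(2), rotated]) (use sub in auto)
  then show "computable I (a0 + (a + a')) (m0 + (m + m')) (\<Phi>0 \<union> (\<Psi> \<union> \<Psi>'))"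
    by (simp add: add.assoc Un_assoc)
qed

lemma extends_subset: "\<Psi> \<subseteq> \<Phi> \<Longrightarrow> extends I \<Phi> \<Psi> 0 0"
  unfolding extends_def by (auto intro: computable_subset)

lemma extends_UN:
  assumes "finite S" "\<And>i. i \<in> S \<Longrightarrow> extends I \<Phi> (\<Psi> i) (a i) (m i)"
  shows "extends I \<Phi> (\<Union>i\<in>S. \<Psi> i) (\<Sum>i\<in>S. a i) (\<Sum>i\<in>S. m i)"
  using assms
proof (induction S rule: finite_induct)
  case empty
  then show ?case by (simp add: extends_subset)
next
  case (insert i S)
  have "extends I \<Phi> (\<Union>i\<in>S. \<Psi> i) (\<Sum>i\<in>S. a i) (\<Sum>i\<in>S. m i)"
    by (rule insert.IH) (use insert.prems in blast)
  then have 1: "extends I (\<Phi> \<union> \<Psi> i) (\<Union>i\<in>S. \<Psi> i) (\<Sum>i\<in>S. a i) (\<Sum>i\<in>S. m i)"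
    by (rule extends_mono) auto
  have "extends I \<Phi> (\<Psi> i) (a i) (m i)" using insert.prems by simp
  from extends_trans[OF this 1] show ?case using insert by simp
qed

lemma extends_const: "extends I \<Phi> {\<lambda>x. c} 0 0"
  unfolding extends_def using computable_insert_const by fastforce

lemma extends_scale: "\<phi> \<in> \<Phi> \<Longrightarrow> extends I \<Phi> {\<lambda>x. c * \<phi> x} 0 1"
  unfolding extends_def using computable_scale by fastforce

lemma extends_plus: "\<phi> \<in> \<Phi> \<Longrightarrow> \<psi> \<in> \<Phi> \<Longrightarrow> extends I \<Phi> {\<lambda>x. \<phi> x + \<psi> x} 1 0"
  unfolding extends_def using computable_plus by fastforce

text \<open>A sign costs no multiplication, since it only selects between \<open>Plus\<close> and
  \<open>Minus\<close>. Thus the coset representatives \<open>id\<close> and \<open>flip\<close> are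
  combined by a single addition.\<close>

lemma extends_sign:
  assumes "\<phi> \<in> \<Phi>" "\<psi> \<in> \<Phi>" "c = 1 \<or> c = - 1"
  shows "extends I \<Phi> {\<lambda>x. \<phi> x + c * \<psi> x} 1 0"
  using assms(3)
proof
  assume "c = 1"
  then show ?thesis using extends_plus[OF assms(1,2)] by simp
next
  assume "c = - 1"
  moreover have "extends I \<Phi> {\<lambda>x. \<phi> x - \<psi> x} 1 0"
    unfolding extends_def using computable_minus assms(1,2) by fastforce
  ultimately show ?thesis by simp
qed

text \<open>Starting from \<open>\<beta>\<close> makes the number of additions equal to that of
  multiplications; \<open>\<beta>\<close> will be the combined contribution of \<open>id\<close> and
  the flip.\<close>

lemma extends_linear_combination:
  assumes "finite S" "\<beta> \<in> \<Phi>" "\<And>i. i \<in> S \<Longrightarrow> \<phi> i \<in> \<Phi>"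
  shows "extends I \<Phi> {\<lambda>x. \<beta> x + (\<Sum>i\<in>S. c i * \<phi> i x)} (card S) (card S)"
  using assms
proof (induction S rule: finite_induct)
  case empty
  then show ?case by (simp add: extends_subset)
next
  case (insert i S)
  let ?f = "\<lambda>x. \<beta> x + (\<Sum>i\<in>S. c i * \<phi> i x)" and ?g = "\<lambda>x. c i * \<phi> i x"
  have 1: "extends I \<Phi> {?f} (card S) (card S)" using insert by auto
  have 2: "extends I (\<Phi> \<union> {?f}) {?g} 0 1" using insert.prems by (intro extends_scale) auto
  have 3: "extends I (\<Phi> \<union> ({?f} \<union> {?g})) {\<lambda>x. ?f x + ?g x} 1 0" by (intro extends_plus) auto
  have "extends I \<Phi> ({?f} \<union> {?g} \<union> {\<lambda>x. ?f x + ?g x}) (card S + 0 + 1) (card S + 1 + 0)"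
    by (rule extends_trans[OF extends_trans[OF 1 2] 3])
  moreover have "(\<lambda>x. ?f x + ?g x) = (\<lambda>x. \<beta> x + (\<Sum>i\<in>insert i S. c i * \<phi> i x))"
    using insert by (simp add: fun_eq_iff algebra_simps)
  ultimately show ?case using insert by (auto elim: extends_mono)
qed

section \<open>A chain of adapted irreducible representations\<close>

type_synonym rep = "(int \<Rightarrow> int) \<Rightarrow> complex mat"

lemma blk_eqD:
  assumes "i < sum_list ds" "j < sum_list ds" "fst (blk ds i) = fst (blk ds j)" "snd (blk ds i) = snd (blk ds j)"
  shows "i = j"
  using assms blk_bounds(3) by metis

text \<open>An adapted choice for the entire chain at once. The restriction is an equality of
  matrices and \<open>kids\<close> is a list, so the order of the diagonal blocks is part of the
  data, and repetitions are not yet excluded.\<close>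

locale branching =
  fixes R :: "nat \<Rightarrow> rep set" and kids :: "nat \<Rightarrow> rep \<Rightarrow> rep list"
  assumes complete: "complete_irreps (weyl_B m) (R m)"
    and kids_subset: "\<rho> \<in> R (Suc m) \<Longrightarrow> set (kids m \<rho>) \<subseteq> R m"
    and kids_restrict: "\<rho> \<in> R (Suc m) \<Longrightarrow> restricts_to (signed_perms m) \<rho> (kids m \<rho>)"
begin

definition d :: "rep \<Rightarrow> nat" where
  "d \<rho> = dim_row (\<rho> id)"

lemma rep_degree_eq: "rep_degree (weyl_B m) \<rho> = d \<rho>"
  by (simp add: rep_degree_def d_def weyl_B_one)

lemma irreducible: "\<rho> \<in> R m \<Longrightarrow> irreducible_rep (weyl_B m) \<rho>"
  using complete[of m] by (simp add: complete_irreps_def)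

lemma R_equivalent: "\<rho> \<in> R m \<Longrightarrow> \<sigma> \<in> R m \<Longrightarrow> equivalent_reps (weyl_B m) \<rho> \<sigma> \<Longrightarrow> \<rho> = \<sigma>"
  using complete[of m] by (auto simp: complete_irreps_def)

lemma is_rep: "\<rho> \<in> R m \<Longrightarrow> matrix_rep (weyl_B m) \<rho>"
  using irreducible by (simp add: irreducible_rep_iff)

lemma d_pos: "\<rho> \<in> R m \<Longrightarrow> 0 < d \<rho>"
  using irreducible[of \<rho> m] by (simp add: irreducible_rep_iff rep_degree_eq)

lemma carrier: "\<rho> \<in> R m \<Longrightarrow> g \<in> signed_perms m \<Longrightarrow> \<rho> g \<in> carrier_mat (d \<rho>) (d \<rho>)"
  using finite_group.rep_carrier[OF finite_group_weyl_B is_rep] by (simp add: rep_degree_eq carrier_weyl_B)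

lemma mult_index:
  assumes "\<rho> \<in> R m" "g \<in> signed_perms m" "h \<in> signed_perms m" "i < d \<rho>" "j < d \<rho>"
  shows "\<rho> (g \<circ> h) $$ (i, j) = (\<Sum>k<d \<rho>. \<rho> g $$ (i, k) * \<rho> h $$ (k, j))"
  using finite_group.rep_mult_index[OF finite_group_weyl_B is_rep[OF assms(1)], of g h i j] assms
  by (simp add: rep_degree_eq carrier_weyl_B weyl_B_mult)

lemma id_index: "\<rho> \<in> R m \<Longrightarrow> i < d \<rho> \<Longrightarrow> j < d \<rho> \<Longrightarrow> \<rho> id $$ (i, j) = (if i = j then 1 else 0)"
  using finite_group.rep_one_index[OF finite_group_weyl_B is_rep, of \<rho> m i j]
  by (simp add: rep_degree_eq weyl_B_one)

lemma coefficient_nonzero: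
  "\<rho> \<in> R m \<Longrightarrow> i < d \<rho> \<Longrightarrow> j < d \<rho> \<Longrightarrow> \<exists>g\<in>signed_perms m. \<rho> g $$ (i, j) \<noteq> 0"
  using finite_group.irreducible_coefficient_nonzero[OF finite_group_weyl_B irreducible, of \<rho> m i j]
  by (simp add: rep_degree_eq carrier_weyl_B)

lemma schur_zero:
  assumes "\<rho> \<in> R m" "\<sigma> \<in> R m" "\<sigma> \<noteq> \<rho>"
    and "\<And>g i j. g \<in> signed_perms m \<Longrightarrow> i < d \<sigma> \<Longrightarrow> j < d \<rho> \<Longrightarrow>
      (\<Sum>k<d \<rho>. F i k * \<rho> g $$ (k, j)) = (\<Sum>k<d \<sigma>. \<sigma> g $$ (i, k) * F k j)"
    and "i < d \<sigma>" "j < d \<rho>"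
  shows "F i j = 0"
proof -
  have ne: "\<not> equivalent_reps (weyl_B m) \<sigma> \<rho>" using R_equivalent[OF assms(2,1)] assms(3) by blast
  show ?thesis
    using finite_group.schur_zero_index[OF finite_group_weyl_B irreducible[OF assms(1)]
        irreducible[OF assms(2)] ne, of F i j] assms(4-6)
    by (simp add: rep_degree_eq carrier_weyl_B)
qed

lemma schur_scalar:
  assumes "\<rho> \<in> R m"
    and "\<And>g i j. g \<in> signed_perms m \<Longrightarrow> i < d \<rho> \<Longrightarrow> j < d \<rho> \<Longrightarrow>
      (\<Sum>k<d \<rho>. F i k * \<rho> g $$ (k, j)) = (\<Sum>k<d \<rho>. \<rho> g $$ (i, k) * F k j)"
    and "i < d \<rho>" "j < d \<rho>"
  shows "F i j = (if i = j then F 0 0 else 0)"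
  using finite_group.schur_scalar_index[OF finite_group_weyl_B irreducible[OF assms(1)], of F i j] assms
  by (simp add: rep_degree_eq carrier_weyl_B)

section \<open>Coordinates of an adapted basis\<close>

definition block :: "nat \<Rightarrow> rep \<Rightarrow> nat \<Rightarrow> nat" where
  "block m \<rho> i = fst (blk (map d (kids m \<rho>)) i)"

definition loc :: "nat \<Rightarrow> rep \<Rightarrow> nat \<Rightarrow> nat" where
  "loc m \<rho> i = snd (blk (map d (kids m \<rho>)) i)"

text \<open>The block number is kept apart from the representation in the block, because two blocks
  with the same representation are ruled out only by \<open>block_eq_if_kid_eq\<close>.\<close>

definition kid :: "nat \<Rightarrow> rep \<Rightarrow> nat \<Rightarrow> rep" where
  "kid m \<rho> i = kids m \<rho> ! block m \<rho> i"

lemma map_dim_row_kids: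
  assumes "\<rho> \<in> R (Suc m)" "h \<in> signed_perms m"
  shows "map dim_row (map (\<lambda>\<sigma>. \<sigma> h) (kids m \<rho>)) = map d (kids m \<rho>)"
  using kids_subset[OF assms(1)] carrier[OF _ assms(2)] by fastforce

lemma sum_list_kids:
  assumes "\<rho> \<in> R (Suc m)"
  shows "sum_list (map d (kids m \<rho>)) = d \<rho>"
proof -
  have "\<rho> id = diag_block_mat (map (\<lambda>\<sigma>. \<sigma> id) (kids m \<rho>))"
    using kids_restrict[OF assms] by (simp add: restricts_to_def)
  then have "d \<rho> = sum_list (map dim_row (map (\<lambda>\<sigma>. \<sigma> id) (kids m \<rho>)))"
    by (simp add: d_def dim_diag_block_mat(1))
  then show ?thesis unfolding map_dim_row_kids[OF assms signed_perms_id] by simp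
qed

lemma block_bounds:
  assumes "\<rho> \<in> R (Suc m)" "i < d \<rho>"
  shows "block m \<rho> i < length (kids m \<rho>)" "loc m \<rho> i < d (kid m \<rho> i)" "kid m \<rho> i \<in> R m"
    "kid m \<rho> i \<in> set (kids m \<rho>)"
proof -
  have i: "i < sum_list (map d (kids m \<rho>))" using assms sum_list_kids by simp
  show b: "block m \<rho> i < length (kids m \<rho>)" using blk_bounds(1)[OF i] by (simp add: block_def)
  show "loc m \<rho> i < d (kid m \<rho> i)"
    using blk_bounds(2)[OF i] b by (simp add: loc_def block_def kid_def)
  show "kid m \<rho> i \<in> set (kids m \<rho>)" using b by (simp add: kid_def)
  then show "kid m \<rho> i \<in> R m" using kids_subset[OF assms(1)] by blast
qed

lemma block_loc_inject:
  assumes "\<rho> \<in> R (Suc m)" "i < d \<rho>" "j < d \<rho>" "block m \<rho> i = block m \<rho> j" "loc m \<rho> i = loc m \<rho> j"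
  shows "i = j"
  using blk_eqD[of i "map d (kids m \<rho>)" j] assms sum_list_kids by (simp add: block_def loc_def)

lemma ex_index:
  assumes "\<rho> \<in> R (Suc m)" "t < length (kids m \<rho>)" "b < d (kids m \<rho> ! t)"
  shows "\<exists>i<d \<rho>. block m \<rho> i = t \<and> loc m \<rho> i = b"
  using blk_at[of t "map d (kids m \<rho>)" b] assms sum_list_kids
  by (auto simp: block_def loc_def intro!: exI[of _ "sum_list (take t (map d (kids m \<rho>))) + b"])

lemma restrict_index:
  assumes r: "\<rho> \<in> R (Suc m)" and h: "h \<in> signed_perms m" and ij: "i < d \<rho>" "j < d \<rho>"
  shows "\<rho> h $$ (i, j) =
    (if block m \<rho> i = block m \<rho> j then kid m \<rho> i h $$ (loc m \<rho> i, loc m \<rho> j) else 0)"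
proof -
  let ?As = "map (\<lambda>\<sigma>. \<sigma> h) (kids m \<rho>)"
  note dims = map_dim_row_kids[OF r h]
  have sq: "\<forall>A\<in>set ?As. dim_col A = dim_row A"
    using kids_subset[OF r] carrier[OF _ h] by fastforce
  have "\<rho> h = diag_block_mat ?As" using kids_restrict[OF r] h by (simp add: restricts_to_def)
  then show ?thesis
    using diag_block_mat_blk[OF sq, of i j] ij sum_list_kids[OF r] block_bounds(1)[OF r ij(1)]
    unfolding dims by (simp add: block_def loc_def kid_def)
qed

text \<open>Conjugation by any group element permutes \<open>S\<close>, so the sum over
  \<open>S\<close> commutes with the representation and is scalar by Schur's lemma.\<close>

lemma central_sum:
  assumes r: "\<rho> \<in> R m" and S: "S \<subseteq> signed_perms m"
    and conj: "\<And>g s. g \<in> signed_perms m \<Longrightarrow> s \<in> S \<Longrightarrow> \<exists>s'\<in>S. g \<circ> s = s' \<circ> g"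
    and ij: "i < d \<rho>" "j < d \<rho>"
  shows "(\<Sum>s\<in>S. \<rho> s $$ (i, j)) = (if i = j then (\<Sum>s\<in>S. \<rho> s $$ (0, 0)) else 0)"
proof (rule schur_scalar[OF r _ ij])
  have fin: "finite S" using S finite_signed_perms by (rule finite_subset)
  fix g i j assume g: "g \<in> signed_perms m" and ij: "i < d \<rho>" "j < d \<rho>"
  let ?c = "\<lambda>s. g \<circ> s \<circ> inv_into UNIV g"
  have gi: "inv_into UNIV g \<circ> g = id" using signed_permsD(2)[OF g] by simp
  have gi': "g \<circ> inv_into UNIV g = id" using signed_permsD(1)[OF g] by (simp add: bij_is_surj flip: surj_iff)
  have cg: "?c s \<circ> g = g \<circ> s" for s by (simp add: comp_assoc gi)
  have "?c s \<in> S" if s: "s \<in> S" for s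
  proof -
    obtain s' where s': "s' \<in> S" "g \<circ> s = s' \<circ> g" using conj[OF g s] by blast
    then have "?c s = s'" by (simp add: comp_assoc gi')
    then show ?thesis using s' by simp
  qed
  then have im: "?c ` S \<subseteq> S" by blast
  have inj: "inj_on ?c S"
  proof (rule inj_onI)
    fix s t assume "?c s = ?c t"
    then have "g \<circ> s = g \<circ> t" using cg by metis
    then show "s = t" using signed_permsD(2)[OF g] by (simp add: fun_eq_iff inj_eq)
  qed
  have bij: "bij_betw ?c S S" using endo_inj_surj[OF fin im inj] inj by (simp add: bij_betw_def)
  have "(\<Sum>k<d \<rho>. (\<Sum>s\<in>S. \<rho> s $$ (i, k)) * \<rho> g $$ (k, j)) = (\<Sum>s\<in>S. \<rho> (s \<circ> g) $$ (i, j))"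
    unfolding sum_distrib_right by (subst sum.swap) (use mult_index[OF r _ g ij] S in \<open>auto intro!: sum.cong\<close>)
  also have "\<dots> = (\<Sum>s\<in>S. \<rho> (?c s \<circ> g) $$ (i, j))"
    using sum.reindex_bij_betw[OF bij, of "\<lambda>s. \<rho> (s \<circ> g) $$ (i, j)"] by simp
  also have "\<dots> = (\<Sum>s\<in>S. \<rho> (g \<circ> s) $$ (i, j))" unfolding cg ..
  also have "\<dots> = (\<Sum>k<d \<rho>. \<rho> g $$ (i, k) * (\<Sum>s\<in>S. \<rho> s $$ (k, j)))"
    unfolding sum_distrib_left by (subst sum.swap) (use mult_index[OF r g _ ij] S in \<open>auto intro!: sum.cong\<close>)
  finally show "(\<Sum>k<d \<rho>. (\<Sum>s\<in>S. \<rho> s $$ (i, k)) * \<rho> g $$ (k, j)) =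
    (\<Sum>k<d \<rho>. \<rho> g $$ (i, k) * (\<Sum>s\<in>S. \<rho> s $$ (k, j)))" .
qed

section \<open>Scalars of the class sums and Jucys-Murphy eigenvalues\<close>

definition refl_sum :: "nat \<Rightarrow> rep \<Rightarrow> complex" where
  "refl_sum m \<rho> = (\<Sum>s\<in>reflections m. \<rho> s $$ (0, 0))"

definition flip_sum :: "nat \<Rightarrow> rep \<Rightarrow> complex" where
  "flip_sum m \<rho> = (\<Sum>s\<in>flips m. \<rho> s $$ (0, 0))"

lemma refl_sum_index:
  "\<rho> \<in> R m \<Longrightarrow> i < d \<rho> \<Longrightarrow> j < d \<rho> \<Longrightarrow>
    (\<Sum>s\<in>reflections m. \<rho> s $$ (i, j)) = (if i = j then refl_sum m \<rho> else 0)"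
  unfolding refl_sum_def by (rule central_sum) (use reflections_subset reflections_conj in auto)

lemma flip_sum_index:
  "\<rho> \<in> R m \<Longrightarrow> i < d \<rho> \<Longrightarrow> j < d \<rho> \<Longrightarrow>
    (\<Sum>s\<in>flips m. \<rho> s $$ (i, j)) = (if i = j then flip_sum m \<rho> else 0)"
  unfolding flip_sum_def by (rule central_sum) (use flips_subset flips_conj in auto)

text \<open>The type B analogues of the content and of the component of the box by which the
  bipartition \<open>\<rho>\<close> exceeds \<open>\<sigma>\<close>: the eigenvalues of the two Jucys-Murphy elements.\<close>

definition cont :: "nat \<Rightarrow> rep \<Rightarrow> rep \<Rightarrow> complex" where
  "cont m \<sigma> \<rho> = refl_sum (Suc m) \<rho> - refl_sum m \<sigma>"

definition sgn_of :: "nat \<Rightarrow> rep \<Rightarrow> rep \<Rightarrow> complex" where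
  "sgn_of m \<sigma> \<rho> = flip_sum (Suc m) \<rho> - flip_sum m \<sigma>"

lemma restrict_sum_index:
  assumes r: "\<rho> \<in> R (Suc m)" and ij: "i < d \<rho>" "j < d \<rho>" and S: "S \<subseteq> signed_perms m"
    and scalar: "\<And>\<sigma> a b. \<sigma> \<in> R m \<Longrightarrow> a < d \<sigma> \<Longrightarrow> b < d \<sigma> \<Longrightarrow>
      (\<Sum>s\<in>S. \<sigma> s $$ (a, b)) = (if a = b then c \<sigma> else 0)"
  shows "(\<Sum>s\<in>S. \<rho> s $$ (i, j)) = (if i = j then c (kid m \<rho> i) else 0)"
proof -
  have "(\<Sum>s\<in>S. \<rho> s $$ (i, j)) = (if block m \<rho> i = block m \<rho> j
      then (\<Sum>s\<in>S. kid m \<rho> i s $$ (loc m \<rho> i, loc m \<rho> j)) else 0)"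
    using restrict_index[OF r _ ij] S by (auto intro!: sum.cong sum.neutral)
  also have "\<dots> = (if i = j then c (kid m \<rho> i) else 0)"
  proof (cases "block m \<rho> i = block m \<rho> j")
    case True
    then have "kid m \<rho> i = kid m \<rho> j" by (simp add: kid_def)
    then have "loc m \<rho> j < d (kid m \<rho> i)" using block_bounds(2)[OF r ij(2)] by simp
    then show ?thesis
      using scalar[OF block_bounds(3,2)[OF r ij(1)]] True block_loc_inject[OF r ij] by auto
  qed auto
  finally show ?thesis .
qed

text \<open>The sum over all reflections of the larger group is scalar on \<open>\<rho>\<close>, the
  sum over those of the smaller group is scalar on every block; their difference is diagonal.
  \<open>flip_index\<close> is the analogue for sign changes, where the difference is a single group
  element.\<close>

lemma new_reflections_index:
  assumes r: "\<rho> \<in> R (Suc m)" and ij: "i < d \<rho>" "j < d \<rho>"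
  shows "(\<Sum>s\<in>new_reflections m. \<rho> s $$ (i, j)) = (if i = j then cont m (kid m \<rho> i) \<rho> else 0)"
proof -
  have fin: "finite (reflections m)" "finite (new_reflections m)"
    using finite_subset[OF reflections_subset finite_signed_perms]
      finite_subset[OF new_reflections_subset finite_signed_perms] .
  have "(\<Sum>s\<in>reflections (Suc m). \<rho> s $$ (i, j)) =
      (\<Sum>s\<in>reflections m. \<rho> s $$ (i, j)) + (\<Sum>s\<in>new_reflections m. \<rho> s $$ (i, j))"
    unfolding reflections_Suc by (rule sum.union_disjoint[OF fin new_reflections_disjoint])
  moreover have "(\<Sum>s\<in>reflections m. \<rho> s $$ (i, j)) = (if i = j then refl_sum m (kid m \<rho> i) else 0)"
    using restrict_sum_index[OF r ij reflections_subset, where c = "refl_sum m"] refl_sum_index by blast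
  ultimately have "(\<Sum>s\<in>new_reflections m. \<rho> s $$ (i, j)) =
      (if i = j then refl_sum (Suc m) \<rho> else 0) - (if i = j then refl_sum m (kid m \<rho> i) else 0)"
    using refl_sum_index[OF r ij] by (cases "i = j") (simp_all add: eq_diff_eq add.commute)
  then show ?thesis by (simp add: cont_def)
qed

lemma flip_index:
  assumes r: "\<rho> \<in> R (Suc m)" and ij: "i < d \<rho>" "j < d \<rho>"
  shows "\<rho> (flip (hi m)) $$ (i, j) = (if i = j then sgn_of m (kid m \<rho> i) \<rho> else 0)"
proof -
  have fin: "finite (flips m)"
    using finite_subset[OF flips_subset finite_signed_perms] .
  have "(\<Sum>s\<in>flips (Suc m). \<rho> s $$ (i, j)) = \<rho> (flip (hi m)) $$ (i, j) + (\<Sum>s\<in>flips m. \<rho> s $$ (i, j))"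
    unfolding flips_Suc using fin flip_top_notin_flips by (rule sum.insert)
  moreover have "(\<Sum>s\<in>flips m. \<rho> s $$ (i, j)) = (if i = j then flip_sum m (kid m \<rho> i) else 0)"
    using restrict_sum_index[OF r ij flips_subset, where c = "flip_sum m"] flip_sum_index by blast
  ultimately have "\<rho> (flip (hi m)) $$ (i, j) =
      (if i = j then flip_sum (Suc m) \<rho> else 0) - (if i = j then flip_sum m (kid m \<rho> i) else 0)"
    using flip_sum_index[OF r ij] by (cases "i = j") (simp_all add: eq_diff_eq add.commute)
  then show ?thesis by (simp add: sgn_of_def)
qed

lemma sgn_of_cases:
  assumes r: "\<rho> \<in> R (Suc m)" and s: "\<sigma> \<in> set (kids m \<rho>)"
  shows "sgn_of m \<sigma> \<rho> = 1 \<or> sgn_of m \<sigma> \<rho> = - 1"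
proof -
  obtain t where t: "t < length (kids m \<rho>)" "kids m \<rho> ! t = \<sigma>" using s by (auto simp: in_set_conv_nth)
  have "\<sigma> \<in> R m" using kids_subset[OF r] s by blast
  then obtain i where i: "i < d \<rho>" "block m \<rho> i = t"
    using ex_index[OF r t(1), of 0] d_pos t(2) by auto
  then have k: "kid m \<rho> i = \<sigma>" using t by (simp add: kid_def)
  have "(\<Sum>k<d \<rho>. \<rho> (flip (hi m)) $$ (i, k) * \<rho> (flip (hi m)) $$ (k, i)) = 1"
    using mult_index[OF r flip_top_in flip_top_in i(1) i(1)] id_index[OF r i(1) i(1)] by (simp add: flip_flip)
  moreover have "(\<Sum>k<d \<rho>. \<rho> (flip (hi m)) $$ (i, k) * \<rho> (flip (hi m)) $$ (k, i)) =
      (\<Sum>k<d \<rho>. if k = i then sgn_of m \<sigma> \<rho> * sgn_of m \<sigma> \<rho> else 0)"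
    by (intro sum.cong refl) (use i k in \<open>auto simp: flip_index[OF r] simp del: of_nat_Suc\<close>)
  ultimately have "sgn_of m \<sigma> \<rho> * sgn_of m \<sigma> \<rho> = 1" using i by simp
  then show ?thesis by (metis square_eq_1_iff)
qed

section \<open>Commutation relations of the adjacent reflection\<close>

definition kid2 :: "nat \<Rightarrow> rep \<Rightarrow> nat \<Rightarrow> rep" where
  "kid2 m \<rho> i = kid m (kid (Suc m) \<rho> i) (loc (Suc m) \<rho> i)"

lemma flip_index2:
  assumes r: "\<rho> \<in> R (Suc (Suc m))" and ij: "i < d \<rho>" "j < d \<rho>"
  shows "\<rho> (flip (hi m)) $$ (i, j) = (if i = j then sgn_of m (kid2 m \<rho> i) (kid (Suc m) \<rho> i) else 0)"
proof (cases "block (Suc m) \<rho> i = block (Suc m) \<rho> j")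
  case True
  then have k: "kid (Suc m) \<rho> j = kid (Suc m) \<rho> i" by (simp add: kid_def)
  have "\<rho> (flip (hi m)) $$ (i, j) =
      kid (Suc m) \<rho> i (flip (hi m)) $$ (loc (Suc m) \<rho> i, loc (Suc m) \<rho> j)"
    using restrict_index[OF r flip_top_in ij] True by (simp del: of_nat_Suc)
  also have "\<dots> = (if loc (Suc m) \<rho> i = loc (Suc m) \<rho> j
      then sgn_of m (kid m (kid (Suc m) \<rho> i) (loc (Suc m) \<rho> i)) (kid (Suc m) \<rho> i) else 0)"
    using flip_index[OF block_bounds(3,2)[OF r ij(1)] block_bounds(2)[OF r ij(2), unfolded k]] .
  also have "loc (Suc m) \<rho> i = loc (Suc m) \<rho> j \<longleftrightarrow> i = j" using block_loc_inject[OF r ij True] by blast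
  finally show ?thesis by (simp only: kid2_def)
next
  case False
  then show ?thesis using restrict_index[OF r flip_top_in ij] by auto
qed

lemma new_reflections_index2:
  assumes r: "\<rho> \<in> R (Suc (Suc m))" and ij: "i < d \<rho>" "j < d \<rho>"
  shows "(\<Sum>s\<in>new_reflections m. \<rho> s $$ (i, j)) =
    (if i = j then cont m (kid2 m \<rho> i) (kid (Suc m) \<rho> i) else 0)"
proof -
  have "(\<Sum>s\<in>new_reflections m. \<rho> s $$ (i, j)) = (if block (Suc m) \<rho> i = block (Suc m) \<rho> j
      then (\<Sum>s\<in>new_reflections m. kid (Suc m) \<rho> i s $$ (loc (Suc m) \<rho> i, loc (Suc m) \<rho> j)) else 0)"
    using restrict_index[OF r subsetD[OF new_reflections_subset] ij] by (auto intro!: sum.cong sum.neutral)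
  also have "\<dots> = (if i = j then cont m (kid2 m \<rho> i) (kid (Suc m) \<rho> i) else 0)"
  proof (cases "block (Suc m) \<rho> i = block (Suc m) \<rho> j")
    case True
    then have k: "kid (Suc m) \<rho> j = kid (Suc m) \<rho> i" by (simp add: kid_def)
    have "(\<Sum>s\<in>new_reflections m. kid (Suc m) \<rho> i s $$ (loc (Suc m) \<rho> i, loc (Suc m) \<rho> j)) =
        (if loc (Suc m) \<rho> i = loc (Suc m) \<rho> j
        then cont m (kid m (kid (Suc m) \<rho> i) (loc (Suc m) \<rho> i)) (kid (Suc m) \<rho> i) else 0)"
      using new_reflections_index[OF block_bounds(3,2)[OF r ij(1)] block_bounds(2)[OF r ij(2), unfolded k]] .
    also have "loc (Suc m) \<rho> i = loc (Suc m) \<rho> j \<longleftrightarrow> i = j" using block_loc_inject[OF r ij True] by blast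
    finally show ?thesis using True by (simp add: kid2_def)
  qed auto
  finally show ?thesis .
qed

lemma sum_diagonal:
  fixes f :: "nat \<Rightarrow> complex"
  shows "j < n \<Longrightarrow> (\<Sum>k<n. f k * (if k = j then c k else 0)) = f j * c j"
    "j < n \<Longrightarrow> (\<Sum>k<n. (if j = k then a else 0) * f k) = a * f j"
  by (simp_all add: if_distrib if_distribR cong: if_cong)

text \<open>Entry \<open>(i, j)\<close> of the relation \<open>flip_adj\<close>, in which both flips
  are diagonal.\<close>

lemma adj_sgn:
  assumes r: "\<rho> \<in> R (Suc (Suc m))" and ij: "i < d \<rho>" "j < d \<rho>"
  shows "(sgn_of (Suc m) (kid (Suc m) \<rho> i) \<rho> - sgn_of m (kid2 m \<rho> j) (kid (Suc m) \<rho> j)) *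
    \<rho> (adj m) $$ (i, j) = 0"
proof -
  have f: "flip (hi m) \<in> signed_perms (Suc (Suc m))"
    using flip_top_in signed_perms_mono[of "Suc m" "Suc (Suc m)"] by auto
  have "\<rho> (flip (hi (Suc m)) \<circ> adj m) $$ (i, j) = (\<Sum>k<d \<rho>. (if i = k then sgn_of (Suc m) (kid (Suc m) \<rho> i) \<rho> else 0) * \<rho> (adj m) $$ (k, j))"
    unfolding mult_index[OF r flip_top_in adj_in ij] by (intro sum.cong refl) (use flip_index[OF r ij(1)] in simp)
  moreover have "\<rho> (adj m \<circ> flip (hi m)) $$ (i, j) = (\<Sum>k<d \<rho>. \<rho> (adj m) $$ (i, k) * (if k = j then sgn_of m (kid2 m \<rho> k) (kid (Suc m) \<rho> k) else 0))"
    unfolding mult_index[OF r adj_in f ij] by (intro sum.cong refl) (use flip_index2[OF r _ ij(2)] in simp)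
  ultimately have "sgn_of (Suc m) (kid (Suc m) \<rho> i) \<rho> * \<rho> (adj m) $$ (i, j) =
      \<rho> (adj m) $$ (i, j) * sgn_of m (kid2 m \<rho> j) (kid (Suc m) \<rho> j)"
    unfolding sum_diagonal(1)[OF ij(2), of "\<lambda>k. \<rho> (adj m) $$ (i, k)"]
      sum_diagonal(2)[OF ij(1), of _ "\<lambda>k. \<rho> (adj m) $$ (k, j)"] flip_adj by simp
  then show ?thesis by (simp add: left_diff_distrib mult.commute)
qed

text \<open>Entry \<open>(i, j)\<close> of the relation \<open>X' s = s X + 1 + f f'\<close>, where
  \<open>s\<close> is \<open>adj m\<close>, \<open>X\<close> and \<open>X'\<close> are the
  Jucys-Murphy elements of the two levels, and \<open>f\<close> and \<open>f'\<close> are the flips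
  of the two top points. All factors except \<open>s\<close> are diagonal, so a nonzero entry of
  \<open>s\<close> off the diagonal forces two eigenvalues to be equal.\<close>

lemma adj_content:
  assumes r: "\<rho> \<in> R (Suc (Suc m))" and ij: "i < d \<rho>" "j < d \<rho>"
  shows "(cont (Suc m) (kid (Suc m) \<rho> i) \<rho> - cont m (kid2 m \<rho> j) (kid (Suc m) \<rho> j)) *
    \<rho> (adj m) $$ (i, j) =
    (if i = j then 1 + sgn_of (Suc m) (kid (Suc m) \<rho> i) \<rho> * sgn_of m (kid2 m \<rho> i) (kid (Suc m) \<rho> i) else 0)"
proof -
  let ?x = "cont (Suc m) (kid (Suc m) \<rho> i) \<rho>" and ?y = "cont m (kid2 m \<rho> j) (kid (Suc m) \<rho> j)"
  let ?s = "swap (- hi m) (hi (Suc m))" and ?c = "\<lambda>r. adj m \<circ> r \<circ> adj m"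
  have f: "flip (hi m) \<in> signed_perms (Suc (Suc m))"
    using flip_top_in signed_perms_mono[of "Suc m" "Suc (Suc m)"] by auto
  have fin: "finite (new_reflections k)" for k
    using finite_subset[OF new_reflections_subset finite_signed_perms] .
  have new: "new_reflections m \<subseteq> signed_perms (Suc (Suc m))"
    using new_reflections_subset signed_perms_mono[of "Suc m" "Suc (Suc m)"] by fastforce
  have inj: "inj_on ?c (new_reflections m)"
  proof (rule inj_onI)
    fix s t assume "?c s = ?c t"
    then have "adj m \<circ> ?c s \<circ> adj m = adj m \<circ> ?c t \<circ> adj m" by simp
    then have "(adj m \<circ> adj m) \<circ> s \<circ> (adj m \<circ> adj m) = (adj m \<circ> adj m) \<circ> t \<circ> (adj m \<circ> adj m)"
      by (simp only: comp_assoc)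
    then show "s = t" by (simp add: adj_adj)
  qed
  have "(\<Sum>s\<in>new_reflections (Suc m). \<rho> (s \<circ> adj m) $$ (i, j)) =
      (\<Sum>k<d \<rho>. (\<Sum>s\<in>new_reflections (Suc m). \<rho> s $$ (i, k)) * \<rho> (adj m) $$ (k, j))"
    unfolding sum_distrib_right
    by (subst sum.swap) (use mult_index[OF r _ adj_in ij] new_reflections_subset in \<open>auto intro!: sum.cong\<close>)
  also have "\<dots> = (\<Sum>k<d \<rho>. (if i = k then ?x else 0) * \<rho> (adj m) $$ (k, j))"
    by (intro sum.cong refl) (use new_reflections_index[OF r ij(1)] in simp)
  also have "\<dots> = ?x * \<rho> (adj m) $$ (i, j)"
    using sum_diagonal(2)[OF ij(1), of ?x "\<lambda>k. \<rho> (adj m) $$ (k, j)"] .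
  finally have L: "(\<Sum>s\<in>new_reflections (Suc m). \<rho> (s \<circ> adj m) $$ (i, j)) = ?x * \<rho> (adj m) $$ (i, j)" .
  have "(\<Sum>s\<in>new_reflections (Suc m). \<rho> (s \<circ> adj m) $$ (i, j)) =
      (\<Sum>s\<in>?c ` new_reflections m. \<rho> (s \<circ> adj m) $$ (i, j)) +
      (\<Sum>s\<in>{adj m, ?s}. \<rho> (s \<circ> adj m) $$ (i, j))"
    unfolding adj_conj_new_reflections(1)[of m, symmetric]
    using adj_conj_new_reflections(2,3)[of m] fin by (intro sum.union_disjoint) auto
  also have "(\<Sum>s\<in>?c ` new_reflections m. \<rho> (s \<circ> adj m) $$ (i, j)) =
      (\<Sum>s\<in>new_reflections m. \<rho> (adj m \<circ> s) $$ (i, j))"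
    by (subst sum.reindex[OF inj]) (simp add: comp_assoc adj_adj)
  also have "\<dots> = (\<Sum>k<d \<rho>. \<rho> (adj m) $$ (i, k) * (\<Sum>s\<in>new_reflections m. \<rho> s $$ (k, j)))"
    unfolding sum_distrib_left
    by (subst sum.swap) (use mult_index[OF r adj_in _ ij] new in \<open>auto intro!: sum.cong\<close>)
  also have "\<dots> = (\<Sum>k<d \<rho>. \<rho> (adj m) $$ (i, k) * (if k = j then cont m (kid2 m \<rho> k) (kid (Suc m) \<rho> k) else 0))"
    by (intro sum.cong refl) (use new_reflections_index2[OF r _ ij(2)] in simp)
  also have "\<dots> = \<rho> (adj m) $$ (i, j) * ?y"
    using sum_diagonal(1)[OF ij(2), of "\<lambda>k. \<rho> (adj m) $$ (i, k)"] .
  also have "(\<Sum>s\<in>{adj m, ?s}. \<rho> (s \<circ> adj m) $$ (i, j)) =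
      \<rho> id $$ (i, j) + \<rho> (flip (hi m) \<circ> flip (hi (Suc m))) $$ (i, j)"
    using adj_conj_new_reflections(4)[of m] by (simp add: adj_adj swap_adj del: of_nat_Suc)
  also have "\<rho> (flip (hi m) \<circ> flip (hi (Suc m))) $$ (i, j) =
      (\<Sum>k<d \<rho>. (if i = k then sgn_of m (kid2 m \<rho> i) (kid (Suc m) \<rho> i) else 0) *
        (if k = j then sgn_of (Suc m) (kid (Suc m) \<rho> k) \<rho> else 0))"
    unfolding mult_index[OF r f flip_top_in ij]
    by (intro sum.cong refl) (use flip_index2[OF r ij(1)] flip_index[OF r _ ij(2)] in simp)
  also have "\<dots> = sgn_of m (kid2 m \<rho> i) (kid (Suc m) \<rho> i) *
        (if i = j then sgn_of (Suc m) (kid (Suc m) \<rho> i) \<rho> else 0)"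
    using sum_diagonal(2)[OF ij(1)] .
  finally have "?x * \<rho> (adj m) $$ (i, j) - \<rho> (adj m) $$ (i, j) * ?y = \<rho> id $$ (i, j) +
      sgn_of m (kid2 m \<rho> i) (kid (Suc m) \<rho> i) * (if i = j then sgn_of (Suc m) (kid (Suc m) \<rho> i) \<rho> else 0)"
    unfolding L by (simp only: diff_eq_eq add.commute)
  then show ?thesis unfolding id_index[OF r ij] by (simp add: algebra_simps)
qed

end

section \<open>Multiplicity-freeness\<close>

context branching
begin

text \<open>Equal constituents make both relations speak of the eigenvalues of \<open>j\<close>
  alone. If the signs agree, the right-hand side on the diagonal is 2, so the contents differ and
  the entry is 2 over their difference; if they disagree, \<open>adj_sgn\<close> annihilates the
  entry.\<close>

lemma adj_same_kid:
  assumes r: "\<rho> \<in> R (Suc (Suc m))" and ij: "i < d \<rho>" "j < d \<rho>"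
    and same: "kid (Suc m) \<rho> i = kid (Suc m) \<rho> j"
  shows "\<rho> (adj m) $$ (i, j) = (if i = j \<and> sgn_of (Suc m) (kid (Suc m) \<rho> j) \<rho> =
      sgn_of m (kid2 m \<rho> j) (kid (Suc m) \<rho> j)
    then 2 / (cont (Suc m) (kid (Suc m) \<rho> j) \<rho> - cont m (kid2 m \<rho> j) (kid (Suc m) \<rho> j)) else 0)"
    and "sgn_of (Suc m) (kid (Suc m) \<rho> j) \<rho> = sgn_of m (kid2 m \<rho> j) (kid (Suc m) \<rho> j) \<Longrightarrow>
      cont (Suc m) (kid (Suc m) \<rho> j) \<rho> \<noteq> cont m (kid2 m \<rho> j) (kid (Suc m) \<rho> j)"
proof -
  let ?la = "kid (Suc m) \<rho> j" and ?mu = "kid2 m \<rho> j"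
  let ?s = "sgn_of (Suc m) ?la \<rho>" and ?s2 = "sgn_of m ?mu ?la"
  let ?x = "cont (Suc m) ?la \<rho>" and ?y = "cont m ?mu ?la"
  have l: "?la \<in> set (kids (Suc m) \<rho>)" using block_bounds(4)[OF r ij(2)] .
  have s: "?s * ?s = 1" using sgn_of_cases[OF r l] by auto
  have jj: "(?x - ?y) * \<rho> (adj m) $$ (j, j) = 1 + ?s * ?s2"
    using adj_content[OF r ij(2) ij(2)] by simp
  have ne: "?x \<noteq> ?y" if "?s = ?s2"
  proof
    assume "?x = ?y"
    then have "1 + ?s * ?s = 0" using jj that by simp
    then show False using s by simp
  qed
  then show "?s = ?s2 \<Longrightarrow> ?x \<noteq> ?y" .
  have 1: "(?s - ?s2) * \<rho> (adj m) $$ (i, j) = 0" using adj_sgn[OF r ij] same by simp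
  have 2: "(?x - ?y) * \<rho> (adj m) $$ (i, j) = (if i = j then 1 + ?s * ?s2 else 0)"
    using adj_content[OF r ij] same by simp
  show "\<rho> (adj m) $$ (i, j) = (if i = j \<and> ?s = ?s2 then 2 / (?x - ?y) else 0)"
  proof (cases "?s = ?s2")
    case True
    then have "?x - ?y \<noteq> 0" using ne by simp
    then show ?thesis using 2 s True by (auto simp: field_simps)
  next
    case False
    then show ?thesis using 1 by simp
  qed
qed

lemma sandwich:
  assumes r: "\<rho> \<in> R (Suc (Suc m))" and h: "h \<in> signed_perms (Suc m)" "h' \<in> signed_perms (Suc m)"
    and ij: "i < d \<rho>" "j < d \<rho>"
  shows "\<rho> (h \<circ> adj m \<circ> h') $$ (i, j) =
    (\<Sum>k<d \<rho>. \<Sum>l<d \<rho>. \<rho> h $$ (i, k) * \<rho> (adj m) $$ (k, l) * \<rho> h' $$ (l, j))"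
proof -
  have h2: "h \<in> signed_perms (Suc (Suc m))" "h' \<in> signed_perms (Suc (Suc m))"
    using h signed_perms_mono[of "Suc m" "Suc (Suc m)"] by auto
  have "\<rho> (h \<circ> (adj m \<circ> h')) $$ (i, j) =
      (\<Sum>k<d \<rho>. \<rho> h $$ (i, k) * \<rho> (adj m \<circ> h') $$ (k, j))"
    by (rule mult_index[OF r h2(1) signed_perms_comp[OF adj_in h2(2)] ij])
  also have "\<dots> = (\<Sum>k<d \<rho>. \<Sum>l<d \<rho>. \<rho> h $$ (i, k) * \<rho> (adj m) $$ (k, l) * \<rho> h' $$ (l, j))"
    by (intro sum.cong refl) (use mult_index[OF r adj_in h2(2) _ ij(2)] in
        \<open>simp add: sum_distrib_left mult.assoc\<close>)
  finally show ?thesis by (simp add: comp_assoc)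
qed

lemma coset_cases:
  assumes g: "g \<in> signed_perms (Suc m)"
  obtains "g \<in> signed_perms m"
  | h where "h \<in> signed_perms m" "g = flip (hi m) \<circ> h"
  | m' h h' where "m = Suc m'" "h \<in> signed_perms m" "h' \<in> signed_perms m" "g = h \<circ> adj m' \<circ> h'"
proof (cases m)
  case 0
  have "g \<in> (\<lambda>(y, h). y \<circ> h) ` (coset_reps 0 \<times> signed_perms 0)"
    using bij_betw_cosets[of 0] g 0 by (simp add: bij_betw_def)
  then show thesis using that(1,2) 0 by fastforce
next
  case (Suc m')
  then show thesis using double_coset[of g m'] g that by metis
qed

lemma flip_mult_index:
  assumes r: "\<rho> \<in> R (Suc m)" and h: "h \<in> signed_perms m" and ij: "i < d \<rho>" "j < d \<rho>"
  shows "\<rho> (flip (hi m) \<circ> h) $$ (i, j) = sgn_of m (kid m \<rho> i) \<rho> * \<rho> h $$ (i, j)"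
proof -
  have h2: "h \<in> signed_perms (Suc m)" using h signed_perms_mono[of m "Suc m"] by auto
  have "\<rho> (flip (hi m) \<circ> h) $$ (i, j) =
      (\<Sum>k<d \<rho>. (if i = k then sgn_of m (kid m \<rho> i) \<rho> else 0) * \<rho> h $$ (k, j))"
    unfolding mult_index[OF r flip_top_in h2 ij]
    by (intro sum.cong refl) (use flip_index[OF r ij(1)] in simp)
  then show ?thesis unfolding sum_diagonal(2)[OF ij(1)] .
qed

text \<open>Otherwise a matrix coefficient between two copies of the same constituent would vanish
  on the whole group.\<close>

lemma block_eq_if_kid_eq:
  assumes r: "\<rho> \<in> R (Suc m)" and ij: "i < d \<rho>" "j < d \<rho>" and same: "kid m \<rho> i = kid m \<rho> j"
  shows "block m \<rho> i = block m \<rho> j"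
proof (rule ccontr)
  assume ne: "block m \<rho> i \<noteq> block m \<rho> j"
  have "\<rho> g $$ (i, j) = 0" if g: "g \<in> signed_perms (Suc m)" for g
    using g
  proof (cases rule: coset_cases)
    case 1
    then show ?thesis using restrict_index[OF r _ ij] ne by simp
  next
    case (2 h)
    then show ?thesis using flip_mult_index[OF r 2(1) ij] restrict_index[OF r 2(1) ij] ne by simp
  next
    case (3 m' h h')
    have r': "\<rho> \<in> R (Suc (Suc m'))" using r 3 by simp
    have h: "h \<in> signed_perms (Suc m')" "h' \<in> signed_perms (Suc m')" using 3 by auto
    have "\<rho> h $$ (i, k) * \<rho> (adj m') $$ (k, l) * \<rho> h' $$ (l, j) = 0" if kl: "k < d \<rho>" "l < d \<rho>" for k l
    \<comment> \<open>Only rows \<open>k\<close> in the block of \<open>i\<close> and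
      \<open>l\<close> in that of \<open>j\<close> can contribute; they carry the same
      representation in different blocks, and there \<open>adj_same_kid\<close> gives zero.\<close>
    proof (cases "block m \<rho> k = block m \<rho> i \<and> block m \<rho> l = block m \<rho> j")
      case True
      then have "kid (Suc m') \<rho> k = kid (Suc m') \<rho> l" "k \<noteq> l" using same ne 3 by (auto simp: kid_def)
      then show ?thesis using adj_same_kid(1)[OF r' kl] by simp
    next
      case False
      then show ?thesis
        using restrict_index[OF r' h(1) ij(1) kl(1)] restrict_index[OF r' h(2) kl(2) ij(2)] 3 by auto
    qed
    then show ?thesis unfolding 3(4) sandwich[OF r' h ij] by (intro sum.neutral ballI) (simp only: lessThan_iff)
  qed
  then show False using coefficient_nonzero[OF r ij] by blast
qed

lemma kid_loc_inject:
  "\<rho> \<in> R (Suc m) \<Longrightarrow> i < d \<rho> \<Longrightarrow> j < d \<rho> \<Longrightarrow> kid m \<rho> i = kid m \<rho> j \<Longrightarrow> loc m \<rho> i = loc m \<rho> j \<Longrightarrow> i = j"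
  using block_eq_if_kid_eq block_loc_inject by metis

text \<open>A set loses nothing against the list \<open>kids\<close>, since
  \<open>block_eq_if_kid_eq\<close> excludes repetitions.\<close>

definition down :: "nat \<Rightarrow> rep \<Rightarrow> rep set" where
  "down m \<rho> = set (kids m \<rho>)"

lemma finite_down [simp]: "finite (down m \<rho>)"
  by (simp add: down_def)

lemma down_subset: "\<rho> \<in> R (Suc m) \<Longrightarrow> \<sigma> \<in> down m \<rho> \<Longrightarrow> \<sigma> \<in> R m"
  using kids_subset by (auto simp: down_def)

text \<open>Inverse of the pair \<open>kid\<close>, \<open>loc\<close>. Rows are from here on
  addressed by constituent instead of block number, which is unambiguous by
  \<open>kid_loc_inject\<close>.\<close>

definition emb :: "nat \<Rightarrow> rep \<Rightarrow> rep \<Rightarrow> nat \<Rightarrow> nat" where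
  "emb m \<rho> \<sigma> b = (SOME i. i < d \<rho> \<and> kid m \<rho> i = \<sigma> \<and> loc m \<rho> i = b)"

lemma emb:
  assumes "\<rho> \<in> R (Suc m)" "\<sigma> \<in> down m \<rho>" "b < d \<sigma>"
  shows "emb m \<rho> \<sigma> b < d \<rho>" "kid m \<rho> (emb m \<rho> \<sigma> b) = \<sigma>" "loc m \<rho> (emb m \<rho> \<sigma> b) = b"
proof -
  obtain t where t: "t < length (kids m \<rho>)" "kids m \<rho> ! t = \<sigma>"
    using assms(2) by (auto simp: down_def in_set_conv_nth)
  then have "\<exists>i. i < d \<rho> \<and> kid m \<rho> i = \<sigma> \<and> loc m \<rho> i = b"
    using ex_index[OF assms(1) t(1), of b] assms(3) by (auto simp: kid_def)
  from someI_ex[OF this, folded emb_def]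
  show "emb m \<rho> \<sigma> b < d \<rho>" "kid m \<rho> (emb m \<rho> \<sigma> b) = \<sigma>" "loc m \<rho> (emb m \<rho> \<sigma> b) = b" by auto
qed

lemma kid_down: "\<rho> \<in> R (Suc m) \<Longrightarrow> i < d \<rho> \<Longrightarrow> kid m \<rho> i \<in> down m \<rho>"
  using block_bounds(4) by (simp add: down_def)

lemma emb_kid_loc: "\<rho> \<in> R (Suc m) \<Longrightarrow> i < d \<rho> \<Longrightarrow> emb m \<rho> (kid m \<rho> i) (loc m \<rho> i) = i"
  using emb[of \<rho> m "kid m \<rho> i" "loc m \<rho> i"] kid_down block_bounds(2) kid_loc_inject by metis

lemma restrict_index_kid:
  assumes "\<rho> \<in> R (Suc m)" "h \<in> signed_perms m" "i < d \<rho>" "j < d \<rho>"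
  shows "\<rho> h $$ (i, j) =
    (if kid m \<rho> i = kid m \<rho> j then kid m \<rho> i h $$ (loc m \<rho> i, loc m \<rho> j) else 0)"
  using restrict_index[OF assms] block_eq_if_kid_eq[OF assms(1,3,4)] by (auto simp: kid_def)

lemma sum_kids:
  assumes r: "\<rho> \<in> R (Suc m)"
  shows "(\<Sum>i<d \<rho>. f (kid m \<rho> i) (loc m \<rho> i)) = (\<Sum>\<sigma>\<in>down m \<rho>. \<Sum>b<d \<sigma>. f \<sigma> b)"
proof -
  have "bij_betw (\<lambda>i. (kid m \<rho> i, loc m \<rho> i)) {..<d \<rho>} (SIGMA \<sigma>:down m \<rho>. {..<d \<sigma>})"
  proof (rule bij_betw_byWitness[where f' = "\<lambda>(\<sigma>, b). emb m \<rho> \<sigma> b"])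
    show "\<forall>i\<in>{..<d \<rho>}. (case (kid m \<rho> i, loc m \<rho> i) of (\<sigma>, b) \<Rightarrow> emb m \<rho> \<sigma> b) = i"
      using emb_kid_loc[OF r] by simp
    show "\<forall>p\<in>SIGMA \<sigma>:down m \<rho>. {..<d \<sigma>}.
        (kid m \<rho> (case p of (\<sigma>, b) \<Rightarrow> emb m \<rho> \<sigma> b), loc m \<rho> (case p of (\<sigma>, b) \<Rightarrow> emb m \<rho> \<sigma> b)) = p"
      using emb[OF r] by auto
    show "(\<lambda>i. (kid m \<rho> i, loc m \<rho> i)) ` {..<d \<rho>} \<subseteq> (SIGMA \<sigma>:down m \<rho>. {..<d \<sigma>})"
      using kid_down[OF r] block_bounds(2)[OF r] by auto
    show "(\<lambda>(\<sigma>, b). emb m \<rho> \<sigma> b) ` (SIGMA \<sigma>:down m \<rho>. {..<d \<sigma>}) \<subseteq> {..<d \<rho>}"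
      using emb[OF r] by auto
  qed
  from sum.reindex_bij_betw[OF this, of "\<lambda>(\<sigma>, b). f \<sigma> b"]
  show ?thesis by (simp add: sum.Sigma)
qed

lemma d_eq_sum_down: "\<rho> \<in> R (Suc m) \<Longrightarrow> d \<rho> = (\<Sum>\<sigma>\<in>down m \<rho>. d \<sigma>)"
  using sum_kids[of \<rho> m "\<lambda>_ _. 1 :: nat"] by simp

lemma sum_one_kid:
  assumes r: "\<rho> \<in> R (Suc m)" and s: "\<sigma> \<in> down m \<rho>"
  shows "(\<Sum>i<d \<rho>. if kid m \<rho> i = \<sigma> then F i else 0) = (\<Sum>b<d \<sigma>. F (emb m \<rho> \<sigma> b))"
proof -
  have "(\<Sum>i<d \<rho>. if kid m \<rho> i = \<sigma> then F i else 0) =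
      (\<Sum>i<d \<rho>. if kid m \<rho> i = \<sigma> then F (emb m \<rho> \<sigma> (loc m \<rho> i)) else 0)"
    using emb_kid_loc[OF r] by (intro sum.cong) auto
  also have "\<dots> = (\<Sum>\<nu>\<in>down m \<rho>. \<Sum>b<d \<nu>. if \<nu> = \<sigma> then F (emb m \<rho> \<sigma> b) else 0)"
    by (rule sum_kids[OF r])
  also have "\<dots> = (\<Sum>\<nu>\<in>down m \<rho>. if \<nu> = \<sigma> then (\<Sum>b<d \<nu>. F (emb m \<rho> \<sigma> b)) else 0)"
    by (intro sum.cong) auto
  also have "\<dots> = (\<Sum>b<d \<sigma>. F (emb m \<rho> \<sigma> b))" using s by (simp add: sum.delta)
  finally show ?thesis .
qed

lemma orthogonality:
  assumes r: "\<rho> \<in> R m" and s: "\<sigma> \<in> R m" and "i < d \<rho>" "j < d \<rho>" "k < d \<sigma>" "l < d \<sigma>"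
  shows "(\<Sum>g\<in>signed_perms m. \<rho> g $$ (i, j) * \<sigma> (inv\<^bsub>weyl_B m\<^esub> g) $$ (k, l)) =
    (if \<rho> = \<sigma> \<and> i = l \<and> j = k then of_nat (card (signed_perms m)) / of_nat (d \<rho>) else 0)"
proof (cases "\<rho> = \<sigma>")
  case True
  then show ?thesis
    using finite_group.orthogonality_same[OF finite_group_weyl_B irreducible[OF r], of i j k l] assms
    by (simp add: rep_degree_eq carrier_weyl_B)
next
  case False
  then have "\<not> equivalent_reps (weyl_B m) \<rho> \<sigma>" using R_equivalent[OF r s] by blast
  then show ?thesis using False
    finite_group.orthogonality_inequivalent[OF finite_group_weyl_B irreducible[OF r] irreducible[OF s],
      of i j k l] assms
    by (simp add: rep_degree_eq carrier_weyl_B)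
qed

text \<open>The matrix coefficients of \<open>\<rho>\<close> inside the constituent \<open>\<sigma>\<close> only depend on the two
  eigenvalues.\<close>

lemma up_unique:
  assumes r: "\<rho> \<in> R (Suc m)" "\<rho>' \<in> R (Suc m)" and s: "\<sigma> \<in> down m \<rho>" "\<sigma> \<in> down m \<rho>'"
    and e: "cont m \<sigma> \<rho> = cont m \<sigma> \<rho>'" and t: "sgn_of m \<sigma> \<rho> = sgn_of m \<sigma> \<rho>'"
  shows "\<rho> = \<rho>'"
proof (rule ccontr)
  assume ne: "\<rho> \<noteq> \<rho>'"
  note E = emb[OF r(1) s(1)] and E' = emb[OF r(2) s(2)]
  have sR: "\<sigma> \<in> R m" using down_subset[OF r(1) s(1)] .
  have res: "\<rho> h $$ (emb m \<rho> \<sigma> a, emb m \<rho> \<sigma> b) = \<sigma> h $$ (a, b)"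
    "\<rho>' h $$ (emb m \<rho>' \<sigma> a, emb m \<rho>' \<sigma> b) = \<sigma> h $$ (a, b)"
    if "h \<in> signed_perms m" "a < d \<sigma>" "b < d \<sigma>" for h a b
    using restrict_index_kid[OF r(1) that(1) E(1)[OF that(2)] E(1)[OF that(3)]]
      restrict_index_kid[OF r(2) that(1) E'(1)[OF that(2)] E'(1)[OF that(3)]]
      E(2,3)[OF that(2)] E(2,3)[OF that(3)] E'(2,3)[OF that(2)] E'(2,3)[OF that(3)] by simp_all
  have coeff: "\<rho> g $$ (emb m \<rho> \<sigma> a, emb m \<rho> \<sigma> b) = \<rho>' g $$ (emb m \<rho>' \<sigma> a, emb m \<rho>' \<sigma> b)"
    if g: "g \<in> signed_perms (Suc m)" and ab: "a < d \<sigma>" "b < d \<sigma>" for g a b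
    using g
  proof (cases rule: coset_cases)
    case 1
    then show ?thesis using res ab by simp
  next
    case (2 h)
    then show ?thesis
      using flip_mult_index[OF r(1) 2(1) E(1)[OF ab(1)] E(1)[OF ab(2)]]
        flip_mult_index[OF r(2) 2(1) E'(1)[OF ab(1)] E'(1)[OF ab(2)]]
        E(2)[OF ab(1)] E'(2)[OF ab(1)] res[OF 2(1) ab] t by simp
  next
    case (3 m' h h')
    have h: "h \<in> signed_perms (Suc m')" "h' \<in> signed_perms (Suc m')" using 3 by auto
    \<comment> \<open>The entries of \<open>adj m'\<close> on the block \<open>\<sigma>\<close>, by
      \<open>adj_same_kid\<close>. They involve \<open>\<rho>\<close> only through the two
      eigenvalues, so the same \<open>D\<close> serves \<open>\<rho>'\<close>.\<close>
    define D where "D b c = (if b = c \<and> sgn_of m \<sigma> \<rho> = sgn_of m' (kid m' \<sigma> c) \<sigma>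
        then 2 / (cont m \<sigma> \<rho> - cont m' (kid m' \<sigma> c) \<sigma>) else 0)" for b c
    have "\<tau> g $$ (emb m \<tau> \<sigma> a, emb m \<tau> \<sigma> b) =
        (\<Sum>u<d \<sigma>. \<Sum>v<d \<sigma>. \<sigma> h $$ (a, u) * D u v * \<sigma> h' $$ (v, b))"
      if \<tau>: "\<tau> \<in> R (Suc m)" "\<sigma> \<in> down m \<tau>" and eq: "cont m \<sigma> \<tau> = cont m \<sigma> \<rho>" "sgn_of m \<sigma> \<tau> = sgn_of m \<sigma> \<rho>" for \<tau>
    proof -
      have \<tau>': "\<tau> \<in> R (Suc (Suc m'))" using \<tau> 3 by simp
      note T = emb[OF \<tau>]
      have "\<tau> g $$ (emb m \<tau> \<sigma> a, emb m \<tau> \<sigma> b) = (\<Sum>k<d \<tau>. \<Sum>l<d \<tau>.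
          \<tau> h $$ (emb m \<tau> \<sigma> a, k) * \<tau> (adj m') $$ (k, l) * \<tau> h' $$ (l, emb m \<tau> \<sigma> b))"
        unfolding 3(4) using sandwich[OF \<tau>' h T(1)[OF ab(1)] T(1)[OF ab(2)]] .
      also have "\<dots> = (\<Sum>k<d \<tau>. if kid m \<tau> k = \<sigma> then (\<Sum>l<d \<tau>. if kid m \<tau> l = \<sigma> then
          \<sigma> h $$ (a, loc m \<tau> k) * \<tau> (adj m') $$ (k, l) * \<sigma> h' $$ (loc m \<tau> l, b) else 0) else 0)"
      proof (intro sum.cong refl)
        fix k assume k: "k \<in> {..<d \<tau>}"
        have 1: "\<tau> h $$ (emb m \<tau> \<sigma> a, k) = (if kid m \<tau> k = \<sigma> then \<sigma> h $$ (a, loc m \<tau> k) else 0)"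
          using restrict_index_kid[OF \<tau>(1) 3(2) T(1)[OF ab(1)], of k] k T(2,3)[OF ab(1)] by auto
        have 2: "\<tau> h' $$ (l, emb m \<tau> \<sigma> b) = (if kid m \<tau> l = \<sigma> then \<sigma> h' $$ (loc m \<tau> l, b) else 0)"
          if "l < d \<tau>" for l
          using restrict_index_kid[OF \<tau>(1) 3(3) that T(1)[OF ab(2)]] T(2,3)[OF ab(2)] by auto
        show "(\<Sum>l<d \<tau>. \<tau> h $$ (emb m \<tau> \<sigma> a, k) * \<tau> (adj m') $$ (k, l) * \<tau> h' $$ (l, emb m \<tau> \<sigma> b)) =
          (if kid m \<tau> k = \<sigma> then (\<Sum>l<d \<tau>. if kid m \<tau> l = \<sigma> then
            \<sigma> h $$ (a, loc m \<tau> k) * \<tau> (adj m') $$ (k, l) * \<sigma> h' $$ (loc m \<tau> l, b) else 0) else 0)"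
          unfolding 1 using 2 by (auto intro!: sum.cong)
      qed
      also have "\<dots> = (\<Sum>u<d \<sigma>. \<Sum>v<d \<sigma>. \<sigma> h $$ (a, loc m \<tau> (emb m \<tau> \<sigma> u)) *
          \<tau> (adj m') $$ (emb m \<tau> \<sigma> u, emb m \<tau> \<sigma> v) * \<sigma> h' $$ (loc m \<tau> (emb m \<tau> \<sigma> v), b))"
        unfolding sum_one_kid[OF \<tau>] ..
      also have "\<dots> = (\<Sum>u<d \<sigma>. \<Sum>v<d \<sigma>. \<sigma> h $$ (a, u) * D u v * \<sigma> h' $$ (v, b))"
      proof (intro sum.cong refl)
        fix u v assume "u \<in> {..<d \<sigma>}" "v \<in> {..<d \<sigma>}"
        then have uv: "u < d \<sigma>" "v < d \<sigma>" by auto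
        have "emb m \<tau> \<sigma> u = emb m \<tau> \<sigma> v \<longleftrightarrow> u = v" using T(3)[OF uv(1)] T(3)[OF uv(2)] by metis
        then have "\<tau> (adj m') $$ (emb m \<tau> \<sigma> u, emb m \<tau> \<sigma> v) = D u v"
          using adj_same_kid(1)[OF \<tau>' T(1)[OF uv(1)] T(1)[OF uv(2)]] T(2)[OF uv(1)] T(2,3)[OF uv(2)] 3(1) eq
          by (simp add: D_def kid2_def)
        then show "\<sigma> h $$ (a, loc m \<tau> (emb m \<tau> \<sigma> u)) * \<tau> (adj m') $$ (emb m \<tau> \<sigma> u, emb m \<tau> \<sigma> v) *
            \<sigma> h' $$ (loc m \<tau> (emb m \<tau> \<sigma> v), b) = \<sigma> h $$ (a, u) * D u v * \<sigma> h' $$ (v, b)"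
          using T(3) uv by simp
      qed
      finally show ?thesis .
    qed
    from this[OF r(1) s(1)] this[OF r(2) s(2)] show ?thesis using e t by simp
  qed
  let ?i = "emb m \<rho> \<sigma> 0" and ?i' = "emb m \<rho>' \<sigma> 0"
  have i: "?i < d \<rho>" "?i' < d \<rho>'" using E(1) E'(1) d_pos[OF sR] by auto
  \<comment> \<open>Equal coefficient functions contradict orthogonality: the left sum is the group
    order divided by the degree, the right one vanishes for inequivalent representations.\<close>
  have "(\<Sum>g\<in>signed_perms (Suc m). \<rho> g $$ (?i, ?i) * \<rho> (inv\<^bsub>weyl_B (Suc m)\<^esub> g) $$ (?i, ?i)) =
      (\<Sum>g\<in>signed_perms (Suc m). \<rho> g $$ (?i, ?i) * \<rho>' (inv\<^bsub>weyl_B (Suc m)\<^esub> g) $$ (?i', ?i'))"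
  proof (intro sum.cong refl)
    fix g assume "g \<in> signed_perms (Suc m)"
    then have "inv\<^bsub>weyl_B (Suc m)\<^esub> g \<in> signed_perms (Suc m)"
      using group.inv_closed[OF group_weyl_B, of g "Suc m"] by (simp add: carrier_weyl_B)
    then show "\<rho> g $$ (?i, ?i) * \<rho> (inv\<^bsub>weyl_B (Suc m)\<^esub> g) $$ (?i, ?i) =
        \<rho> g $$ (?i, ?i) * \<rho>' (inv\<^bsub>weyl_B (Suc m)\<^esub> g) $$ (?i', ?i')"
      using coeff d_pos[OF sR] by simp
  qed
  then show False
    using orthogonality[OF r(1) r(1) i(1) i(1) i(1) i(1)] orthogonality[OF r i(1) i(1) i(2) i(2)] ne
      d_pos[OF r(1)] finite_signed_perms[of "Suc m"] signed_perms_id[of "Suc m"]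
    by (auto simp: card_eq_0_iff)
qed

end

section \<open>The adjacent reflection in an adapted basis\<close>

context branching
begin

lemma sum_restrict_right:
  assumes r: "\<rho> \<in> R (Suc m)" and s: "\<sigma> \<in> down m \<rho>" and g: "g \<in> signed_perms m" and b: "b < d \<sigma>"
  shows "(\<Sum>k<d \<rho>. F k * \<rho> g $$ (k, emb m \<rho> \<sigma> b)) = (\<Sum>p<d \<sigma>. F (emb m \<rho> \<sigma> p) * \<sigma> g $$ (p, b))"
proof -
  note E = emb[OF r s]
  have "(\<Sum>k<d \<rho>. F k * \<rho> g $$ (k, emb m \<rho> \<sigma> b)) =
      (\<Sum>k<d \<rho>. if kid m \<rho> k = \<sigma> then F k * \<sigma> g $$ (loc m \<rho> k, b) else 0)"
  proof (intro sum.cong refl)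
    fix k assume "k \<in> {..<d \<rho>}"
    then show "F k * \<rho> g $$ (k, emb m \<rho> \<sigma> b) =
        (if kid m \<rho> k = \<sigma> then F k * \<sigma> g $$ (loc m \<rho> k, b) else 0)"
      using restrict_index_kid[OF r g _ E(1)[OF b], of k] E(2,3)[OF b] by auto
  qed
  also have "\<dots> = (\<Sum>p<d \<sigma>. F (emb m \<rho> \<sigma> p) * \<sigma> g $$ (loc m \<rho> (emb m \<rho> \<sigma> p), b))"
    by (rule sum_one_kid[OF r s])
  finally show ?thesis using E(3) by simp
qed

lemma sum_restrict_left:
  assumes r: "\<rho> \<in> R (Suc m)" and s: "\<sigma> \<in> down m \<rho>" and g: "g \<in> signed_perms m" and b: "b < d \<sigma>"
  shows "(\<Sum>k<d \<rho>. \<rho> g $$ (emb m \<rho> \<sigma> b, k) * F k) = (\<Sum>p<d \<sigma>. \<sigma> g $$ (b, p) * F (emb m \<rho> \<sigma> p))"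
proof -
  note E = emb[OF r s]
  have "(\<Sum>k<d \<rho>. \<rho> g $$ (emb m \<rho> \<sigma> b, k) * F k) =
      (\<Sum>k<d \<rho>. if kid m \<rho> k = \<sigma> then \<sigma> g $$ (b, loc m \<rho> k) * F k else 0)"
  proof (intro sum.cong refl)
    fix k assume "k \<in> {..<d \<rho>}"
    then show "\<rho> g $$ (emb m \<rho> \<sigma> b, k) * F k =
        (if kid m \<rho> k = \<sigma> then \<sigma> g $$ (b, loc m \<rho> k) * F k else 0)"
      using restrict_index_kid[OF r g E(1)[OF b], of k] E(2,3)[OF b] by auto
  qed
  also have "\<dots> = (\<Sum>p<d \<sigma>. \<sigma> g $$ (b, loc m \<rho> (emb m \<rho> \<sigma> p)) * F (emb m \<rho> \<sigma> p))"
    by (rule sum_one_kid[OF r s])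
  finally show ?thesis using E(3) by simp
qed

definition loc2 :: "nat \<Rightarrow> rep \<Rightarrow> nat \<Rightarrow> nat" where
  "loc2 m \<rho> i = loc m (kid (Suc m) \<rho> i) (loc (Suc m) \<rho> i)"

definition adj_coeff :: "nat \<Rightarrow> rep \<Rightarrow> rep \<Rightarrow> rep \<Rightarrow> rep \<Rightarrow> complex" where
  "adj_coeff m \<rho> \<nu> \<theta> \<mu> =
    \<rho> (adj m) $$ (emb (Suc m) \<rho> \<nu> (emb m \<nu> \<mu> 0), emb (Suc m) \<rho> \<theta> (emb m \<theta> \<mu> 0))"

text \<open>\<open>adj m\<close> commutes with \<open>B_m\<close>, so its part between a copy of one
  constituent and a copy of another is an intertwiner: zero if they are distinct, scalar if they are
  equal. \<open>adj_coeff\<close> is that scalar, read off at local index 0.\<close>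

lemma adj_index:
  assumes r: "\<rho> \<in> R (Suc (Suc m))" and ij: "i < d \<rho>" "j < d \<rho>"
  shows "\<rho> (adj m) $$ (i, j) = (if kid2 m \<rho> i = kid2 m \<rho> j \<and> loc2 m \<rho> i = loc2 m \<rho> j
    then adj_coeff m \<rho> (kid (Suc m) \<rho> i) (kid (Suc m) \<rho> j) (kid2 m \<rho> i) else 0)"
proof -
  define \<nu> where "\<nu> = kid (Suc m) \<rho> i"
  define \<theta> where "\<theta> = kid (Suc m) \<rho> j"
  define \<mu> where "\<mu> = kid2 m \<rho> i"
  define \<mu>' where "\<mu>' = kid2 m \<rho> j"
  have n: "\<nu> \<in> down (Suc m) \<rho>" "\<nu> \<in> R (Suc m)" and l: "\<theta> \<in> down (Suc m) \<rho>" "\<theta> \<in> R (Suc m)"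
    using kid_down[OF r] block_bounds(3)[OF r] ij by (auto simp: \<nu>_def \<theta>_def)
  have i1: "loc (Suc m) \<rho> i < d \<nu>" "loc (Suc m) \<rho> j < d \<theta>"
    using block_bounds(2)[OF r] ij by (auto simp: \<nu>_def \<theta>_def)
  have m: "\<mu> \<in> down m \<nu>" "\<mu> \<in> R m" and m': "\<mu>' \<in> down m \<theta>" "\<mu>' \<in> R m"
    using kid_down[OF n(2) i1(1)] block_bounds(3)[OF n(2) i1(1)]
      kid_down[OF l(2) i1(2)] block_bounds(3)[OF l(2) i1(2)]
    by (auto simp: \<mu>_def \<mu>'_def kid2_def \<nu>_def \<theta>_def)
  have i2: "loc2 m \<rho> i < d \<mu>" "loc2 m \<rho> j < d \<mu>'"
    using block_bounds(2)[OF n(2) i1(1)] block_bounds(2)[OF l(2) i1(2)]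
    by (auto simp: \<mu>_def \<mu>'_def kid2_def loc2_def \<nu>_def \<theta>_def)
  have i3: "emb (Suc m) \<rho> \<nu> (emb m \<nu> \<mu> (loc2 m \<rho> i)) = i" "emb (Suc m) \<rho> \<theta> (emb m \<theta> \<mu>' (loc2 m \<rho> j)) = j"
    using emb_kid_loc[OF n(2) i1(1)] emb_kid_loc[OF l(2) i1(2)] emb_kid_loc[OF r ij(1)] emb_kid_loc[OF r ij(2)]
    by (simp_all add: \<mu>_def \<mu>'_def kid2_def loc2_def \<nu>_def \<theta>_def)
  define F where "F a b =
    \<rho> (adj m) $$ (emb (Suc m) \<rho> \<nu> (emb m \<nu> \<mu> a), emb (Suc m) \<rho> \<theta> (emb m \<theta> \<mu>' b))" for a b
  have comm: "(\<Sum>c<d \<mu>'. F a c * \<mu>' g $$ (c, b)) = (\<Sum>c<d \<mu>. \<mu> g $$ (a, c) * F c b)"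
    if g: "g \<in> signed_perms m" and ab: "a < d \<mu>" "b < d \<mu>'" for g a b
  proof -
    have g1: "g \<in> signed_perms (Suc m)" and g2: "g \<in> signed_perms (Suc (Suc m))"
      using g signed_perms_mono[of m "Suc m"] signed_perms_mono[of m "Suc (Suc m)"] by auto
    have "g (hi m) = hi m" "g (hi (Suc m)) = hi (Suc m)"
      using signed_perms_fix_top[OF g] signed_perms_fix_top[OF g1] by auto
    then have eq: "g \<circ> adj m = adj m \<circ> g" unfolding adj_def using swap_conj[OF g] by metis
    note a1 = emb(1)[OF n(2) m(1) ab(1)] and b1 = emb(1)[OF l(2) m'(1) ab(2)]
    note a2 = emb(1)[OF r n(1) a1] and b2 = emb(1)[OF r l(1) b1]
    have "(\<Sum>c<d \<mu>'. F a c * \<mu>' g $$ (c, b)) =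
        \<rho> (adj m \<circ> g) $$ (emb (Suc m) \<rho> \<nu> (emb m \<nu> \<mu> a), emb (Suc m) \<rho> \<theta> (emb m \<theta> \<mu>' b))"
      unfolding F_def mult_index[OF r adj_in g2 a2 b2] sum_restrict_right[OF r l(1) g1 b1]
        sum_restrict_right[OF l(2) m'(1) g ab(2)] ..
    also have "\<dots> = (\<Sum>c<d \<mu>. \<mu> g $$ (a, c) * F c b)"
      unfolding F_def eq[symmetric] mult_index[OF r g2 adj_in a2 b2] sum_restrict_left[OF r n(1) g1 a1]
        sum_restrict_left[OF n(2) m(1) g ab(1)] ..
    finally show ?thesis .
  qed
  have "F (loc2 m \<rho> i) (loc2 m \<rho> j) = (if \<mu> = \<mu>' \<and> loc2 m \<rho> i = loc2 m \<rho> j then F 0 0 else 0)"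
  proof (cases "\<mu> = \<mu>'")
    case True
    have "F (loc2 m \<rho> i) (loc2 m \<rho> j) = (if loc2 m \<rho> i = loc2 m \<rho> j then F 0 0 else 0)"
      by (rule schur_scalar[OF m(2)]) (use comm i2 True in auto)
    then show ?thesis using True by simp
  next
    case False
    have "F (loc2 m \<rho> i) (loc2 m \<rho> j) = 0"
      by (rule schur_zero[OF m'(2) m(2) False]) (use comm i2 in auto)
    then show ?thesis using False by simp
  qed
  moreover have "\<mu> = \<mu>' \<Longrightarrow> F 0 0 = adj_coeff m \<rho> \<nu> \<theta> \<mu>" by (simp add: F_def adj_coeff_def)
  ultimately show ?thesis unfolding F_def i3 by (auto simp: \<mu>_def \<mu>'_def \<nu>_def \<theta>_def)
qed

section \<open>Weights of constituents and the interplay of two successive restrictions\<close>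

definition wt :: "nat \<Rightarrow> rep \<Rightarrow> rep \<Rightarrow> complex \<times> complex" where
  "wt m \<sigma> \<rho> = (sgn_of m \<sigma> \<rho>, cont m \<sigma> \<rho>)"

lemma up_unique_wt:
  "\<rho> \<in> R (Suc m) \<Longrightarrow> \<rho>' \<in> R (Suc m) \<Longrightarrow> \<sigma> \<in> down m \<rho> \<Longrightarrow> \<sigma> \<in> down m \<rho>' \<Longrightarrow>
    wt m \<sigma> \<rho> = wt m \<sigma> \<rho>' \<Longrightarrow> \<rho> = \<rho>'"
  using up_unique by (simp add: wt_def)

text \<open>By irreducibility, two different constituents are connected by some group element; the
  double coset decomposition shows that the adjacent reflection already connects them.\<close>

lemma common_down:
  assumes r: "\<rho> \<in> R (Suc (Suc m))" and l: "\<theta> \<in> down (Suc m) \<rho>" and n: "\<nu> \<in> down (Suc m) \<rho>" and ne: "\<theta> \<noteq> \<nu>"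
  obtains \<mu> where "\<mu> \<in> down m \<theta>" "\<mu> \<in> down m \<nu>" "wt m \<mu> \<theta> = wt (Suc m) \<nu> \<rho>" "wt m \<mu> \<nu> = wt (Suc m) \<theta> \<rho>"
proof -
  have lR: "\<theta> \<in> R (Suc m)" and nR: "\<nu> \<in> R (Suc m)" using down_subset[OF r] l n by auto
  define i where "i = emb (Suc m) \<rho> \<nu> 0"
  define j where "j = emb (Suc m) \<rho> \<theta> 0"
  have i: "i < d \<rho>" "kid (Suc m) \<rho> i = \<nu>" and j: "j < d \<rho>" "kid (Suc m) \<rho> j = \<theta>"
    using emb[OF r n d_pos[OF nR]] emb[OF r l d_pos[OF lR]] by (auto simp: i_def j_def)
  obtain g where g: "g \<in> signed_perms (Suc (Suc m))" "\<rho> g $$ (i, j) \<noteq> 0"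
    using coefficient_nonzero[OF r i(1) j(1)] by blast
  have z: "\<rho> h $$ (i, j) = 0" if "h \<in> signed_perms (Suc m)" for h
    using restrict_index_kid[OF r that i(1) j(1)] i j ne by simp
  obtain h h' where h: "h \<in> signed_perms (Suc m)" "h' \<in> signed_perms (Suc m)" "g = h \<circ> adj m \<circ> h'"
    using g(1)
  proof (cases rule: double_coset)
    case 1
    then show ?thesis using z g(2) by simp
  next
    case (2 h)
    then show ?thesis using flip_mult_index[OF r 2(1) i(1) j(1)] z g(2) by simp
  qed (use that in blast)
  have "\<exists>k<d \<rho>. \<exists>l<d \<rho>. \<rho> h $$ (i, k) * \<rho> (adj m) $$ (k, l) * \<rho> h' $$ (l, j) \<noteq> 0"
  proof (rule ccontr)
    assume "\<not> ?thesis"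
    then have "\<rho> g $$ (i, j) = 0"
      unfolding h(3) sandwich[OF r h(1,2) i(1) j(1)] by (intro sum.neutral ballI) (auto simp del: mult_eq_0_iff)
    then show False using g(2) by simp
  qed
  then obtain k l where kl: "k < d \<rho>" "l < d \<rho>"
    and nz: "\<rho> h $$ (i, k) \<noteq> 0" "\<rho> (adj m) $$ (k, l) \<noteq> 0" "\<rho> h' $$ (l, j) \<noteq> 0" by auto
  have k: "kid (Suc m) \<rho> k = \<nu>" and l: "kid (Suc m) \<rho> l = \<theta>"
    using nz(1,3) restrict_index_kid[OF r h(1) i(1) kl(1)] restrict_index_kid[OF r h(2) kl(2) j(1)] i j
    by (auto split: if_splits)
  define \<mu> where "\<mu> = kid2 m \<rho> k"
  have m: "kid2 m \<rho> l = \<mu>" using adj_index[OF r kl] nz(2) by (auto simp: \<mu>_def split: if_splits)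
  have "\<mu> \<in> down m \<nu>" "\<mu> \<in> down m \<theta>"
    using kid_down[OF nR block_bounds(2)[OF r kl(1), unfolded k]]
      kid_down[OF lR block_bounds(2)[OF r kl(2), unfolded l]] k l m
    by (auto simp: \<mu>_def kid2_def)
  moreover have kl_ne: "k \<noteq> l" using k l ne by auto
  moreover have "cont (Suc m) \<nu> \<rho> = cont m \<mu> \<theta>" "sgn_of (Suc m) \<nu> \<rho> = sgn_of m \<mu> \<theta>"
    using adj_content[OF r kl] adj_sgn[OF r kl] nz(2) kl_ne k l m by auto
  \<comment> \<open>The eigenvalues along the paths from \<open>\<mu>\<close> to
    \<open>\<rho>\<close> through \<open>\<theta>\<close> and through \<open>\<nu>\<close> have the
    same sum, as both telescope. So the first pair of equations yields the crossed one.\<close>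
  moreover from this have "cont (Suc m) \<theta> \<rho> = cont m \<mu> \<nu>" "sgn_of (Suc m) \<theta> \<rho> = sgn_of m \<mu> \<nu>"
    unfolding cont_def sgn_of_def by (auto simp: algebra_simps)
  ultimately show thesis using that[of \<mu>] by (simp add: wt_def)
qed

lemma R_0_unique:
  assumes "\<mu> \<in> R 0" "\<mu>' \<in> R 0"
  shows "\<mu> = \<mu>'"
proof (rule ccontr)
  assume ne: "\<mu> \<noteq> \<mu>'"
  have s: "signed_perms 0 = {id}"
  proof (intro equalityI subsetI)
    fix \<pi> assume p: "\<pi> \<in> signed_perms 0"
    have "\<pi> x = id x" for x
      using signed_permsD(4)[OF p, of x] signed_perms_zero[OF p] by (cases "x = 0") auto
    then show "\<pi> \<in> {id}" by auto
  qed auto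
  have "inv\<^bsub>weyl_B 0\<^esub> id = id"
    using monoid.inv_one[OF group.is_monoid[OF group_weyl_B], of 0] by (simp add: weyl_B_one)
  then show False
    using orthogonality[OF assms, of 0 0 0 0] ne d_pos[OF assms(1)] d_pos[OF assms(2)]
      id_index[OF assms(1), of 0 0] id_index[OF assms(2), of 0 0] s by simp
qed

text \<open>Two common constituents \<open>\<mu>\<close> and \<open>\<mu>'\<close> would themselves
  have a common constituent, once as parts of \<open>\<theta>\<close> and once as parts of
  \<open>\<nu>\<close>. By induction it is the same one, so \<open>\<mu>\<close> has the same weight
  in \<open>\<theta>\<close> and in \<open>\<nu>\<close>, and \<open>up_unique_wt\<close> identifies
  the two.\<close>

lemma common_down_unique:
  "\<theta> \<in> R (Suc m) \<Longrightarrow> \<nu> \<in> R (Suc m) \<Longrightarrow> \<theta> \<noteq> \<nu> \<Longrightarrow> \<mu> \<in> down m \<theta> \<Longrightarrow> \<mu> \<in> down m \<nu> \<Longrightarrow>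
    \<mu>' \<in> down m \<theta> \<Longrightarrow> \<mu>' \<in> down m \<nu> \<Longrightarrow> \<mu> = \<mu>'"
proof (induction m arbitrary: \<theta> \<nu> \<mu> \<mu>')
  case 0
  then show ?case using R_0_unique down_subset by blast
next
  case (Suc m)
  show ?case
  proof (rule ccontr)
    assume ne: "\<mu> \<noteq> \<mu>'"
    have mR: "\<mu> \<in> R (Suc m)" "\<mu>' \<in> R (Suc m)" using down_subset Suc.prems by blast+
    obtain \<kappa> where k: "\<kappa> \<in> down m \<mu>" "\<kappa> \<in> down m \<mu>'" "wt m \<kappa> \<mu>' = wt (Suc m) \<mu> \<theta>"
      using common_down[OF Suc.prems(1) Suc.prems(4,6) ne] by metis
    obtain \<kappa>' where k': "\<kappa>' \<in> down m \<mu>" "\<kappa>' \<in> down m \<mu>'" "wt m \<kappa>' \<mu>' = wt (Suc m) \<mu> \<nu>"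
      using common_down[OF Suc.prems(2) Suc.prems(5,7) ne] by metis
    have "\<kappa> = \<kappa>'" using Suc.IH[OF mR ne] k k' by blast
    then have "wt (Suc m) \<mu> \<theta> = wt (Suc m) \<mu> \<nu>" using k k' by simp
    then show False using up_unique_wt[OF Suc.prems(1,2,4,5)] Suc.prems(3) by blast
  qed
qed

text \<open>Otherwise the crossed weights in \<open>common_down\<close> would be equal, against
  \<open>up_unique_wt\<close> one level below. On level 0 there is only one representation.\<close>

lemma down_unique_wt:
  assumes r: "\<rho> \<in> R (Suc m)" and l: "\<theta> \<in> down m \<rho>" and n: "\<nu> \<in> down m \<rho>" and eq: "wt m \<theta> \<rho> = wt m \<nu> \<rho>"
  shows "\<theta> = \<nu>"
proof (rule ccontr)
  assume ne: "\<theta> \<noteq> \<nu>"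
  show False
  proof (cases m)
    case 0
    then show ?thesis using R_0_unique down_subset[OF r] l n ne by metis
  next
    case (Suc k)
    obtain \<mu> where m: "\<mu> \<in> down k \<theta>" "\<mu> \<in> down k \<nu>" "wt k \<mu> \<theta> = wt m \<nu> \<rho>" "wt k \<mu> \<nu> = wt m \<theta> \<rho>"
      using common_down[of \<rho> k \<theta> \<nu>] r l n ne Suc by metis
    have "\<theta> \<in> R (Suc k)" "\<nu> \<in> R (Suc k)" using down_subset[OF r] l n Suc by auto
    then show ?thesis using up_unique_wt[of \<theta> k \<nu> \<mu>] m ne eq by metis
  qed
qed

text \<open>Both sides are the trace of the Jucys-Murphy element on the block
  \<open>\<sigma>\<close> of \<open>\<rho>\<close>. Its \<open>2 * Suc m\<close> reflections are
  conjugate to \<open>adj m\<close> by elements that preserve this block, so each contributes the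
  trace of \<open>adj m\<close> there, which \<open>adj_same_kid\<close> provides.\<close>

lemma secular:
  assumes r: "\<rho> \<in> R (Suc (Suc m))" and s: "\<sigma> \<in> down (Suc m) \<rho>"
  shows "of_nat (d \<sigma>) * cont (Suc m) \<sigma> \<rho> = of_nat (2 * Suc m) * (\<Sum>b<d \<sigma>.
    if sgn_of (Suc m) \<sigma> \<rho> = sgn_of m (kid m \<sigma> b) \<sigma>
    then 2 / (cont (Suc m) \<sigma> \<rho> - cont m (kid m \<sigma> b) \<sigma>) else 0)"
proof -
  have sR: "\<sigma> \<in> R (Suc m)" using down_subset[OF r s] .
  note E = emb[OF r s]
  let ?i = "emb (Suc m) \<rho> \<sigma>"
  define D where "D b = (if sgn_of (Suc m) \<sigma> \<rho> = sgn_of m (kid m \<sigma> b) \<sigma>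
    then 2 / (cont (Suc m) \<sigma> \<rho> - cont m (kid m \<sigma> b) \<sigma>) else 0)" for b
  have S: "\<rho> (adj m) $$ (?i u, ?i v) = (if u = v then D v else 0)" if uv: "u < d \<sigma>" "v < d \<sigma>" for u v
  proof -
    have "?i u = ?i v \<longleftrightarrow> u = v" using E(3)[OF uv(1)] E(3)[OF uv(2)] by metis
    then show ?thesis
      using adj_same_kid(1)[OF r E(1)[OF uv(1)] E(1)[OF uv(2)]] E(2)[OF uv(1)] E(2,3)[OF uv(2)]
      by (auto simp: D_def kid2_def)
  qed
  have tr: "(\<Sum>b<d \<sigma>. \<rho> t $$ (?i b, ?i b)) = (\<Sum>b<d \<sigma>. D b)" if t: "t \<in> new_reflections (Suc m)" for t
  proof -
    obtain z where z: "z \<in> signed_perms (Suc m)" "z \<circ> adj m = t \<circ> z" using new_reflection_conj[OF t] .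
    define w where "w = inv_into UNIV z"
    have w: "w \<in> signed_perms (Suc m)" unfolding w_def by (rule signed_perms_inv[OF z(1)])
    have zw: "z \<circ> w = id" "w \<circ> z = id"
      using signed_permsD(1,2)[OF z(1)] by (simp_all add: w_def bij_is_surj flip: surj_iff)
    have t_eq: "t = z \<circ> adj m \<circ> w" unfolding z(2) by (simp add: comp_assoc zw)
    have "\<rho> t $$ (?i b, ?i b) = (\<Sum>u<d \<sigma>. D u * (\<sigma> w $$ (u, b) * \<sigma> z $$ (b, u)))" if b: "b < d \<sigma>" for b
    proof -
      have "\<rho> t $$ (?i b, ?i b) = (\<Sum>k<d \<rho>. \<rho> z $$ (?i b, k) * (\<Sum>l<d \<rho>. \<rho> (adj m) $$ (k, l) * \<rho> w $$ (l, ?i b)))"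
        unfolding t_eq sandwich[OF r z(1) w E(1)[OF b] E(1)[OF b]] by (simp add: sum_distrib_left mult.assoc)
      also have "\<dots> = (\<Sum>u<d \<sigma>. \<sigma> z $$ (b, u) * (\<Sum>v<d \<sigma>. \<rho> (adj m) $$ (?i u, ?i v) * \<sigma> w $$ (v, b)))"
        unfolding sum_restrict_left[OF r s z(1) b] sum_restrict_right[OF r s w b] ..
      also have "\<dots> = (\<Sum>u<d \<sigma>. D u * (\<sigma> w $$ (u, b) * \<sigma> z $$ (b, u)))"
      proof (intro sum.cong refl)
        fix u assume "u \<in> {..<d \<sigma>}"
        then have u: "u < d \<sigma>" by simp
        have "(\<Sum>v<d \<sigma>. \<rho> (adj m) $$ (?i u, ?i v) * \<sigma> w $$ (v, b)) =
            (\<Sum>v<d \<sigma>. (if u = v then D u else 0) * \<sigma> w $$ (v, b))"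
          by (intro sum.cong refl) (use S u in auto)
        then show "\<sigma> z $$ (b, u) * (\<Sum>v<d \<sigma>. \<rho> (adj m) $$ (?i u, ?i v) * \<sigma> w $$ (v, b)) =
            D u * (\<sigma> w $$ (u, b) * \<sigma> z $$ (b, u))"
          using sum_diagonal(2)[OF u, of "D u"] by simp
      qed
      finally show ?thesis .
    qed
    then have "(\<Sum>b<d \<sigma>. \<rho> t $$ (?i b, ?i b)) =
        (\<Sum>u<d \<sigma>. D u * (\<Sum>b<d \<sigma>. \<sigma> w $$ (u, b) * \<sigma> z $$ (b, u)))"
      unfolding sum_distrib_left by (subst sum.swap) simp
    also have "\<dots> = (\<Sum>u<d \<sigma>. D u)"
    proof (intro sum.cong refl)
      fix u assume "u \<in> {..<d \<sigma>}"
      then show "D u * (\<Sum>b<d \<sigma>. \<sigma> w $$ (u, b) * \<sigma> z $$ (b, u)) = D u"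
        using mult_index[OF sR w z(1), of u u] id_index[OF sR, of u u] zw by simp
    qed
    finally show ?thesis .
  qed
  have "of_nat (d \<sigma>) * cont (Suc m) \<sigma> \<rho> = (\<Sum>b<d \<sigma>. \<Sum>t\<in>new_reflections (Suc m). \<rho> t $$ (?i b, ?i b))"
    using new_reflections_index[OF r E(1) E(1)] E(2) by simp
  also have "\<dots> = (\<Sum>t\<in>new_reflections (Suc m). \<Sum>b<d \<sigma>. D b)"
    by (subst sum.swap) (simp add: tr)
  also have "\<dots> = of_nat (2 * Suc m) * (\<Sum>b<d \<sigma>. D b)" by (simp add: card_new_reflections)
  finally show ?thesis by (simp add: D_def)
qed

lemma cont_ne:
  assumes r: "\<rho> \<in> R (Suc (Suc m))" and s: "\<sigma> \<in> down (Suc m) \<rho>" and b: "b < d \<sigma>"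
    and eq: "sgn_of (Suc m) \<sigma> \<rho> = sgn_of m (kid m \<sigma> b) \<sigma>"
  shows "cont (Suc m) \<sigma> \<rho> \<noteq> cont m (kid m \<sigma> b) \<sigma>"
  using adj_same_kid(2)[OF r emb(1)[OF r s b] emb(1)[OF r s b] refl] emb(2,3)[OF r s b] eq
  by (simp add: kid2_def)

text \<open>In the secular equation all weights are positive, which forces real solutions.\<close>

lemma refl_sum_real: "\<rho> \<in> R n \<Longrightarrow> refl_sum n \<rho> \<in> \<real>"
proof (induction n arbitrary: \<rho> rule: less_induct)
  case (less n)
  consider "n = 0 \<or> n = 1" | m where "n = Suc (Suc m)" by (metis One_nat_def not0_implies_Suc)
  then show ?case
  proof cases
    case 1
    then have "reflections n = {}" by (auto simp: reflections_def)
    then show ?thesis by (simp add: refl_sum_def)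
  next
    case (2 m)
    have r: "\<rho> \<in> R (Suc (Suc m))" using less 2 by simp
    define \<sigma> where "\<sigma> = kid (Suc m) \<rho> 0"
    have s: "\<sigma> \<in> down (Suc m) \<rho>" "\<sigma> \<in> R (Suc m)"
      using kid_down[OF r d_pos[OF r]] block_bounds(3)[OF r d_pos[OF r]] by (auto simp: \<sigma>_def)
    define x where "x = cont (Suc m) \<sigma> \<rho>"
    define y where "y b = cont m (kid m \<sigma> b) \<sigma>" for b
    define P where "P b \<longleftrightarrow> sgn_of (Suc m) \<sigma> \<rho> = sgn_of m (kid m \<sigma> b) \<sigma>" for b
    have sr: "refl_sum (Suc m) \<sigma> \<in> \<real>" using less.IH[of "Suc m"] s 2 by simp
    have y: "Im (y b) = 0" if "b < d \<sigma>" for b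
      using sr less.IH[of m, OF _ block_bounds(3)[OF s(2) that]] 2
      by (simp add: y_def cont_def complex_is_Real_iff)
    \<comment> \<open>Since \<open>y b\<close> is real by induction, a summand has imaginary part
      \<open>- Im x * c b\<close> with \<open>c b\<close> nonnegative. The equation becomes a
      positive number times \<open>Im x\<close> equal to zero.\<close>
    define c where "c b = (if P b then 2 / ((Re x - Re (y b))\<^sup>2 + (Im x)\<^sup>2) else 0)" for b
    have "Im (if P b then 2 / (x - y b) else 0) = - Im x * c b" if "b < d \<sigma>" for b
      using y[OF that] by (simp add: c_def Im_divide)
    then have "Im (of_nat (2 * Suc m) * (\<Sum>b<d \<sigma>. if P b then 2 / (x - y b) else 0)) =
        real (2 * Suc m) * (\<Sum>b<d \<sigma>. - Im x * c b)" by simp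
    moreover have "of_nat (d \<sigma>) * x = of_nat (2 * Suc m) * (\<Sum>b<d \<sigma>. if P b then 2 / (x - y b) else 0)"
      unfolding x_def y_def P_def by (rule secular[OF r s(1)])
    moreover have "Im (of_nat (d \<sigma>) * x) = real (d \<sigma>) * Im x" by simp
    ultimately have "real (d \<sigma>) * Im x = real (2 * Suc m) * (\<Sum>b<d \<sigma>. - Im x * c b)"
      by metis
    then have "(real (d \<sigma>) + real (2 * Suc m) * (\<Sum>b<d \<sigma>. c b)) * Im x = 0"
      by (simp add: sum_distrib_left[symmetric] sum_negf algebra_simps)
    moreover have "0 \<le> (\<Sum>b<d \<sigma>. c b)" by (intro sum_nonneg) (simp add: c_def)
    then have "0 < real (d \<sigma>) + real (2 * Suc m) * (\<Sum>b<d \<sigma>. c b)"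
      using d_pos[OF s(2)] by (intro add_pos_nonneg) auto
    ultimately have "Im x = 0" by simp
    then show ?thesis using sr 2 by (simp add: x_def cont_def complex_is_Real_iff)
  qed
qed

lemma cont_real:
  assumes "\<rho> \<in> R (Suc m)" "\<sigma> \<in> down m \<rho>"
  shows "cont m \<sigma> \<rho> = of_real (Re (cont m \<sigma> \<rho>))"
  using refl_sum_real[OF assms(1)] refl_sum_real[OF down_subset[OF assms]]
  by (simp add: cont_def complex_eq_iff complex_is_Real_iff)

lemma secular_real:
  assumes r: "\<rho> \<in> R (Suc (Suc m))" and s: "\<sigma> \<in> down (Suc m) \<rho>"
  shows "real (d \<sigma>) * Re (cont (Suc m) \<sigma> \<rho>) = real (2 * Suc m) * (\<Sum>b<d \<sigma>.
    if sgn_of (Suc m) \<sigma> \<rho> = sgn_of m (kid m \<sigma> b) \<sigma>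
    then 2 / (Re (cont (Suc m) \<sigma> \<rho>) - Re (cont m (kid m \<sigma> b) \<sigma>)) else 0)"
proof -
  have sR: "\<sigma> \<in> R (Suc m)" using down_subset[OF r s] .
  let ?X = "Re (cont (Suc m) \<sigma> \<rho>)" and ?Y = "\<lambda>b. Re (cont m (kid m \<sigma> b) \<sigma>)"
  have "complex_of_real (real (d \<sigma>) * ?X) = of_nat (d \<sigma>) * cont (Suc m) \<sigma> \<rho>"
    using cont_real[OF r s] by simp
  also have "\<dots> = of_nat (2 * Suc m) * (\<Sum>b<d \<sigma>.
    if sgn_of (Suc m) \<sigma> \<rho> = sgn_of m (kid m \<sigma> b) \<sigma>
    then 2 / (cont (Suc m) \<sigma> \<rho> - cont m (kid m \<sigma> b) \<sigma>) else 0)" by (rule secular[OF r s])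
  also have "(\<Sum>b<d \<sigma>. if sgn_of (Suc m) \<sigma> \<rho> = sgn_of m (kid m \<sigma> b) \<sigma>
      then 2 / (cont (Suc m) \<sigma> \<rho> - cont m (kid m \<sigma> b) \<sigma>) else 0) =
    (\<Sum>b<d \<sigma>. complex_of_real (if sgn_of (Suc m) \<sigma> \<rho> = sgn_of m (kid m \<sigma> b) \<sigma>
      then 2 / (?X - ?Y b) else 0))"
  proof (intro sum.cong refl)
    fix b assume "b \<in> {..<d \<sigma>}"
    then have "cont m (kid m \<sigma> b) \<sigma> = of_real (?Y b)" using cont_real[OF sR kid_down[OF sR]] by simp
    moreover have "cont (Suc m) \<sigma> \<rho> = of_real ?X" by (rule cont_real[OF r s])
    ultimately have "2 / (cont (Suc m) \<sigma> \<rho> - cont m (kid m \<sigma> b) \<sigma>) = of_real (2 / (?X - ?Y b))"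
      by (metis of_real_diff of_real_divide of_real_numeral)
    then show "(if sgn_of (Suc m) \<sigma> \<rho> = sgn_of m (kid m \<sigma> b) \<sigma>
        then 2 / (cont (Suc m) \<sigma> \<rho> - cont m (kid m \<sigma> b) \<sigma>) else 0) =
      complex_of_real (if sgn_of (Suc m) \<sigma> \<rho> = sgn_of m (kid m \<sigma> b) \<sigma> then 2 / (?X - ?Y b) else 0)"
      by simp
  qed
  also have "of_nat (2 * Suc m) * \<dots> = complex_of_real (real (2 * Suc m) * (\<Sum>b<d \<sigma>.
      if sgn_of (Suc m) \<sigma> \<rho> = sgn_of m (kid m \<sigma> b) \<sigma> then 2 / (?X - ?Y b) else 0))"
    by (simp only: of_real_mult of_real_of_nat_eq of_real_sum)
  finally show ?thesis by (simp only: of_real_eq_iff)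
qed

text \<open>Without a pole \<open>Y b\<close> between the two contents, the right-hand side of the
  secular equation would not grow from the smaller content to the larger one, because
  \<open>2 / (X - Y b)\<close> decreases in \<open>X\<close> on either side of its pole; the
  left-hand side grows strictly. By \<open>cont_ne\<close> neither content is itself a pole.\<close>

lemma between_ups:
  assumes r: "\<rho> \<in> R (Suc (Suc m))" "\<rho>' \<in> R (Suc (Suc m))"
    and s: "\<sigma> \<in> down (Suc m) \<rho>" "\<sigma> \<in> down (Suc m) \<rho>'"
    and sg: "sgn_of (Suc m) \<sigma> \<rho> = sgn_of (Suc m) \<sigma> \<rho>'"
    and lt: "Re (cont (Suc m) \<sigma> \<rho>) < Re (cont (Suc m) \<sigma> \<rho>')"
  shows "\<exists>\<mu>\<in>down m \<sigma>. sgn_of m \<mu> \<sigma> = sgn_of (Suc m) \<sigma> \<rho> \<and>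
    Re (cont (Suc m) \<sigma> \<rho>) < Re (cont m \<mu> \<sigma>) \<and> Re (cont m \<mu> \<sigma>) < Re (cont (Suc m) \<sigma> \<rho>')"
proof (rule ccontr)
  assume no: "\<not> ?thesis"
  have sR: "\<sigma> \<in> R (Suc m)" using down_subset[OF r(1) s(1)] .
  define A where "A = Re (cont (Suc m) \<sigma> \<rho>)"
  define Z where "Z = Re (cont (Suc m) \<sigma> \<rho>')"
  define Y where "Y b = Re (cont m (kid m \<sigma> b) \<sigma>)" for b
  define P where "P b \<longleftrightarrow> sgn_of (Suc m) \<sigma> \<rho> = sgn_of m (kid m \<sigma> b) \<sigma>" for b
  have step: "(if P b then 2 / (Z - Y b) else 0) \<le> (if P b then 2 / (A - Y b) else 0)" if b: "b < d \<sigma>" for b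
  proof (cases "P b")
    case True
    have k: "kid m \<sigma> b \<in> down m \<sigma>" using kid_down[OF sR b] .
    have "A \<noteq> Y b" "Z \<noteq> Y b"
      using cont_ne[OF r(1) s(1) b] cont_ne[OF r(2) s(2) b] True sg cont_real[OF r(1) s(1)]
        cont_real[OF r(2) s(2)] cont_real[OF sR k] by (metis P_def A_def Y_def, metis P_def Z_def Y_def)
    moreover have "\<not> (A < Y b \<and> Y b < Z)" using no k True by (auto simp: A_def Z_def Y_def P_def)
    moreover have "A < Z" using lt by (simp add: A_def Z_def)
    ultimately consider "Y b < A" | "Z < Y b" by linarith
    then have "2 / (Z - Y b) \<le> 2 / (A - Y b)"
    proof cases
      case 1
      then show ?thesis using \<open>A < Z\<close> by (intro divide_left_mono) auto
    next
      case 2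
      then show ?thesis using \<open>A < Z\<close> by (simp add: divide_le_cancel frac_le_eq divide_nonpos_pos field_simps mult_neg_neg)
    qed
    then show ?thesis using True by simp
  qed simp
  have "real (d \<sigma>) * Z = real (2 * Suc m) * (\<Sum>b<d \<sigma>. if P b then 2 / (Z - Y b) else 0)"
    unfolding Z_def Y_def P_def sg by (rule secular_real[OF r(2) s(2)])
  also have "\<dots> \<le> real (2 * Suc m) * (\<Sum>b<d \<sigma>. if P b then 2 / (A - Y b) else 0)"
    by (intro mult_left_mono sum_mono) (use step in auto)
  also have "\<dots> = real (d \<sigma>) * A"
    unfolding A_def Y_def P_def by (rule secular_real[OF r(1) s(1), symmetric])
  finally show False using d_pos[OF sR] lt by (simp add: A_def Z_def)
qed

end

section \<open>Counting branches\<close>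

text \<open>The induction removes the largest point of \<open>A\<close> together with a separator
  between it and the next largest.\<close>

lemma card_le_Suc_card_between:
  fixes A B :: "real set"
  assumes "finite A" "finite B" "\<And>a a'. a \<in> A \<Longrightarrow> a' \<in> A \<Longrightarrow> a < a' \<Longrightarrow> \<exists>b\<in>B. a < b \<and> b < a'"
  shows "card A \<le> Suc (card B)"
  using assms
proof (induction A arbitrary: B rule: finite_linorder_max_induct)
  case (insert x A)
  show ?case
  proof (cases "A = {}")
    case False
    then have "Max A \<in> A" using insert.hyps(1) by simp
    then obtain b where b: "b \<in> B" "Max A < b" "b < x"
      using insert.prems(2)[of "Max A" x] insert.hyps(2) by auto
    have "card A \<le> Suc (card (B - {b}))"
    proof (rule insert.IH)
      fix a a' assume a: "a \<in> A" "a' \<in> A" "a < a'"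
      then obtain c where c: "c \<in> B" "a < c" "c < a'" using insert.prems(2)[of a a'] by auto
      moreover have "a' \<le> Max A" using a insert.hyps(1) by simp
      ultimately show "\<exists>c\<in>B - {b}. a < c \<and> c < a'" using b by (intro bexI[of _ c]) auto
    qed (use insert.prems in simp)
    also have "Suc (card (B - {b})) = card B" using b insert.prems(1) by (metis card_Suc_Diff1)
    finally show ?thesis using insert.hyps by (auto simp: card_insert_if)
  qed simp
qed simp

lemma left_inverse_card_le:
  fixes P :: "'i \<Rightarrow> 'j \<Rightarrow> complex" and Q :: "'j \<Rightarrow> 'i \<Rightarrow> complex"
  assumes fin: "finite A" "finite B"
    and PQ: "\<And>a a'. a \<in> A \<Longrightarrow> a' \<in> A \<Longrightarrow> (\<Sum>b\<in>B. P a b * Q b a') = (if a = a' then 1 else 0)"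
  shows "card A \<le> card B"
proof -
  obtain f where f: "bij_betw f {..<card A} A"
    using ex_bij_betw_nat_finite[OF fin(1)] by (auto simp: atLeast0LessThan)
  obtain g where g: "bij_betw g {..<card B} B"
    using ex_bij_betw_nat_finite[OF fin(2)] by (auto simp: atLeast0LessThan)
  define M where "M = mat (card A) (card B) (\<lambda>(i, j). P (f i) (g j))"
  define N where "N = mat (card B) (card A) (\<lambda>(i, j). Q (g i) (f j))"
  have car: "M \<in> carrier_mat (card A) (card B)" "N \<in> carrier_mat (card B) (card A)"
    by (auto simp: M_def N_def)
  have fA: "f i \<in> A" if "i < card A" for i using f that by (auto simp: bij_betw_def)
  have "M * N = 1\<^sub>m (card A)"
  proof (rule eq_matI)
    fix i j assume "i < dim_row (1\<^sub>m (card A) :: complex mat)" "j < dim_col (1\<^sub>m (card A) :: complex mat)"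
    then have ij: "i < card A" "j < card A" by auto
    have "(M * N) $$ (i, j) = (\<Sum>l<card B. P (f i) (g l) * Q (g l) (f j))"
      by (subst index_mult_mat_sum[OF car ij]) (use ij in \<open>auto simp: M_def N_def\<close>)
    also have "\<dots> = (\<Sum>b\<in>B. P (f i) b * Q b (f j))"
      using sum.reindex_bij_betw[OF g, of "\<lambda>b. P (f i) b * Q b (f j)"] .
    also have "\<dots> = (if f i = f j then 1 else 0)" using PQ fA ij by simp
    also have "f i = f j \<longleftrightarrow> i = j" using f ij by (auto simp: bij_betw_def dest: inj_onD)
    finally show "(M * N) $$ (i, j) = 1\<^sub>m (card A) $$ (i, j)" using ij by simp
  qed (use car in auto)
  then show ?thesis using left_inverse_dim_le[OF car] by blast
qed

lemma weyl_B_inv: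
  assumes g: "g \<in> signed_perms m"
  shows "inv\<^bsub>weyl_B m\<^esub> g = inv_into UNIV g"
proof (rule group.inv_equality[OF group_weyl_B])
  have i: "inv_into UNIV g \<in> signed_perms m" by (rule signed_perms_inv[OF g])
  then show "inv_into UNIV g \<in> carrier (weyl_B m)" "g \<in> carrier (weyl_B m)"
    using g by (simp_all add: carrier_weyl_B)
  show "inv_into UNIV g \<otimes>\<^bsub>weyl_B m\<^esub> g = \<one>\<^bsub>weyl_B m\<^esub>"
    using signed_permsD(2)[OF g] by (simp add: weyl_B_mult[OF i g] weyl_B_one)
qed

context branching
begin

section \<open>Addable and removable boxes, expressed by weights\<close>

definition ups :: "nat \<Rightarrow> rep \<Rightarrow> rep set" where
  "ups m \<sigma> = {\<rho> \<in> R (Suc m). \<sigma> \<in> down m \<rho>}"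

text \<open>Weights replace the constituents, since the same box is compared in representations of
  different levels. On level 0 there is nothing to remove.\<close>

definition down_wts :: "nat \<Rightarrow> rep \<Rightarrow> (complex \<times> complex) set" where
  "down_wts n \<rho> = (case n of 0 \<Rightarrow> {} | Suc m \<Rightarrow> (\<lambda>\<sigma>. wt m \<sigma> \<rho>) ` down m \<rho>)"

lemma down_wts_simps [simp]:
  "down_wts 0 \<rho> = {}" "down_wts (Suc m) \<rho> = (\<lambda>\<sigma>. wt m \<sigma> \<rho>) ` down m \<rho>"
  by (simp_all add: down_wts_def)

lemma finite_down_wts [simp]: "finite (down_wts n \<rho>)"
  by (cases n) simp_all

text \<open>\<open>common_down\<close> carries the weight of another constituent of
  \<open>\<rho>\<close> to a constituent of \<open>\<sigma>\<close>: boxes removable next to a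
  removed one remain removable.\<close>

lemma down_wts_of_down:
  assumes r: "\<rho> \<in> R (Suc m)" and s: "\<sigma> \<in> down m \<rho>"
  shows "down_wts (Suc m) \<rho> - {wt m \<sigma> \<rho>} \<subseteq> down_wts m \<sigma>"
proof
  fix w assume "w \<in> down_wts (Suc m) \<rho> - {wt m \<sigma> \<rho>}"
  then obtain \<nu> where n: "\<nu> \<in> down m \<rho>" "w = wt m \<nu> \<rho>" "\<nu> \<noteq> \<sigma>" by auto
  show "w \<in> down_wts m \<sigma>"
  proof (cases m)
    case 0
    then show ?thesis using R_0_unique down_subset[OF r] s n by metis
  next
    case (Suc k)
    then obtain \<mu> where "\<mu> \<in> down k \<sigma>" "wt k \<mu> \<sigma> = wt m \<nu> \<rho>"
      using common_down[of \<rho> k \<sigma> \<nu>] r s n by metis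
    then show ?thesis using Suc n by force
  qed
qed

text \<open>Removing all boxes with weights in \<open>W\<close> from \<open>\<sigma>\<close> gives a bipartition to which each of
  them can be added. The set \<open>V\<close> of weights that can be added is carried along for the
  induction.\<close>

lemma remove_corners:
  assumes "finite W" "\<sigma> \<in> R k" "W \<subseteq> down_wts k \<sigma>" "V \<inter> W = {}"
    "\<forall>v\<in>V. \<exists>\<rho>\<in>ups k \<sigma>. wt k \<sigma> \<rho> = v \<and> W \<subseteq> down_wts (Suc k) \<rho>"
  shows "\<exists>j. k = j + card W \<and> (\<exists>\<kappa>\<in>R j. \<forall>w\<in>W \<union> V. \<exists>\<rho>\<in>ups j \<kappa>. wt j \<kappa> \<rho> = w)"
  using assms
proof (induction W arbitrary: k \<sigma> V rule: finite_induct)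
  case empty
  then show ?case by auto
next
  case (insert w W)
  obtain k' where k: "k = Suc k'" using insert.prems(2) by (cases k) auto
  then obtain \<mu> where m: "\<mu> \<in> down k' \<sigma>" "wt k' \<mu> \<sigma> = w" using insert.prems(2) by auto
  have sR: "\<sigma> \<in> R (Suc k')" using insert.prems(1) k by simp
  have mR: "\<mu> \<in> R k'" using down_subset[OF sR m(1)] .
  have W: "W \<subseteq> down_wts k' \<mu>"
    using down_wts_of_down[OF sR m(1)] insert.prems(2) insert.hyps(2) k m(2) by blast
  \<comment> \<open>Removing the box \<open>w\<close> makes it addable, with witness
    \<open>\<sigma>\<close>. A box \<open>v\<close> addable to \<open>\<sigma>\<close> stays addable
    to \<open>\<mu>\<close>: take \<open>\<rho>\<close>, which has both boxes, and remove
    \<open>w\<close> from it. That all of \<open>W\<close> is removable from the witnesses lets this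
    continue with the remaining boxes.\<close>
  have "\<exists>\<nu>\<in>ups k' \<mu>. wt k' \<mu> \<nu> = v \<and> W \<subseteq> down_wts (Suc k') \<nu>" if v: "v \<in> insert w V" for v
  proof (cases "v = w")
    case True
    then show ?thesis using m sR insert.prems(2) k by (intro bexI[of _ \<sigma>]) (auto simp: ups_def)
  next
    case False
    then obtain \<rho> where r: "\<rho> \<in> R (Suc k)" "\<sigma> \<in> down k \<rho>" "wt k \<sigma> \<rho> = v" "insert w W \<subseteq> down_wts (Suc k) \<rho>"
      using insert.prems(4) v by (auto simp: ups_def)
    then obtain \<nu> where n: "\<nu> \<in> down k \<rho>" "wt k \<nu> \<rho> = w" by auto
    have "\<sigma> \<noteq> \<nu>" using n r False by auto
    then obtain \<mu>' where m': "\<mu>' \<in> down k' \<sigma>" "\<mu>' \<in> down k' \<nu>" "wt k' \<mu>' \<sigma> = w" "wt k' \<mu>' \<nu> = v"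
      using common_down[of \<rho> k' \<sigma> \<nu>] r n k by metis
    have "\<mu>' = \<mu>" using down_unique_wt[OF sR m'(1) m(1)] m m' by simp
    moreover have "W \<subseteq> down_wts (Suc k') \<nu>"
      using down_wts_of_down[OF r(1) n(1)] r(4) insert.hyps(2) n(2) k by blast
    moreover have "\<nu> \<in> R (Suc k')" using down_subset[OF r(1) n(1)] k by simp
    ultimately show ?thesis using m' by (intro bexI[of _ \<nu>]) (auto simp: ups_def)
  qed
  then have "\<exists>j. k' = j + card W \<and> (\<exists>\<kappa>\<in>R j. \<forall>u\<in>W \<union> insert w V. \<exists>\<rho>\<in>ups j \<kappa>. wt j \<kappa> \<rho> = u)"
    using insert.IH[OF mR W, of "insert w V"] insert.hyps(2) insert.prems(3) by blast
  then show ?case using insert.hyps k by auto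
qed

text \<open>By \<open>between_ups\<close> the removable contents of sign \<open>c\<close> separate
  the addable ones. Comparing real parts is harmless, as contents are real and the sign is
  fixed.\<close>

lemma up_wts_bound:
  assumes k: "\<kappa> \<in> R j" and W: "finite W" "\<forall>w\<in>W. fst w = c \<and> (\<exists>\<rho>\<in>ups j \<kappa>. wt j \<kappa> \<rho> = w)"
  shows "card W \<le> Suc (card {w \<in> down_wts j \<kappa>. fst w = c})"
proof -
  let ?f = "\<lambda>w :: complex \<times> complex. Re (snd w)"
  have real: "snd w = of_real (?f w)" if "w \<in> W" for w
    using that W(2) cont_real[of _ j \<kappa>] by (auto simp: ups_def wt_def)
  have inj: "inj_on ?f W"
  proof (rule inj_onI)
    fix v w assume "v \<in> W" "w \<in> W" "?f v = ?f w"
    then show "v = w" using real[of v] real[of w] W(2) by (metis prod_eq_iff)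
  qed
  have "card (?f ` W) \<le> Suc (card (?f ` {w \<in> down_wts j \<kappa>. fst w = c}))"
  proof (rule card_le_Suc_card_between)
    fix a a' assume "a \<in> ?f ` W" "a' \<in> ?f ` W" and lt: "a < a'"
    then obtain \<rho> \<rho>' where r: "\<rho> \<in> ups j \<kappa>" "wt j \<kappa> \<rho> \<in> W" "a = ?f (wt j \<kappa> \<rho>)"
      "\<rho>' \<in> ups j \<kappa>" "wt j \<kappa> \<rho>' \<in> W" "a' = ?f (wt j \<kappa> \<rho>')"
      using W(2) by (smt (verit) imageE)
    have sg: "sgn_of j \<kappa> \<rho> = c" "sgn_of j \<kappa> \<rho>' = c" using r W(2) by (auto simp: wt_def)
    show "\<exists>b\<in>?f ` {w \<in> down_wts j \<kappa>. fst w = c}. a < b \<and> b < a'"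
    proof (cases j)
      case 0
      \<comment> \<open>There are no \<open>swap\<close> reflections on these two levels, so all
        contents vanish and two different ones cannot occur.\<close>
      have "reflections 0 = {}" "reflections (Suc 0) = {}" by (auto simp: reflections_def)
      then have "cont 0 \<kappa> \<tau> = 0" for \<tau> by (simp add: cont_def refl_sum_def)
      then show ?thesis using lt r 0 by (simp add: wt_def)
    next
      case (Suc i)
      have u: "\<rho> \<in> R (Suc (Suc i))" "\<rho>' \<in> R (Suc (Suc i))" "\<kappa> \<in> down (Suc i) \<rho>" "\<kappa> \<in> down (Suc i) \<rho>'"
        using r Suc by (auto simp: ups_def)
      have "Re (cont (Suc i) \<kappa> \<rho>) < Re (cont (Suc i) \<kappa> \<rho>')" using lt r Suc by (simp add: wt_def)
      then obtain \<mu> where "\<mu> \<in> down i \<kappa>" "sgn_of i \<mu> \<kappa> = c" "a < Re (cont i \<mu> \<kappa>)" "Re (cont i \<mu> \<kappa>) < a'"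
        using between_ups[OF u] sg r Suc by (auto simp: wt_def)
      then show ?thesis using Suc by (intro bexI[of _ "Re (cont i \<mu> \<kappa>)"] image_eqI[of _ _ "wt i \<mu> \<kappa>"]) (auto simp: wt_def)
    qed
  qed (use W(1) in auto)
  then show ?thesis using card_image[OF inj] card_image_le[of "{w \<in> down_wts j \<kappa>. fst w = c}" ?f] by simp
qed

text \<open>A partition with \<open>r\<close> removable boxes contains a staircase.\<close>

lemma corner_bound:
  "\<sigma> \<in> R k \<Longrightarrow> card {w \<in> down_wts k \<sigma>. fst w = c} * Suc (card {w \<in> down_wts k \<sigma>. fst w = c}) \<le> 2 * k"
proof (induction k arbitrary: \<sigma> rule: less_induct)
  case (less k)
  define W where "W = {w \<in> down_wts k \<sigma>. fst w = c}"
  show ?case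
  proof (cases "W = {}")
    case True
    then show ?thesis unfolding W_def[symmetric] by simp
  next
    case False
    have fin: "finite W" by (simp add: W_def)
    obtain j \<kappa> where j: "k = j + card W" and kR: "\<kappa> \<in> R j" and up: "\<forall>w\<in>W. \<exists>\<rho>\<in>ups j \<kappa>. wt j \<kappa> \<rho> = w"
      using remove_corners[OF fin less.prems, of "{}"] by (auto simp: W_def)
    define s where "s = card {w \<in> down_wts j \<kappa>. fst w = c}"
    have "0 < card W" using False fin by (simp add: card_gt_0_iff)
    then have s: "s * Suc s \<le> 2 * j" using less.IH[OF _ kR] j by (simp add: s_def)
    have "card W \<le> Suc s" using up_wts_bound[OF kR fin, of c] up by (simp add: W_def s_def)
    then obtain p where p: "card W = Suc p" "p \<le> s" using \<open>0 < card W\<close> by (cases "card W") auto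
    \<comment> \<open>After the removal of \<open>p + 1\<close> boxes, \<open>\<kappa>\<close> on
      level \<open>k - (p + 1)\<close> has at least \<open>p\<close> removable boxes. Induction
      gives \<open>p * (p + 1) \<le> 2 * (k - (p + 1))\<close>, and adding
      \<open>2 * (p + 1)\<close> gives the bound for \<open>p + 1\<close>.\<close>
    have "p * Suc p \<le> s * Suc s" using p by (intro mult_mono) auto
    then have "card W * Suc (card W) \<le> 2 * k" using p s j by (simp add: algebra_simps)
    then show ?thesis by (simp add: W_def)
  qed
qed

lemma sgn_split:
  assumes "\<And>w. w \<in> W \<Longrightarrow> fst w = 1 \<or> fst w = (- 1 :: complex)" "finite W"
  shows "card W = card {w \<in> W. fst w = 1} + card {w \<in> W. fst w = - 1}"
proof -
  have "W = {w \<in> W. fst w = 1} \<union> {w \<in> W. fst w = - 1}" using assms(1) by blast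
  moreover have "{w \<in> W. fst w = 1} \<inter> {w \<in> W. fst w = - 1} = {}" by auto
  ultimately show ?thesis using assms(2) by (metis (no_types, lifting) card_Un_disjoint finite_Un)
qed

definition downs :: "nat \<Rightarrow> rep \<Rightarrow> nat" where
  "downs n \<sigma> = card (down_wts n \<sigma>)"

lemma card_down: "\<sigma> \<in> R (Suc m) \<Longrightarrow> card (down m \<sigma>) = downs (Suc m) \<sigma>"
  unfolding downs_def down_wts_simps
  by (subst card_image) (auto intro!: inj_onI dest: down_unique_wt)

lemma down_wts_sgn_split:
  assumes s: "\<sigma> \<in> R k"
  shows "card (down_wts k \<sigma>) = card {w \<in> down_wts k \<sigma>. fst w = 1} + card {w \<in> down_wts k \<sigma>. fst w = - 1}"
proof (rule sgn_split[OF _ finite_down_wts])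
  fix w assume w: "w \<in> down_wts k \<sigma>"
  show "fst w = 1 \<or> fst w = - 1"
  proof (cases k)
    case 0
    then show ?thesis using w by simp
  next
    case (Suc m)
    then obtain \<nu> where "\<nu> \<in> set (kids m \<sigma>)" "w = wt m \<nu> \<sigma>" using w by (auto simp: down_def)
    then show ?thesis using sgn_of_cases[of \<sigma> m \<nu>] s Suc by (simp add: wt_def)
  qed
qed

text \<open>With \<open>p\<close> and \<open>q\<close> boxes of the two signs,
  \<open>corner_bound\<close> bounds \<open>p * (p + 1)\<close> and \<open>q * (q + 1)\<close> by
  \<open>2 * k\<close> each. The inequality \<open>2 * (p * q) \<le> p * p + q * q\<close> bounds
  the left-hand side by twice their sum.\<close>

lemma downs_bound:
  assumes s: "\<sigma> \<in> R k"
  shows "downs k \<sigma> * (downs k \<sigma> + 2) \<le> 8 * k"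
proof -
  define p q where "p = card {w \<in> down_wts k \<sigma>. fst w = 1}" and "q = card {w \<in> down_wts k \<sigma>. fst w = - 1}"
  have e: "downs k \<sigma> = p + q" unfolding downs_def p_def q_def by (rule down_wts_sgn_split[OF s])
  have "p * Suc p \<le> 2 * k" "q * Suc q \<le> 2 * k" using corner_bound[OF s] by (auto simp: p_def q_def)
  then have 1: "p * p + p + (q * q + q) \<le> 4 * k" by simp
  have "2 * (p * q) \<le> p * p + q * q"
  proof -
    have "2 * (int p * int q) \<le> int p * int p + int q * int q"
      using zero_le_square[of "int p - int q"] by (simp add: algebra_simps)
    then have "int (2 * (p * q)) \<le> int (p * p + q * q)" by simp
    then show ?thesis by (simp only: of_nat_le_iff)
  qed
  then show ?thesis using 1 unfolding e by (simp add: algebra_simps)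
qed

text \<open>The right-hand side is the dimension of the representation induced from
  \<open>\<sigma>\<close>, in which every \<open>\<rho>\<close> in \<open>U\<close> occurs. Instead
  of constructing it, a matrix \<open>P\<close> with rows for the indices of all
  \<open>\<rho>\<close> and columns for coset representatives and indices of \<open>\<sigma>\<close>
  is shown to have a right inverse \<open>Q\<close>.\<close>

lemma sum_d_ups:
  assumes s: "\<sigma> \<in> R m" and U: "finite U" "U \<subseteq> ups m \<sigma>"
  shows "(\<Sum>\<rho>\<in>U. d \<rho>) \<le> 2 * Suc m * d \<sigma>"
proof -
  have UR: "\<rho> \<in> R (Suc m)" "\<sigma> \<in> down m \<rho>" if "\<rho> \<in> U" for \<rho> using U that by (auto simp: ups_def)
  define N where "N = (of_nat (card (signed_perms (Suc m))) :: complex)"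
  define H where "H = (of_nat (card (signed_perms m)) :: complex)"
  have cpos: "card (signed_perms k) \<noteq> 0" for k
    using finite_signed_perms signed_perms_id by (metis card_eq_0_iff empty_iff)
  have H: "H \<noteq> 0" "N \<noteq> 0" using cpos by (simp_all add: H_def N_def)
  have D: "of_nat (d \<sigma>) \<noteq> (0 :: complex)" using d_pos[OF s] by simp
  define P where "P = (\<lambda>(\<rho>, a) (y, b). \<rho> y $$ (a, emb m \<rho> \<sigma> b) :: complex)"
  \<comment> \<open>The scalar is forced by orthogonality: the sum over the group is
    \<open>N * d \<sigma> / d \<rho>\<close> on the diagonal, and passing from the group to coset
    representatives divides it by \<open>H\<close>.\<close>
  define Q where "Q = (\<lambda>(y, b) (\<rho>, c). of_nat (d \<rho>) * H / (N * of_nat (d \<sigma>)) *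
    \<rho> (inv_into UNIV y) $$ (emb m \<rho> \<sigma> b, c) :: complex)"
  let ?A = "SIGMA \<rho>:U. {..<d \<rho>}" and ?B = "coset_reps m \<times> {..<d \<sigma>}"
  have "card ?A \<le> card ?B"
  proof (rule left_inverse_card_le[of ?A ?B P Q])
    fix a a' assume "a \<in> ?A" "a' \<in> ?A"
    then obtain \<rho> i \<rho>' j where a: "a = (\<rho>, i)" "a' = (\<rho>', j)" "\<rho> \<in> U" "\<rho>' \<in> U" "i < d \<rho>" "j < d \<rho>'" by auto
    note r = UR[OF a(3)] and r' = UR[OF a(4)]
    note E = emb[OF r] and E' = emb[OF r']
    let ?c = "of_nat (d \<rho>') * H / (N * of_nat (d \<sigma>))"
    let ?t = "\<lambda>g. \<Sum>b<d \<sigma>. \<rho> g $$ (i, emb m \<rho> \<sigma> b) * \<rho>' (inv_into UNIV g) $$ (emb m \<rho>' \<sigma> b, j)"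
    \<comment> \<open>The inner element \<open>h\<close> cancels, because \<open>\<sigma> h\<close>
      and the matrix of its inverse meet in the sum over \<open>b\<close>. So \<open>?t\<close>
      depends on the coset only, and a sum over representatives is a sum over the group up to the
      factor \<open>H\<close>.\<close>
    have t_coset: "?t (y \<circ> h) = ?t y" if y: "y \<in> signed_perms (Suc m)" and h: "h \<in> signed_perms m" for y h
    proof -
      define w where "w = inv_into UNIV h"
      have w: "w \<in> signed_perms m" unfolding w_def by (rule signed_perms_inv[OF h])
      have hw: "h \<circ> w = id" using signed_permsD(1)[OF h] by (simp add: w_def bij_is_surj flip: surj_iff)
      have h1: "h \<in> signed_perms (Suc m)" "w \<in> signed_perms (Suc m)"
        using h w signed_perms_mono[of m "Suc m"] by auto
      have yi: "inv_into UNIV y \<in> signed_perms (Suc m)" by (rule signed_perms_inv[OF y])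
      have iv: "inv_into UNIV (y \<circ> h) = w \<circ> inv_into UNIV y"
        unfolding w_def using signed_permsD(1)[OF y] signed_permsD(1)[OF h] by (simp add: o_inv_distrib)
      have 1: "\<rho> (y \<circ> h) $$ (i, emb m \<rho> \<sigma> b) = (\<Sum>p<d \<sigma>. \<rho> y $$ (i, emb m \<rho> \<sigma> p) * \<sigma> h $$ (p, b))"
        if b: "b < d \<sigma>" for b
        unfolding mult_index[OF r(1) y h1(1) a(5) E(1)[OF b]] sum_restrict_right[OF r h b] ..
      have 2: "\<rho>' (w \<circ> inv_into UNIV y) $$ (emb m \<rho>' \<sigma> b, j) =
          (\<Sum>q<d \<sigma>. \<sigma> w $$ (b, q) * \<rho>' (inv_into UNIV y) $$ (emb m \<rho>' \<sigma> q, j))" if b: "b < d \<sigma>" for b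
        unfolding mult_index[OF r'(1) h1(2) yi E'(1)[OF b] a(6)] sum_restrict_left[OF r' w b] ..
      have "?t (y \<circ> h) = (\<Sum>b<d \<sigma>. \<Sum>p<d \<sigma>. \<Sum>q<d \<sigma>.
          \<rho> y $$ (i, emb m \<rho> \<sigma> p) * (\<sigma> h $$ (p, b) * \<sigma> w $$ (b, q)) * \<rho>' (inv_into UNIV y) $$ (emb m \<rho>' \<sigma> q, j))"
        unfolding iv using 1 2 by (simp add: sum_product mult.assoc)
      also have "\<dots> = (\<Sum>p<d \<sigma>. \<Sum>q<d \<sigma>. \<Sum>b<d \<sigma>.
          \<rho> y $$ (i, emb m \<rho> \<sigma> p) * (\<sigma> h $$ (p, b) * \<sigma> w $$ (b, q)) * \<rho>' (inv_into UNIV y) $$ (emb m \<rho>' \<sigma> q, j))"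
        by (rule trans[OF sum.swap], rule sum.cong[OF refl], rule sum.swap)
      also have "\<dots> = (\<Sum>p<d \<sigma>. \<Sum>q<d \<sigma>. \<rho> y $$ (i, emb m \<rho> \<sigma> p) *
          (if p = q then 1 else 0) * \<rho>' (inv_into UNIV y) $$ (emb m \<rho>' \<sigma> q, j))"
      proof (rule sum.cong[OF refl], rule sum.cong[OF refl])
        fix p q assume "p \<in> {..<d \<sigma>}" "q \<in> {..<d \<sigma>}"
        then have "(\<Sum>b<d \<sigma>. \<sigma> h $$ (p, b) * \<sigma> w $$ (b, q)) = (if p = q then 1 else 0)"
          using mult_index[OF s h w, of p q] id_index[OF s, of p q] hw by simp
        then show "(\<Sum>b<d \<sigma>. \<rho> y $$ (i, emb m \<rho> \<sigma> p) * (\<sigma> h $$ (p, b) * \<sigma> w $$ (b, q)) *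
            \<rho>' (inv_into UNIV y) $$ (emb m \<rho>' \<sigma> q, j)) = \<rho> y $$ (i, emb m \<rho> \<sigma> p) *
          (if p = q then 1 else 0) * \<rho>' (inv_into UNIV y) $$ (emb m \<rho>' \<sigma> q, j)"
          by (simp only: sum_distrib_left[symmetric] sum_distrib_right[symmetric])
      qed
      also have "\<dots> = ?t y" by (intro sum.cong refl) (simp add: if_distrib if_distribR cong: if_cong)
      finally show ?thesis .
    qed
    have "H * (\<Sum>y\<in>coset_reps m. ?t y) = (\<Sum>y\<in>coset_reps m. \<Sum>h\<in>signed_perms m. ?t (y \<circ> h))"
    proof -
      have "H * ?t y = (\<Sum>h\<in>signed_perms m. ?t (y \<circ> h))" if "y \<in> coset_reps m" for y
      proof -
        have "y \<in> signed_perms (Suc m)" using that coset_reps_subset by blast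
        then have "(\<Sum>h\<in>signed_perms m. ?t (y \<circ> h)) = (\<Sum>h\<in>signed_perms m. ?t y)"
          by (intro sum.cong refl t_coset)
        then show ?thesis by (simp add: H_def)
      qed
      then have "(\<Sum>y\<in>coset_reps m. H * ?t y) = (\<Sum>y\<in>coset_reps m. \<Sum>h\<in>signed_perms m. ?t (y \<circ> h))"
        by (rule sum.cong[OF refl])
      then show ?thesis by (simp only: sum_distrib_left[of H, where f = ?t])
    qed
    also have "\<dots> = (\<Sum>g\<in>signed_perms (Suc m). ?t g)" by (rule sum_cosets[symmetric])
    also have "\<dots> = (\<Sum>b<d \<sigma>. \<Sum>g\<in>signed_perms (Suc m).
        \<rho> g $$ (i, emb m \<rho> \<sigma> b) * \<rho>' (inv\<^bsub>weyl_B (Suc m)\<^esub> g) $$ (emb m \<rho>' \<sigma> b, j))"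
      by (subst sum.swap) (simp add: weyl_B_inv)
    also have "\<dots> = (\<Sum>b<d \<sigma>. if \<rho> = \<rho>' \<and> i = j then N / of_nat (d \<rho>) else 0)"
      by (intro sum.cong refl) (use orthogonality[OF r(1) r'(1) a(5) E(1) E'(1) a(6)] in \<open>auto simp: N_def\<close>)
    finally have "H * (\<Sum>y\<in>coset_reps m. ?t y) = (if a = a' then of_nat (d \<sigma>) * N / of_nat (d \<rho>) else 0)"
      using a by auto
    then have "?c * (\<Sum>y\<in>coset_reps m. ?t y) = (if a = a' then 1 else 0)"
      using H D d_pos[OF r(1)] a by (auto simp: field_simps split: if_splits)
    moreover have "(\<Sum>b\<in>?B. P a b * Q b a') = ?c * (\<Sum>y\<in>coset_reps m. ?t y)"
    proof -
      have "(\<Sum>b\<in>?B. P a b * Q b a') = (\<Sum>(y, b)\<in>?B.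
          ?c * (\<rho> y $$ (i, emb m \<rho> \<sigma> b) * \<rho>' (inv_into UNIV y) $$ (emb m \<rho>' \<sigma> b, j)))"
        by (intro sum.cong refl) (auto simp: P_def Q_def a)
      also have "\<dots> = (\<Sum>y\<in>coset_reps m. \<Sum>b<d \<sigma>.
          ?c * (\<rho> y $$ (i, emb m \<rho> \<sigma> b) * \<rho>' (inv_into UNIV y) $$ (emb m \<rho>' \<sigma> b, j)))"
        by (rule sum.cartesian_product[symmetric])
      finally show ?thesis by (simp only: sum_distrib_left)
    qed
    ultimately show "(\<Sum>b\<in>?B. P a b * Q b a') = (if a = a' then 1 else 0)" by simp
  qed (use U finite_coset_reps in auto)
  then show ?thesis using U(1) by (simp add: card_cartesian_product card_coset_reps card_SigmaI)
qed

end

section \<open>One induction step of the transform\<close>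

context branching
begin

lemma finite_ups: "\<sigma> \<in> R m \<Longrightarrow> finite (ups m \<sigma>)"
proof -
  assume s: "\<sigma> \<in> R m"
  have "card U \<le> 2 * Suc m * d \<sigma>" if U: "U \<subseteq> ups m \<sigma>" "finite U" for U
  proof -
    have "card U \<le> (\<Sum>\<rho>\<in>U. d \<rho>)"
      using sum_mono[of U "\<lambda>_. 1 :: nat" d] d_pos[of _ "Suc m"] U by (auto simp: ups_def Suc_le_eq)
    also have "\<dots> \<le> 2 * Suc m * d \<sigma>" by (rule sum_d_ups[OF s U(2,1)])
    finally show ?thesis .
  qed
  then show ?thesis using finite_if_finite_subsets_card_bdd[of "ups m \<sigma>"] by blast
qed

text \<open>The bound by interlacing is applied once for each sign, and each application admits one
  extra box.\<close>

lemma card_ups: 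
  assumes s: "\<sigma> \<in> R m"
  shows "card (ups m \<sigma>) \<le> downs m \<sigma> + 2"
proof -
  let ?W = "wt m \<sigma> ` ups m \<sigma>"
  have fin: "finite ?W" using finite_ups[OF s] by simp
  have "inj_on (wt m \<sigma>) (ups m \<sigma>)"
    by (rule inj_onI) (auto simp: ups_def intro: up_unique_wt)
  then have "card (ups m \<sigma>) = card ?W" by (simp add: card_image)
  also have "\<dots> = card {w \<in> ?W. fst w = 1} + card {w \<in> ?W. fst w = - 1}"
    by (rule sgn_split[OF _ fin]) (use sgn_of_cases in \<open>fastforce simp: ups_def wt_def down_def\<close>)
  also have "\<dots> \<le> Suc (card {w \<in> down_wts m \<sigma>. fst w = 1}) + Suc (card {w \<in> down_wts m \<sigma>. fst w = - 1})"
    by (intro add_mono up_wts_bound[OF s]) (use fin in auto)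
  also have "card {w \<in> down_wts m \<sigma>. fst w = 1} + card {w \<in> down_wts m \<sigma>. fst w = - 1} = downs m \<sigma>"
    unfolding downs_def by (rule down_wts_sgn_split[OF s, symmetric])
  then have "Suc (card {w \<in> down_wts m \<sigma>. fst w = 1}) + Suc (card {w \<in> down_wts m \<sigma>. fst w = - 1}) =
      downs m \<sigma> + 2" by simp
  finally show ?thesis .
qed

text \<open>Row \<open>i\<close> of a column of the transform on level \<open>m + 1\<close>, where
  \<open>v y b\<close> is row \<open>b\<close> of the matching column for the coset of
  \<open>y\<close>, and \<open>x\<close> is the input of the program. The family \<open>v\<close> is
  left arbitrary so that the recursion can be applied to rearranged data.\<close>

definition out :: "nat \<Rightarrow> rep \<Rightarrow> rep \<Rightarrow> ((int \<Rightarrow> int) \<Rightarrow> nat \<Rightarrow> 'x \<Rightarrow> complex) \<Rightarrow> nat \<Rightarrow> 'x \<Rightarrow> complex" where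
  "out m \<sigma> \<rho> v i x = (\<Sum>y\<in>coset_reps m. \<Sum>b<d \<sigma>. \<rho> y $$ (i, emb m \<rho> \<sigma> b) * v y b x)"

lemma sum_emb:
  assumes s: "\<sigma> \<in> R (Suc m)"
  shows "(\<Sum>b<d \<sigma>. F b) = (\<Sum>\<mu>\<in>down m \<sigma>. \<Sum>c<d \<mu>. F (emb m \<sigma> \<mu> c))"
proof -
  have "(\<Sum>b<d \<sigma>. F b) = (\<Sum>b<d \<sigma>. F (emb m \<sigma> (kid m \<sigma> b) (loc m \<sigma> b)))"
    using emb_kid_loc[OF s] by (intro sum.cong) auto
  also have "\<dots> = (\<Sum>\<mu>\<in>down m \<sigma>. \<Sum>c<d \<mu>. F (emb m \<sigma> \<mu> c))" by (rule sum_kids[OF s])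
  finally show ?thesis .
qed

lemma out_id:
  assumes r: "\<rho> \<in> R (Suc m)" and s: "\<sigma> \<in> down m \<rho>" and i: "i < d \<rho>"
  shows "(\<Sum>b<d \<sigma>. \<rho> id $$ (i, emb m \<rho> \<sigma> b) * w b) = (if kid m \<rho> i = \<sigma> then w (loc m \<rho> i) else 0)"
proof -
  note E = emb[OF r s]
  have "(\<Sum>b<d \<sigma>. \<rho> id $$ (i, emb m \<rho> \<sigma> b) * w b) =
      (\<Sum>b<d \<sigma>. if b = loc m \<rho> i then (if kid m \<rho> i = \<sigma> then w b else 0) else 0)"
  proof (rule sum.cong[OF refl])
    fix b assume "b \<in> {..<d \<sigma>}"
    then have b: "b < d \<sigma>" by simp
    have "i = emb m \<rho> \<sigma> b \<longleftrightarrow> kid m \<rho> i = \<sigma> \<and> b = loc m \<rho> i"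
      using E[OF b] emb_kid_loc[OF r i] by auto
    then show "\<rho> id $$ (i, emb m \<rho> \<sigma> b) * w b = (if b = loc m \<rho> i then (if kid m \<rho> i = \<sigma> then w b else 0) else 0)"
      using id_index[OF r i E(1)[OF b]] by auto
  qed
  also have "\<dots> = (if kid m \<rho> i = \<sigma> then w (loc m \<rho> i) else 0)"
    using block_bounds(2)[OF r i] by auto
  finally show ?thesis .
qed

lemma out_flip:
  assumes r: "\<rho> \<in> R (Suc m)" and s: "\<sigma> \<in> down m \<rho>" and i: "i < d \<rho>"
  shows "(\<Sum>b<d \<sigma>. \<rho> (flip (hi m)) $$ (i, emb m \<rho> \<sigma> b) * w b) =
    (if kid m \<rho> i = \<sigma> then sgn_of m \<sigma> \<rho> * w (loc m \<rho> i) else 0)"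
proof -
  have "(\<Sum>b<d \<sigma>. \<rho> (flip (hi m)) $$ (i, emb m \<rho> \<sigma> b) * w b) =
      (\<Sum>b<d \<sigma>. sgn_of m (kid m \<rho> i) \<rho> * (\<rho> id $$ (i, emb m \<rho> \<sigma> b) * w b))"
    by (rule sum.cong[OF refl]) (use flip_index[OF r i emb(1)[OF r s]] id_index[OF r i emb(1)[OF r s]] in auto)
  then show ?thesis using out_id[OF r s i, of w] by (simp flip: sum_distrib_left)
qed

lemma out_0:
  assumes r: "\<rho> \<in> ups 0 \<sigma>" and i: "i < d \<rho>"
  shows "kid 0 \<rho> i = \<sigma>"
    "out 0 \<sigma> \<rho> v i x = v id (loc 0 \<rho> i) x + sgn_of 0 \<sigma> \<rho> * v (flip (hi 0)) (loc 0 \<rho> i) x"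
proof -
  have r': "\<rho> \<in> R (Suc 0)" "\<sigma> \<in> down 0 \<rho>" using r by (auto simp: ups_def)
  show k: "kid 0 \<rho> i = \<sigma>"
    using R_0_unique block_bounds(3)[OF r'(1) i] down_subset[OF r'] by blast
  have "id \<noteq> flip 1" by (auto simp: fun_eq_iff flip_apply intro!: exI[of _ 1])
  then show "out 0 \<sigma> \<rho> v i x = v id (loc 0 \<rho> i) x + sgn_of 0 \<sigma> \<rho> * v (flip (hi 0)) (loc 0 \<rho> i) x"
    using out_id[OF r' i, of "\<lambda>b. v id b x"] out_flip[OF r' i, of "\<lambda>b. v (flip (hi 0)) b x"] k
    by (simp add: out_def)
qed

text \<open>In \<open>z \<circ> adj m\<close>, the factor \<open>adj m\<close> maps the part
  \<open>\<mu>\<close> of \<open>\<sigma>\<close> to the part \<open>\<mu>\<close> of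
  \<open>\<nu>\<close> by a scalar, see \<open>adj_index\<close>, and \<open>z\<close> then acts
  within \<open>\<nu>\<close>. The sum over \<open>z\<close> is therefore an output of the stage
  below, with \<open>\<mu>\<close> in place of \<open>\<sigma>\<close> and \<open>\<nu>\<close> in
  place of \<open>\<rho>\<close>.\<close>

lemma out_Suc:
  fixes v :: "(int \<Rightarrow> int) \<Rightarrow> nat \<Rightarrow> 'x \<Rightarrow> complex"
  assumes r: "\<rho> \<in> ups (Suc m) \<sigma>" and i: "i < d \<rho>"
  defines "\<nu> \<equiv> kid (Suc m) \<rho> i" and "a \<equiv> loc (Suc m) \<rho> i"
  shows "out (Suc m) \<sigma> \<rho> v i x =
    (if \<nu> = \<sigma> then v id a x + sgn_of (Suc m) \<sigma> \<rho> * v (flip (hi (Suc m))) a x else 0) +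
    (\<Sum>\<mu>\<in>down m \<sigma> \<inter> down m \<nu>. adj_coeff m \<rho> \<nu> \<sigma> \<mu> *
      out m \<mu> \<nu> (\<lambda>z c. v (z \<circ> adj m) (emb m \<sigma> \<mu> c)) a x)"
proof -
  have r': "\<rho> \<in> R (Suc (Suc m))" and s: "\<sigma> \<in> down (Suc m) \<rho>" using r by (auto simp: ups_def)
  have sR: "\<sigma> \<in> R (Suc m)" using down_subset[OF r' s] .
  have n: "\<nu> \<in> down (Suc m) \<rho>" "\<nu> \<in> R (Suc m)" "a < d \<nu>" "emb (Suc m) \<rho> \<nu> a = i"
    using kid_down[OF r' i] block_bounds(2,3)[OF r' i] emb_kid_loc[OF r' i] by (auto simp: \<nu>_def a_def)
  have main: "(\<Sum>b<d \<sigma>. \<rho> (z \<circ> adj m) $$ (i, emb (Suc m) \<rho> \<sigma> b) * w b) =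
      (\<Sum>\<mu>\<in>down m \<sigma> \<inter> down m \<nu>. adj_coeff m \<rho> \<nu> \<sigma> \<mu> *
        (\<Sum>c<d \<mu>. \<nu> z $$ (a, emb m \<nu> \<mu> c) * w (emb m \<sigma> \<mu> c)))"
    if z: "z \<in> signed_perms (Suc m)" for z w
  proof -
    have z2: "z \<in> signed_perms (Suc (Suc m))" using z signed_perms_mono[of "Suc m" "Suc (Suc m)"] by auto
    have col: "\<rho> (z \<circ> adj m) $$ (i, emb (Suc m) \<rho> \<sigma> (emb m \<sigma> \<mu> c)) =
        (if \<mu> \<in> down m \<nu> then \<nu> z $$ (a, emb m \<nu> \<mu> c) * adj_coeff m \<rho> \<nu> \<sigma> \<mu> else 0)"
      if mu: "\<mu> \<in> down m \<sigma>" and c: "c < d \<mu>" for \<mu> c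
    proof -
      note b = emb[OF sR mu c]
      note j = emb[OF r' s b(1)]
      have j2: "kid2 m \<rho> (emb (Suc m) \<rho> \<sigma> (emb m \<sigma> \<mu> c)) = \<mu>" "loc2 m \<rho> (emb (Suc m) \<rho> \<sigma> (emb m \<sigma> \<mu> c)) = c"
        using b j by (simp_all add: kid2_def loc2_def)
      have "\<rho> (z \<circ> adj m) $$ (i, emb (Suc m) \<rho> \<sigma> (emb m \<sigma> \<mu> c)) =
          (\<Sum>k<d \<rho>. \<rho> z $$ (emb (Suc m) \<rho> \<nu> a, k) * \<rho> (adj m) $$ (k, emb (Suc m) \<rho> \<sigma> (emb m \<sigma> \<mu> c)))"
        unfolding n(4) by (rule mult_index[OF r' z2 adj_in i j(1)])
      also have "\<dots> = (\<Sum>p<d \<nu>. \<nu> z $$ (a, p) *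
          \<rho> (adj m) $$ (emb (Suc m) \<rho> \<nu> p, emb (Suc m) \<rho> \<sigma> (emb m \<sigma> \<mu> c)))"
        by (rule sum_restrict_left[OF r' n(1) z n(3)])
      also have "\<dots> = (\<Sum>p<d \<nu>. if kid m \<nu> p = \<mu> then
          (if loc m \<nu> p = c then \<nu> z $$ (a, p) * adj_coeff m \<rho> \<nu> \<sigma> \<mu> else 0) else 0)"
      proof (rule sum.cong[OF refl])
        fix p assume "p \<in> {..<d \<nu>}"
        then have p: "p < d \<nu>" by simp
        note k = emb[OF r' n(1) p]
        show "\<nu> z $$ (a, p) * \<rho> (adj m) $$ (emb (Suc m) \<rho> \<nu> p, emb (Suc m) \<rho> \<sigma> (emb m \<sigma> \<mu> c)) =
          (if kid m \<nu> p = \<mu> then (if loc m \<nu> p = c then \<nu> z $$ (a, p) * adj_coeff m \<rho> \<nu> \<sigma> \<mu> else 0) else 0)"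
          unfolding adj_index[OF r' k(1) j(1)] j2 using k(2,3) j(2) by (auto simp: kid2_def loc2_def)
      qed
      also have "\<dots> = (if \<mu> \<in> down m \<nu> then \<nu> z $$ (a, emb m \<nu> \<mu> c) * adj_coeff m \<rho> \<nu> \<sigma> \<mu> else 0)"
      proof (cases "\<mu> \<in> down m \<nu>")
        case True
        have "(\<Sum>p<d \<nu>. if kid m \<nu> p = \<mu> then
          (if loc m \<nu> p = c then \<nu> z $$ (a, p) * adj_coeff m \<rho> \<nu> \<sigma> \<mu> else 0) else 0) =
          (\<Sum>e<d \<mu>. if loc m \<nu> (emb m \<nu> \<mu> e) = c then \<nu> z $$ (a, emb m \<nu> \<mu> e) * adj_coeff m \<rho> \<nu> \<sigma> \<mu> else 0)"
          by (rule sum_one_kid[OF n(2) True])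
        also have "\<dots> = (\<Sum>e<d \<mu>. if e = c then \<nu> z $$ (a, emb m \<nu> \<mu> e) * adj_coeff m \<rho> \<nu> \<sigma> \<mu> else 0)"
          by (rule sum.cong[OF refl]) (use emb(3)[OF n(2) True] in auto)
        also have "\<dots> = \<nu> z $$ (a, emb m \<nu> \<mu> c) * adj_coeff m \<rho> \<nu> \<sigma> \<mu>" using c by simp
        finally show ?thesis using True by simp
      next
        case False
        then have "kid m \<nu> p \<noteq> \<mu>" if "p < d \<nu>" for p using kid_down[OF n(2) that] by auto
        then show ?thesis using False by simp
      qed
      finally show ?thesis .
    qed
    have "(\<Sum>b<d \<sigma>. \<rho> (z \<circ> adj m) $$ (i, emb (Suc m) \<rho> \<sigma> b) * w b) = (\<Sum>\<mu>\<in>down m \<sigma>. \<Sum>c<d \<mu>.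
        \<rho> (z \<circ> adj m) $$ (i, emb (Suc m) \<rho> \<sigma> (emb m \<sigma> \<mu> c)) * w (emb m \<sigma> \<mu> c))"
      by (rule sum_emb[OF sR])
    also have "\<dots> = (\<Sum>\<mu>\<in>down m \<sigma>. if \<mu> \<in> down m \<nu> then adj_coeff m \<rho> \<nu> \<sigma> \<mu> *
        (\<Sum>c<d \<mu>. \<nu> z $$ (a, emb m \<nu> \<mu> c) * w (emb m \<sigma> \<mu> c)) else 0)"
    proof (rule sum.cong[OF refl])
      fix \<mu> assume mu: "\<mu> \<in> down m \<sigma>"
      have "(\<Sum>c<d \<mu>. \<rho> (z \<circ> adj m) $$ (i, emb (Suc m) \<rho> \<sigma> (emb m \<sigma> \<mu> c)) * w (emb m \<sigma> \<mu> c)) =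
        (\<Sum>c<d \<mu>. (if \<mu> \<in> down m \<nu> then \<nu> z $$ (a, emb m \<nu> \<mu> c) * adj_coeff m \<rho> \<nu> \<sigma> \<mu> else 0) * w (emb m \<sigma> \<mu> c))"
        by (rule sum.cong[OF refl]) (use col[OF mu] in auto)
      then show "(\<Sum>c<d \<mu>. \<rho> (z \<circ> adj m) $$ (i, emb (Suc m) \<rho> \<sigma> (emb m \<sigma> \<mu> c)) * w (emb m \<sigma> \<mu> c)) =
        (if \<mu> \<in> down m \<nu> then adj_coeff m \<rho> \<nu> \<sigma> \<mu> *
        (\<Sum>c<d \<mu>. \<nu> z $$ (a, emb m \<nu> \<mu> c) * w (emb m \<sigma> \<mu> c)) else 0)"
        by (auto simp: sum_distrib_left algebra_simps)
    qed
    finally show ?thesis by (simp add: sum.inter_restrict)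
  qed
  have "(\<Sum>z\<in>coset_reps m. \<Sum>b<d \<sigma>. \<rho> (z \<circ> adj m) $$ (i, emb (Suc m) \<rho> \<sigma> b) * v (z \<circ> adj m) b x) =
      (\<Sum>z\<in>coset_reps m. \<Sum>\<mu>\<in>down m \<sigma> \<inter> down m \<nu>. adj_coeff m \<rho> \<nu> \<sigma> \<mu> *
        (\<Sum>c<d \<mu>. \<nu> z $$ (a, emb m \<nu> \<mu> c) * v (z \<circ> adj m) (emb m \<sigma> \<mu> c) x))"
    by (rule sum.cong[OF refl], rule main) (use coset_reps_subset in blast)
  also have "\<dots> = (\<Sum>\<mu>\<in>down m \<sigma> \<inter> down m \<nu>. adj_coeff m \<rho> \<nu> \<sigma> \<mu> *
      out m \<mu> \<nu> (\<lambda>z c. v (z \<circ> adj m) (emb m \<sigma> \<mu> c)) a x)"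
    unfolding out_def sum_distrib_left by (rule sum.swap)
  finally have Z: "(\<Sum>z\<in>coset_reps m. \<Sum>b<d \<sigma>. \<rho> (z \<circ> adj m) $$ (i, emb (Suc m) \<rho> \<sigma> b) * v (z \<circ> adj m) b x) =
      (\<Sum>\<mu>\<in>down m \<sigma> \<inter> down m \<nu>. adj_coeff m \<rho> \<nu> \<sigma> \<mu> *
      out m \<mu> \<nu> (\<lambda>z c. v (z \<circ> adj m) (emb m \<sigma> \<mu> c)) a x)" .
  show ?thesis
    unfolding out_def[of "Suc m"] sum_coset_reps_Suc Z out_id[OF r' s i] out_flip[OF r' s i]
    by (simp add: \<nu>_def a_def)
qed

text \<open>The factor \<open>2 * Suc m\<close> bounds the number of outputs per row of
  \<open>\<sigma>\<close>, see \<open>sum_d_ups\<close>; the other factor is the cost of one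
  output.\<close>

definition stage_cost :: "nat \<Rightarrow> nat" where
  "stage_cost m = 2 * Suc m * (4 * m + 1)"

lemma stage_cost_Suc: "stage_cost (Suc m) = stage_cost m + (16 * m + 18)"
  by (simp add: stage_cost_def algebra_simps)

text \<open>The stage below is run once for every constituent \<open>\<mu>\<close> of the
  restriction of \<open>\<sigma>\<close>. Their degrees add up to \<open>d \<sigma>\<close>, so this
  costs \<open>stage_cost m * d \<sigma>\<close>, and \<open>(16 * m + 18) * d \<sigma>\<close> is
  left for assembling the outputs. On level 0 every output is a sum or difference of two
  inputs.\<close>

lemma extends_stage:
  assumes "\<sigma> \<in> R m"
  shows "extends I {v y b |y b. y \<in> coset_reps m \<and> b < d \<sigma>} {out m \<sigma> \<rho> v i |\<rho> i. \<rho> \<in> ups m \<sigma> \<and> i < d \<rho>}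
    (stage_cost m * d \<sigma>) (stage_cost m * d \<sigma>)"
  using assms
proof (induction m arbitrary: \<sigma> v)
  case 0
  let ?in = "{v y b |y b. y \<in> coset_reps 0 \<and> b < d \<sigma>}"
  let ?S = "SIGMA \<rho>:ups 0 \<sigma>. {..<d \<rho>}"
  have "extends I ?in {case p of (\<rho>, i) \<Rightarrow> out 0 \<sigma> \<rho> v i} 1 0" if p: "p \<in> ?S" for p
  proof -
    obtain \<rho> i where r: "p = (\<rho>, i)" "\<rho> \<in> ups 0 \<sigma>" "i < d \<rho>" using p by auto
    have r': "\<rho> \<in> R (Suc 0)" "\<sigma> \<in> down 0 \<rho>" using r by (auto simp: ups_def)
    have l: "loc 0 \<rho> i < d \<sigma>" using block_bounds(2)[OF r'(1) r(3)] out_0(1)[OF r(2,3)] by simp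
    have eq: "out 0 \<sigma> \<rho> v i = (\<lambda>x. v id (loc 0 \<rho> i) x + sgn_of 0 \<sigma> \<rho> * v (flip (hi 0)) (loc 0 \<rho> i) x)"
      by (rule ext) (rule out_0(2)[OF r(2,3)])
    show ?thesis unfolding r(1) prod.case eq
    proof (rule extends_sign)
      show "v id (loc 0 \<rho> i) \<in> ?in" "v (flip (hi 0)) (loc 0 \<rho> i) \<in> ?in" using l by auto
      show "sgn_of 0 \<sigma> \<rho> = 1 \<or> sgn_of 0 \<sigma> \<rho> = - 1" using sgn_of_cases[OF r'(1)] r'(2) by (simp add: down_def)
    qed
  qed
  then have "extends I ?in (\<Union>p\<in>?S. {case p of (\<rho>, i) \<Rightarrow> out 0 \<sigma> \<rho> v i}) (\<Sum>p\<in>?S. 1) (\<Sum>p\<in>?S. 0)"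
    using finite_ups[OF 0] by (intro extends_UN) auto
  then show ?case
  proof (rule extends_mono)
    have "(\<Sum>p\<in>?S. 1) = (\<Sum>\<rho>\<in>ups 0 \<sigma>. d \<rho>)" using finite_ups[OF 0] by (simp add: card_SigmaI)
    also have "\<dots> \<le> 2 * Suc 0 * d \<sigma>" by (rule sum_d_ups[OF 0 finite_ups[OF 0]]) simp
    finally show "(\<Sum>p\<in>?S. 1) \<le> stage_cost 0 * d \<sigma>" by (simp add: stage_cost_def)
  qed (auto intro!: bexI[of _ "(_, _)"])
next
  case (Suc m)
  let ?in = "{v y b |y b. y \<in> coset_reps (Suc m) \<and> b < d \<sigma>}"
  let ?S = "SIGMA \<rho>:ups (Suc m) \<sigma>. {..<d \<rho>}"
  let ?v = "\<lambda>\<mu> z c. v (z \<circ> adj m) (emb m \<sigma> \<mu> c)"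
  let ?mid = "\<Union>\<mu>\<in>down m \<sigma>. {out m \<mu> \<nu> (?v \<mu>) a |\<nu> a. \<nu> \<in> ups m \<mu> \<and> a < d \<nu>}"
  define r where "r = card (down m \<sigma>)"
  have rb: "r * (r + 2) \<le> 8 * Suc m" using downs_bound[OF Suc.prems] card_down[OF Suc.prems] by (simp add: r_def)
  have ub: "card (ups (Suc m) \<sigma>) \<le> r + 2" using card_ups[OF Suc.prems] card_down[OF Suc.prems] by (simp add: r_def)
  have fin: "finite (ups (Suc m) \<sigma>)" by (rule finite_ups[OF Suc.prems])
  have "extends I ?in {out m \<mu> \<nu> (?v \<mu>) a |\<nu> a. \<nu> \<in> ups m \<mu> \<and> a < d \<nu>} (stage_cost m * d \<mu>) (stage_cost m * d \<mu>)"
    if mu: "\<mu> \<in> down m \<sigma>" for \<mu>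
  proof (rule extends_mono[OF Suc.IH[OF down_subset[OF Suc.prems mu], of "?v \<mu>"]])
    show "{?v \<mu> y b |y b. y \<in> coset_reps m \<and> b < d \<mu>} \<subseteq> ?in"
    proof clarify
      fix y b assume "y \<in> coset_reps m" "b < d \<mu>"
      then show "\<exists>y' b'. v (y \<circ> adj m) (emb m \<sigma> \<mu> b) = v y' b' \<and> y' \<in> coset_reps (Suc m) \<and> b' < d \<sigma>"
        using emb(1)[OF Suc.prems mu]
        by - (rule exI[of _ "y \<circ> adj m"], rule exI[of _ "emb m \<sigma> \<mu> b"], simp)
    qed
  qed auto
  then have "extends I ?in ?mid (\<Sum>\<mu>\<in>down m \<sigma>. stage_cost m * d \<mu>) (\<Sum>\<mu>\<in>down m \<sigma>. stage_cost m * d \<mu>)"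
    by (intro extends_UN) auto
  then have mid: "extends I ?in ?mid (stage_cost m * d \<sigma>) (stage_cost m * d \<sigma>)"
    by (simp add: d_eq_sum_down[OF Suc.prems] sum_distrib_left)
  \<comment> \<open>An output in the block \<open>\<sigma>\<close> takes one addition for the two
    sign terms, then one multiplication and one addition for each of the \<open>r\<close> terms from
    below. By \<open>common_down_unique\<close> any other output is zero or a single scaled
    value.\<close>
  let ?add = "\<lambda>(\<rho>, i). if kid (Suc m) \<rho> i = \<sigma> then r + 1 else 0"
  let ?mul = "\<lambda>(\<rho>, i). 1 + (if kid (Suc m) \<rho> i = \<sigma> then r else 0)"
  have one: "extends I (?in \<union> ?mid) {case p of (\<rho>, i) \<Rightarrow> out (Suc m) \<sigma> \<rho> v i} (?add p) (?mul p)"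
    if p: "p \<in> ?S" for p
  proof -
    obtain \<rho> i where ri: "p = (\<rho>, i)" "\<rho> \<in> ups (Suc m) \<sigma>" "i < d \<rho>" using p by auto
    have r': "\<rho> \<in> R (Suc (Suc m))" "\<sigma> \<in> down (Suc m) \<rho>" using ri by (auto simp: ups_def)
    define \<nu> where "\<nu> = kid (Suc m) \<rho> i"
    define a where "a = loc (Suc m) \<rho> i"
    have n: "\<nu> \<in> R (Suc m)" "a < d \<nu>" using block_bounds(2,3)[OF r'(1) ri(3)] by (auto simp: \<nu>_def a_def)
    have mem: "out m \<mu> \<nu> (?v \<mu>) a \<in> ?in \<union> ?mid" if "\<mu> \<in> down m \<sigma> \<inter> down m \<nu>" for \<mu>
      using that n by (auto simp: ups_def)
    have eq: "out (Suc m) \<sigma> \<rho> v i = (\<lambda>x.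
      (if \<nu> = \<sigma> then v id a x + sgn_of (Suc m) \<sigma> \<rho> * v (flip (hi (Suc m))) a x else 0) +
      (\<Sum>\<mu>\<in>down m \<sigma> \<inter> down m \<nu>. adj_coeff m \<rho> \<nu> \<sigma> \<mu> * out m \<mu> \<nu> (?v \<mu>) a x))"
      unfolding \<nu>_def a_def by (rule ext) (rule out_Suc[OF ri(2,3)])
    show ?thesis
    proof (cases "\<nu> = \<sigma>")
      case True
      let ?f = "\<lambda>x. v id a x + sgn_of (Suc m) \<sigma> \<rho> * v (flip (hi (Suc m))) a x"
      have "extends I (?in \<union> ?mid) {?f} 1 0"
      proof (rule extends_sign)
        show "v id a \<in> ?in \<union> ?mid" "v (flip (hi (Suc m))) a \<in> ?in \<union> ?mid"
          using n(2) True by (auto simp del: of_nat_Suc)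
        show "sgn_of (Suc m) \<sigma> \<rho> = 1 \<or> sgn_of (Suc m) \<sigma> \<rho> = - 1"
          using sgn_of_cases[OF r'(1)] r'(2) by (simp add: down_def)
      qed
      moreover have "extends I (?in \<union> ?mid \<union> {?f}) {\<lambda>x. ?f x +
          (\<Sum>\<mu>\<in>down m \<sigma> \<inter> down m \<nu>. adj_coeff m \<rho> \<nu> \<sigma> \<mu> * out m \<mu> \<nu> (?v \<mu>) a x)}
          (card (down m \<sigma> \<inter> down m \<nu>)) (card (down m \<sigma> \<inter> down m \<nu>))"
        by (rule extends_linear_combination) (use mem in auto)
      ultimately have "extends I (?in \<union> ?mid) ({?f} \<union> {\<lambda>x. ?f x +
          (\<Sum>\<mu>\<in>down m \<sigma> \<inter> down m \<nu>. adj_coeff m \<rho> \<nu> \<sigma> \<mu> * out m \<mu> \<nu> (?v \<mu>) a x)})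
          (1 + card (down m \<sigma> \<inter> down m \<nu>)) (0 + card (down m \<sigma> \<inter> down m \<nu>))"
        by (rule extends_trans)
      then show ?thesis
        by (rule extends_mono) (use True in \<open>auto simp: ri(1) eq r_def \<nu>_def[symmetric]\<close>)
    next
      case False
      have sub: "\<mu> = \<mu>'" if "\<mu> \<in> down m \<sigma> \<inter> down m \<nu>" "\<mu>' \<in> down m \<sigma> \<inter> down m \<nu>" for \<mu> \<mu>'
        using common_down_unique[OF Suc.prems n(1), of \<mu> \<mu>'] False that by auto
      have "extends I (?in \<union> ?mid) {out (Suc m) \<sigma> \<rho> v i} 0 1"
      proof (cases "down m \<sigma> \<inter> down m \<nu> = {}")
        case True
        then have z: "out (Suc m) \<sigma> \<rho> v i = (\<lambda>x. 0)" unfolding eq using False by simp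
        show ?thesis unfolding z by (rule extends_mono[OF extends_const]) auto
      next
        case ne: False
        then obtain \<mu> where mu: "\<mu> \<in> down m \<sigma> \<inter> down m \<nu>" by blast
        then have "down m \<sigma> \<inter> down m \<nu> = {\<mu>}" using sub by blast
        then have "out (Suc m) \<sigma> \<rho> v i = (\<lambda>x. adj_coeff m \<rho> \<nu> \<sigma> \<mu> * out m \<mu> \<nu> (?v \<mu>) a x)"
          unfolding eq using False by simp
        then show ?thesis using extends_scale[OF mem[OF mu]] by simp
      qed
      then show ?thesis using False by (simp add: ri(1) \<nu>_def)
    qed
  qed
  have "extends I (?in \<union> ?mid) (\<Union>p\<in>?S. {case p of (\<rho>, i) \<Rightarrow> out (Suc m) \<sigma> \<rho> v i})
      (\<Sum>p\<in>?S. ?add p) (\<Sum>p\<in>?S. ?mul p)"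
    using fin one by (intro extends_UN) auto
  from extends_trans[OF mid this]
  show ?case
  proof (rule extends_mono)
    have cnt: "(\<Sum>i<d \<rho>. if kid (Suc m) \<rho> i = \<sigma> then c else 0) = d \<sigma> * c" if "\<rho> \<in> ups (Suc m) \<sigma>" for \<rho> and c :: nat
      using sum_one_kid[of \<rho> "Suc m" \<sigma> "\<lambda>_. c"] that by (simp add: ups_def)
    have const: "(\<Sum>\<rho>\<in>ups (Suc m) \<sigma>. c) \<le> (r + 2) * c" for c :: nat
      using mult_le_mono1[OF ub, of c] by (simp only: sum_constant of_nat_id)
    have "(\<Sum>p\<in>?S. ?add p) = (\<Sum>\<rho>\<in>ups (Suc m) \<sigma>. d \<sigma> * (r + 1))"
      using fin cnt by (subst sum.Sigma[symmetric]) auto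
    also have "\<dots> \<le> (r + 2) * (d \<sigma> * (r + 1))" by (rule const)
    also have "\<dots> \<le> (16 * m + 18) * d \<sigma>"
    proof -
      have "r \<le> r * (r + 2)" by simp
      \<comment> \<open>The product is \<open>r * (r + 2) + r + 2\<close>, and both
        \<open>r * (r + 2)\<close> and \<open>r\<close> are at most \<open>8 * Suc m\<close>. This
        is where the increment \<open>16 * m + 18\<close> comes from.\<close>
      then have "(r + 2) * (r + 1) \<le> 16 * m + 18" using rb by (simp add: algebra_simps)
      from mult_le_mono1[OF this, of "d \<sigma>"] show ?thesis by (simp only: mult_ac)
    qed
    finally show "stage_cost m * d \<sigma> + (\<Sum>p\<in>?S. ?add p) \<le> stage_cost (Suc m) * d \<sigma>"
      by (simp only: stage_cost_Suc add_mult_distrib add_le_cancel_left)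
    have "(\<Sum>i<d \<rho>. 1 + (if kid (Suc m) \<rho> i = \<sigma> then r else 0)) = d \<rho> + d \<sigma> * r"
      if "\<rho> \<in> ups (Suc m) \<sigma>" for \<rho>
      unfolding sum.distrib cnt[OF that] by simp
    then have "(\<Sum>p\<in>?S. ?mul p) = (\<Sum>\<rho>\<in>ups (Suc m) \<sigma>. d \<rho> + d \<sigma> * r)"
      using fin by (subst sum.Sigma[symmetric]) (auto intro!: sum.cong)
    also have "\<dots> \<le> 2 * Suc (Suc m) * d \<sigma> + (r + 2) * (d \<sigma> * r)"
      unfolding sum.distrib by (intro add_mono sum_d_ups[OF Suc.prems fin] const) simp
    also have "\<dots> \<le> (16 * m + 18) * d \<sigma>"
    proof -
      have "2 * Suc (Suc m) + (r + 2) * r \<le> 16 * m + 18" using rb by (simp add: algebra_simps)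
      from mult_le_mono1[OF this, of "d \<sigma>"] show ?thesis
        by (simp only: mult_ac add_mult_distrib add_mult_distrib2)
    qed
    finally show "stage_cost m * d \<sigma> + (\<Sum>p\<in>?S. ?mul p) \<le> stage_cost (Suc m) * d \<sigma>"
      by (simp only: stage_cost_Suc add_mult_distrib add_le_cancel_left)
  qed (auto intro!: bexI[of _ "(_, _)"])
qed

end

section \<open>The complete transform\<close>

lemma diag_block_mat_concat:
  "diag_block_mat (map (\<lambda>\<sigma>. \<sigma> h) (concat \<sigma>ss)) = diag_block_mat (map (\<lambda>\<sigma>s. diag_block_mat (map (\<lambda>\<sigma>. \<sigma> h) \<sigma>s)) \<sigma>ss)"
  by (induction \<sigma>ss) (simp_all add: diag_block_mat_append Let_def)

text \<open>The levels are chosen recursively, each set adapted to the one already chosen below it,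
  so that restrictions match as matrices through the entire chain.\<close>

lemma ex_branching: "\<exists>R kids. branching R kids"
proof -
  let ?next = "\<lambda>m RH R'. complete_irreps (weyl_B (Suc m)) R' \<and>
    (\<forall>\<rho>\<in>R'. \<exists>\<sigma>s. set \<sigma>s \<subseteq> RH \<and> restricts_to (signed_perms m) \<rho> \<sigma>s)"
  define R where "R = rec_nat (SOME R. complete_irreps (weyl_B 0) R) (\<lambda>m RH. SOME R'. ?next m RH R')"
  have R0: "R 0 = (SOME R. complete_irreps (weyl_B 0) R)"
    and RSuc: "R (Suc m) = (SOME R'. ?next m (R m) R')" for m by (simp_all add: R_def)
  have step: "?next m (R m) (R (Suc m))" if "complete_irreps (weyl_B m) (R m)" for m
    unfolding RSuc
  proof (rule someI_ex)
    have "subgroup (signed_perms m) (weyl_B (Suc m))"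
      using subgroup_weyl_B[of m "Suc m"] by (simp add: carrier_weyl_B)
    moreover have "weyl_B (Suc m)\<lparr>carrier := signed_perms m\<rparr> = weyl_B m" by (rule weyl_B_restrict)
    ultimately show "\<exists>R'. ?next m (R m) R'"
      using finite_group.ex_adapted_irreps[OF finite_group_weyl_B, of "signed_perms m" "Suc m" "R m"] that
      by simp
  qed
  have complete: "complete_irreps (weyl_B m) (R m)" for m
  proof (induction m)
    case 0
    show ?case unfolding R0
      by (rule someI_ex) (rule finite_group.ex_complete_irreps[OF finite_group_weyl_B])
  next
    case (Suc m)
    then show ?case using step[of m] by blast
  qed
  define kids where "kids m \<rho> = (SOME \<sigma>s. set \<sigma>s \<subseteq> R m \<and> restricts_to (signed_perms m) \<rho> \<sigma>s)" for m \<rho>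
  have kids: "set (kids m \<rho>) \<subseteq> R m \<and> restricts_to (signed_perms m) \<rho> (kids m \<rho>)" if "\<rho> \<in> R (Suc m)" for m \<rho>
    unfolding kids_def by (rule someI_ex) (use step[OF complete] that in blast)
  have "branching R kids" by unfold_locales (use complete kids in auto)
  then show ?thesis by blast
qed

context branching
begin

text \<open>Restricting level by level refines each diagonal block in turn; concatenating the lists
  of blocks gives the decomposition over the smaller group in one step.\<close>

lemma adapted:
  assumes "m \<le> n"
  shows "adapted_irreps (weyl_B n) (carrier (weyl_B m)) (R n)"
proof -
  have "\<exists>\<sigma>s. set \<sigma>s \<subseteq> R m \<and> restricts_to (signed_perms m) \<rho> \<sigma>s" if "\<rho> \<in> R n" for \<rho>
    using assms that
  proof (induction n arbitrary: \<rho> rule: dec_induct)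
    case base
    then show ?case by (intro exI[of _ "[\<rho>]"]) (simp add: restricts_to_def del: diag_block_mat.simps)
  next
    case (step n)
    define s where "s \<sigma> = (SOME \<sigma>s. set \<sigma>s \<subseteq> R m \<and> restricts_to (signed_perms m) \<sigma> \<sigma>s)" for \<sigma>
    have s: "set (s \<sigma>) \<subseteq> R m \<and> restricts_to (signed_perms m) \<sigma> (s \<sigma>)" if "\<sigma> \<in> R n" for \<sigma>
      unfolding s_def by (rule someI_ex) (use step.IH[OF that] in blast)
    let ?\<sigma>s = "concat (map s (kids n \<rho>))"
    have "set ?\<sigma>s \<subseteq> R m" using s kids_subset[OF step.prems] by fastforce
    moreover have "\<rho> h = diag_block_mat (map (\<lambda>\<sigma>. \<sigma> h) ?\<sigma>s)" if h: "h \<in> signed_perms m" for h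
    proof -
      have "h \<in> signed_perms n" using h signed_perms_mono[of m n] step.hyps by auto
      then have "\<rho> h = diag_block_mat (map (\<lambda>\<sigma>. \<sigma> h) (kids n \<rho>))"
        using kids_restrict[OF step.prems] by (simp add: restricts_to_def)
      also have "map (\<lambda>\<sigma>. \<sigma> h) (kids n \<rho>) = map (\<lambda>\<sigma>s. diag_block_mat (map (\<lambda>\<sigma>. \<sigma> h) \<sigma>s)) (map s (kids n \<rho>))"
        using s kids_subset[OF step.prems] h by (auto simp: restricts_to_def)
      finally show ?thesis unfolding diag_block_mat_concat .
    qed
    ultimately show ?case unfolding restricts_to_def by blast
  qed
  moreover have "weyl_B n\<lparr>carrier := signed_perms m\<rparr> = weyl_B m" by (rule weyl_B_restrict)
  ultimately show ?thesis
    unfolding adapted_irreps_def restricts_to_def carrier_weyl_B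
    using complete by (intro conjI exI[of _ "R m"]) auto
qed

section \<open>Columns that survive for right invariant functions; \<open>k\<close> is here the
  level of the small group\<close>

definition trivial :: "nat \<Rightarrow> rep \<Rightarrow> bool" where
  "trivial m \<sigma> \<longleftrightarrow> d \<sigma> = 1 \<and> (\<forall>h\<in>signed_perms m. \<sigma> h $$ (0, 0) = 1)"

lemma trivial_unique:
  assumes "\<sigma> \<in> R m" "\<sigma>' \<in> R m" "trivial m \<sigma>" "trivial m \<sigma>'"
  shows "\<sigma> = \<sigma>'"
proof (rule ccontr)
  assume ne: "\<sigma> \<noteq> \<sigma>'"
  have "inv\<^bsub>weyl_B m\<^esub> g \<in> signed_perms m" if "g \<in> signed_perms m" for g
    using signed_perms_inv[OF that] weyl_B_inv[OF that] by simp
  then have "(\<Sum>g\<in>signed_perms m. \<sigma> g $$ (0, 0) * \<sigma>' (inv\<^bsub>weyl_B m\<^esub> g) $$ (0, 0)) = of_nat (card (signed_perms m))"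
    using assms(3,4) by (simp add: trivial_def)
  moreover have "card (signed_perms m) \<noteq> 0"
    using finite_signed_perms signed_perms_id by (metis card_eq_0_iff empty_iff)
  ultimately show False
    using orthogonality[OF assms(1,2), of 0 0 0 0] ne d_pos assms(1,2) by simp
qed

text \<open>The sum over the group is central, hence a scalar \<open>c\<close>, and multiplication
  by any \<open>\<sigma> g\<close> leaves it unchanged. If \<open>c\<close> were nonzero, every
  \<open>\<sigma> g\<close> would be the identity, and irreducibility would leave only degree
  1.\<close>

lemma sum_nontrivial:
  assumes s: "\<sigma> \<in> R m" and ab: "a < d \<sigma>" "b < d \<sigma>" and nt: "\<not> trivial m \<sigma>"
  shows "(\<Sum>h\<in>signed_perms m. \<sigma> h $$ (a, b)) = 0"
proof -
  define c where "c = (\<Sum>h\<in>signed_perms m. \<sigma> h $$ (0, 0))"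
  have conj: "\<exists>h'\<in>signed_perms m. g \<circ> h = h' \<circ> g" if g: "g \<in> signed_perms m" and h: "h \<in> signed_perms m" for g h
  proof (rule bexI)
    have "inv_into UNIV g \<circ> g = id" using signed_permsD(2)[OF g] by simp
    then show "g \<circ> h = (g \<circ> h \<circ> inv_into UNIV g) \<circ> g" by (simp add: comp_assoc)
    show "g \<circ> h \<circ> inv_into UNIV g \<in> signed_perms m" using g h by (intro signed_perms_comp signed_perms_inv)
  qed
  have sum: "(\<Sum>h\<in>signed_perms m. \<sigma> h $$ (i, j)) = (if i = j then c else 0)" if "i < d \<sigma>" "j < d \<sigma>" for i j
    unfolding c_def by (rule central_sum[OF s subset_refl conj that])
  have "c = 0"
  proof (rule ccontr)
    assume c: "c \<noteq> 0"
    have "\<sigma> g $$ (i, j) = (if i = j then 1 else 0)" if g: "g \<in> signed_perms m" and ij: "i < d \<sigma>" "j < d \<sigma>" for g i j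
    proof -
      have "bij_betw ((\<circ>) g) (signed_perms m) (signed_perms m)"
      proof (rule bij_betw_byWitness[where f' = "(\<circ>) (inv_into UNIV g)"])
        have "inv_into UNIV g \<circ> g = id" "g \<circ> inv_into UNIV g = id"
          using signed_permsD(1,2)[OF g] by (simp_all add: bij_is_surj flip: surj_iff)
        then show "\<forall>h\<in>signed_perms m. inv_into UNIV g \<circ> (g \<circ> h) = h" "\<forall>h\<in>signed_perms m. g \<circ> (inv_into UNIV g \<circ> h) = h"
          by (simp_all add: comp_assoc[symmetric])
      qed (use g signed_perms_inv[OF g] signed_perms_comp in auto)
      from sum.reindex_bij_betw[OF this, of "\<lambda>h. \<sigma> h $$ (i, j)"]
      have "(\<Sum>h\<in>signed_perms m. \<sigma> h $$ (i, j)) = (\<Sum>h\<in>signed_perms m. \<sigma> (g \<circ> h) $$ (i, j))" by simp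
      also have "\<dots> = (\<Sum>k<d \<sigma>. \<sigma> g $$ (i, k) * (\<Sum>h\<in>signed_perms m. \<sigma> h $$ (k, j)))"
        unfolding sum_distrib_left by (subst sum.swap) (use mult_index[OF s g _ ij] in \<open>auto intro!: sum.cong\<close>)
      also have "\<dots> = (\<Sum>k<d \<sigma>. \<sigma> g $$ (i, k) * (if k = j then c else 0))"
        by (intro sum.cong refl) (use sum ij in simp)
      also have "\<dots> = \<sigma> g $$ (i, j) * c" by (rule sum_diagonal(1)[OF ij(2)])
      finally show ?thesis using sum[OF ij] c by (auto split: if_splits)
    qed
    moreover from this have "d \<sigma> = 1"
      using coefficient_nonzero[OF s, of 0 1] d_pos[OF s] by (cases "1 < d \<sigma>") auto
    ultimately show False using nt by (simp add: trivial_def)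
  qed
  then show ?thesis using sum[OF ab] by simp
qed

lemma finite_R: "finite (R m)"
proof (induction m)
  case 0
  have "R 0 \<subseteq> {SOME \<sigma>. \<sigma> \<in> R 0}" using R_0_unique by (metis insertCI someI subsetI)
  then show ?case using finite_subset by blast
next
  case (Suc m)
  have "R (Suc m) \<subseteq> (\<Union>\<sigma>\<in>R m. ups m \<sigma>)"
  proof
    fix \<rho> assume r: "\<rho> \<in> R (Suc m)"
    then show "\<rho> \<in> (\<Union>\<sigma>\<in>R m. ups m \<sigma>)"
      using kid_down[OF r d_pos[OF r]] block_bounds(3)[OF r d_pos[OF r]] by (auto simp: ups_def)
  qed
  then show ?case using Suc finite_ups by (meson finite_UN_I finite_subset)
qed

text \<open>The columns of \<open>\<rho>\<close> that are fixed by \<open>B\<^sub>k\<close>; \<open>\<rho>\<close> is a representation of \<open>B\<^sub>k\<^sub>+\<^sub>j\<close>.\<close>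

primrec live :: "nat \<Rightarrow> nat \<Rightarrow> rep \<Rightarrow> nat set" where
  "live k 0 \<sigma> = (if trivial k \<sigma> then {0} else {})"
| "live k (Suc j) \<rho> = {i. i < d \<rho> \<and> loc (k + j) \<rho> i \<in> live k j (kid (k + j) \<rho> i)}"

lemma live_subset: "live k j \<rho> \<subseteq> {..<d \<rho>}"
  by (cases j) (auto simp: trivial_def)

lemma finite_live [simp]: "finite (live k j \<rho>)"
  by (rule finite_subset[OF live_subset]) simp

lemma card_live_Suc:
  assumes r: "\<rho> \<in> R (Suc (k + j))"
  shows "card (live k (Suc j) \<rho>) = (\<Sum>\<sigma>\<in>down (k + j) \<rho>. card (live k j \<sigma>))"
proof -
  have "card (live k (Suc j) \<rho>) = (\<Sum>i<d \<rho>. if loc (k + j) \<rho> i \<in> live k j (kid (k + j) \<rho> i) then 1 else 0)"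
    by (simp add: sum.If_cases Collect_conj_eq lessThan_def)
  also have "\<dots> = (\<Sum>\<sigma>\<in>down (k + j) \<rho>. \<Sum>b<d \<sigma>. if b \<in> live k j \<sigma> then 1 else 0)" by (rule sum_kids[OF r])
  also have "\<dots> = (\<Sum>\<sigma>\<in>down (k + j) \<rho>. card (live k j \<sigma>))"
  proof (rule sum.cong[OF refl])
    fix \<sigma>
    have "{..<d \<sigma>} \<inter> {b. b \<in> live k j \<sigma>} = live k j \<sigma>" using live_subset by blast
    then show "(\<Sum>b<d \<sigma>. if b \<in> live k j \<sigma> then 1 else 0) = card (live k j \<sigma>)"
      by (simp add: sum.If_cases)
  qed
  finally show ?thesis .
qed

text \<open>The group index \<open>|B_{k+j}| / |B_k|\<close>, computed along the chain.\<close>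

primrec index :: "nat \<Rightarrow> nat \<Rightarrow> nat" where
  "index k 0 = 1"
| "index k (Suc j) = 2 * Suc (k + j) * index k j"

lemma index_eq: "card (signed_perms (k + j)) = index k j * card (signed_perms k)"
  by (induction j) (simp_all add: card_signed_perms_Suc algebra_simps)

text \<open>This counts the transform entries in live columns. A live column of
  \<open>\<rho>\<close> lies over a live column of one constituent \<open>\<sigma>\<close>, so the
  count becomes a sum over pairs of \<open>\<sigma>\<close> and \<open>\<rho>\<close>, and
  \<open>sum_d_ups\<close> supplies the factor \<open>2 * Suc (k + j)\<close>. At the base only the
  trivial representation contributes.\<close>

lemma sum_live: "(\<Sum>\<sigma>\<in>R (k + j). d \<sigma> * card (live k j \<sigma>)) \<le> index k j"
proof (induction j)
  case 0
  have "(\<Sum>\<sigma>\<in>R k. d \<sigma> * card (live k 0 \<sigma>)) = (\<Sum>\<sigma>\<in>R k. if trivial k \<sigma> then 1 else 0)"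
    by (intro sum.cong refl) (simp add: trivial_def)
  also have "\<dots> = card {\<sigma> \<in> R k. trivial k \<sigma>}"
    using finite_R by (simp add: sum.If_cases Int_def)
  also have "\<dots> \<le> 1"
    using trivial_unique[of _ k] finite_R by (intro card_le_Suc0_iff_eq[THEN iffD2, folded One_nat_def]) auto
  finally show ?case by simp
next
  case (Suc j)
  let ?c = "\<lambda>\<sigma>. card (live k j \<sigma>)"
  have "(\<Sum>\<rho>\<in>R (k + Suc j). d \<rho> * card (live k (Suc j) \<rho>)) =
      (\<Sum>\<rho>\<in>R (Suc (k + j)). \<Sum>\<sigma>\<in>down (k + j) \<rho>. d \<rho> * ?c \<sigma>)"
    using card_live_Suc by (simp add: sum_distrib_left del: live.simps)
  also have "\<dots> = (\<Sum>\<rho>\<in>R (Suc (k + j)). \<Sum>\<sigma>\<in>R (k + j). if \<sigma> \<in> down (k + j) \<rho> then d \<rho> * ?c \<sigma> else 0)"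
  proof (rule sum.cong[OF refl])
    fix \<rho> assume "\<rho> \<in> R (Suc (k + j))"
    then have "R (k + j) \<inter> {\<sigma>. \<sigma> \<in> down (k + j) \<rho>} = down (k + j) \<rho>" using down_subset by blast
    then show "(\<Sum>\<sigma>\<in>down (k + j) \<rho>. d \<rho> * ?c \<sigma>) =
        (\<Sum>\<sigma>\<in>R (k + j). if \<sigma> \<in> down (k + j) \<rho> then d \<rho> * ?c \<sigma> else 0)"
      using finite_R by (simp add: sum.If_cases)
  qed
  also have "\<dots> = (\<Sum>\<sigma>\<in>R (k + j). \<Sum>\<rho>\<in>R (Suc (k + j)). if \<sigma> \<in> down (k + j) \<rho> then d \<rho> * ?c \<sigma> else 0)"
    by (rule sum.swap)
  also have "\<dots> = (\<Sum>\<sigma>\<in>R (k + j). \<Sum>\<rho>\<in>ups (k + j) \<sigma>. d \<rho> * ?c \<sigma>)"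
    unfolding ups_def by (rule sum.cong[OF refl], rule sum.inter_filter[OF finite_R, symmetric])
  also have "\<dots> \<le> (\<Sum>\<sigma>\<in>R (k + j). 2 * Suc (k + j) * (d \<sigma> * ?c \<sigma>))"
  proof (rule sum_mono)
    fix \<sigma> assume s: "\<sigma> \<in> R (k + j)"
    have "(\<Sum>\<rho>\<in>ups (k + j) \<sigma>. d \<rho> * ?c \<sigma>) = (\<Sum>\<rho>\<in>ups (k + j) \<sigma>. d \<rho>) * ?c \<sigma>" by (rule sum_distrib_right[symmetric])
    also have "\<dots> \<le> (2 * Suc (k + j) * d \<sigma>) * ?c \<sigma>"
      by (intro mult_le_mono1 sum_d_ups[OF s finite_ups[OF s]]) simp
    finally show "(\<Sum>\<rho>\<in>ups (k + j) \<sigma>. d \<rho> * ?c \<sigma>) \<le> 2 * Suc (k + j) * (d \<sigma> * ?c \<sigma>)" by (simp only: mult.assoc)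
  qed
  also have "\<dots> = 2 * Suc (k + j) * (\<Sum>\<sigma>\<in>R (k + j). d \<sigma> * ?c \<sigma>)" by (simp only: sum_distrib_left)
  also have "\<dots> \<le> index k (Suc j)" using Suc by (simp del: mult_Suc)
  finally show ?case .
qed

text \<open>Entry \<open>(a, b)\<close> of the transform on \<open>B_i\<close> of the lifted
  function translated by \<open>w\<close>, that is of its values on the coset of \<open>w\<close>.
  For \<open>i = n\<close> and \<open>w = id\<close> it is an entry of the full transform.\<close>

definition partial_transform ::
  "nat \<Rightarrow> nat \<Rightarrow> nat \<Rightarrow> rep \<Rightarrow> (int \<Rightarrow> int) \<Rightarrow> nat \<Rightarrow> nat \<Rightarrow> ((int \<Rightarrow> int) set \<Rightarrow> complex) \<Rightarrow> complex" where
  "partial_transform n k i \<rho> w a b x =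
    (\<Sum>h\<in>signed_perms i. coset_lift (weyl_B n) (signed_perms k) x (w \<circ> h) * \<rho> h $$ (a, b))"

text \<open>The sum is grouped by cosets of \<open>B_i\<close>, and
  \<open>\<rho> (y \<circ> h)\<close> is factored. Column \<open>b\<close> of
  \<open>\<rho> h\<close> is supported in one block, where it is a column of the constituent, so a
  column is computed from columns only.\<close>

lemma partial_transform_Suc:
  assumes r: "\<rho> \<in> R (Suc i)" and ab: "a < d \<rho>" "b < d \<rho>"
  shows "partial_transform n k (Suc i) \<rho> w a b x =
    out i (kid i \<rho> b) \<rho> (\<lambda>y p. partial_transform n k i (kid i \<rho> b) (w \<circ> y) p (loc i \<rho> b)) a x"
proof -
  let ?\<sigma> = "kid i \<rho> b" and ?q = "loc i \<rho> b"
  let ?f = "coset_lift (weyl_B n) (signed_perms k) x"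
  have s: "?\<sigma> \<in> down i \<rho>" using kid_down[OF r ab(2)] .
  have q: "?q < d ?\<sigma>" "emb i \<rho> ?\<sigma> ?q = b" using block_bounds(2)[OF r ab(2)] emb_kid_loc[OF r ab(2)] by auto
  have "partial_transform n k (Suc i) \<rho> w a b x =
      (\<Sum>y\<in>coset_reps i. \<Sum>h\<in>signed_perms i. ?f (w \<circ> (y \<circ> h)) * \<rho> (y \<circ> h) $$ (a, b))"
    unfolding partial_transform_def by (rule sum_cosets)
  also have "\<dots> = (\<Sum>y\<in>coset_reps i. \<Sum>h\<in>signed_perms i. \<Sum>p<d ?\<sigma>.
      \<rho> y $$ (a, emb i \<rho> ?\<sigma> p) * (?f (w \<circ> y \<circ> h) * ?\<sigma> h $$ (p, ?q)))"
  proof (rule sum.cong[OF refl], rule sum.cong[OF refl])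
    fix y h assume "y \<in> coset_reps i" and h: "h \<in> signed_perms i"
    then have y: "y \<in> signed_perms (Suc i)" using coset_reps_subset by blast
    have h1: "h \<in> signed_perms (Suc i)" using h signed_perms_mono[of i "Suc i"] by auto
    have "\<rho> (y \<circ> h) $$ (a, emb i \<rho> ?\<sigma> ?q) = (\<Sum>p<d ?\<sigma>. \<rho> y $$ (a, emb i \<rho> ?\<sigma> p) * ?\<sigma> h $$ (p, ?q))"
      unfolding mult_index[OF r y h1 ab(1) emb(1)[OF r s q(1)]] by (rule sum_restrict_right[OF r s h q(1)])
    then show "?f (w \<circ> (y \<circ> h)) * \<rho> (y \<circ> h) $$ (a, b) =
        (\<Sum>p<d ?\<sigma>. \<rho> y $$ (a, emb i \<rho> ?\<sigma> p) * (?f (w \<circ> y \<circ> h) * ?\<sigma> h $$ (p, ?q)))"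
      unfolding q(2) by (simp add: sum_distrib_left comp_assoc mult.left_commute)
  qed
  also have "\<dots> = (\<Sum>y\<in>coset_reps i. \<Sum>p<d ?\<sigma>. \<Sum>h\<in>signed_perms i.
      \<rho> y $$ (a, emb i \<rho> ?\<sigma> p) * (?f (w \<circ> y \<circ> h) * ?\<sigma> h $$ (p, ?q)))"
    by (rule sum.cong[OF refl], rule sum.swap)
  finally show ?thesis unfolding out_def partial_transform_def by (simp only: sum_distrib_left)
qed

lemma coset_absorb:
  assumes kn: "k \<le> n" and w: "w \<in> signed_perms n" and h: "h \<in> signed_perms k"
  shows "(w \<circ> h) <#\<^bsub>weyl_B n\<^esub> signed_perms k = w <#\<^bsub>weyl_B n\<^esub> signed_perms k"
proof -
  have hn: "h \<in> signed_perms n" using h signed_perms_mono[OF kn] by auto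
  have H: "subgroup (signed_perms k) (weyl_B n)"
    using subgroup_weyl_B[OF kn] by (simp add: carrier_weyl_B)
  have "h <#\<^bsub>weyl_B n\<^esub> signed_perms k = signed_perms k"
    using group.lcos_m_assoc[OF group_weyl_B] group.coset_join3[OF group_weyl_B _ H h] hn
    by (simp add: carrier_weyl_B)
  then show ?thesis
    using group.lcos_m_assoc[OF group_weyl_B, of "signed_perms k" n w h] w hn signed_perms_mono[OF kn]
    by (simp add: carrier_weyl_B weyl_B_mult)
qed

text \<open>On the lowest level the lifted function is constant on the coset, so only the sum of a
  matrix coefficient over \<open>B_k\<close> remains. The normalization in \<open>coset_lift\<close>
  cancels it in the trivial case, which makes the result a bare input at no cost.\<close>

lemma partial_transform_0:
  assumes kn: "k \<le> n" and s: "\<sigma> \<in> R k" and w: "w \<in> signed_perms n" and ab: "a < d \<sigma>" "b < d \<sigma>"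
  shows "partial_transform n k k \<sigma> w a b x =
    (if trivial k \<sigma> then x (w <#\<^bsub>weyl_B n\<^esub> signed_perms k) else 0)"
proof -
  let ?C = "w <#\<^bsub>weyl_B n\<^esub> signed_perms k" and ?N = "of_nat (card (signed_perms k)) :: complex"
  have N: "?N \<noteq> 0"
    using finite_signed_perms signed_perms_id by (metis card_eq_0_iff empty_iff of_nat_eq_0_iff)
  have "partial_transform n k k \<sigma> w a b x = (1 / ?N * x ?C) * (\<Sum>h\<in>signed_perms k. \<sigma> h $$ (a, b))"
    unfolding partial_transform_def coset_lift_def sum_distrib_left
    by (rule sum.cong[OF refl]) (simp add: coset_absorb[OF kn w])
  also have "(\<Sum>h\<in>signed_perms k. \<sigma> h $$ (a, b)) = (if trivial k \<sigma> then ?N else 0)"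
    using sum_nontrivial[OF s ab] ab by (auto simp: trivial_def)
  finally show ?thesis using N by simp
qed

lemma partial_transform_not_live:
  assumes kn: "k \<le> n" and r: "\<rho> \<in> R (k + j)" and w: "w \<in> signed_perms n" and le: "k + j \<le> n"
    and ab: "a < d \<rho>" "b < d \<rho>" and nl: "b \<notin> live k j \<rho>"
  shows "partial_transform n k (k + j) \<rho> w a b x = 0"
  using r w le ab nl
proof (induction j arbitrary: \<rho> w a b)
  case 0
  then show ?case using partial_transform_0[OF kn, of \<rho> w a b x] by (auto simp: trivial_def)
next
  case (Suc j)
  let ?i = "k + j"
  have r: "\<rho> \<in> R (Suc ?i)" using Suc.prems by simp
  have "partial_transform n k ?i (kid ?i \<rho> b) (w \<circ> y) p (loc ?i \<rho> b) x = 0"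
    if y: "y \<in> coset_reps ?i" and p: "p < d (kid ?i \<rho> b)" for y p
  proof (rule Suc.IH)
    have "y \<in> signed_perms n" using y coset_reps_subset signed_perms_mono[of "Suc ?i" n] Suc.prems(3) by auto
    then show "w \<circ> y \<in> signed_perms n" using Suc.prems(2) by (intro signed_perms_comp)
  qed (use block_bounds[OF r Suc.prems(5)] Suc.prems p in auto)
  then show ?case
    using partial_transform_Suc[OF r Suc.prems(4,5), of n k w x] by (simp add: out_def)
qed

section \<open>Recursion for the total cost\<close>

definition transform_set :: "nat \<Rightarrow> nat \<Rightarrow> nat \<Rightarrow> (int \<Rightarrow> int) \<Rightarrow> (((int \<Rightarrow> int) set \<Rightarrow> complex) \<Rightarrow> complex) set" where
  "transform_set n k i w = {partial_transform n k i \<rho> w a b |\<rho> a b. \<rho> \<in> R i \<and> a < d \<rho> \<and> b < d \<rho>}"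

text \<open>Columns that are not live are delivered as the constant zero, which is free.\<close>

lemma extends_zero_insert:
  assumes "extends I \<Phi> \<Psi> a m"
  shows "extends I \<Phi> (insert (\<lambda>x. 0) \<Psi>) a m"
proof -
  have "extends I (\<Phi> \<union> \<Psi>) {\<lambda>x. 0} 0 0" by (rule extends_mono[OF extends_const[of I "\<Phi> \<union> \<Psi>" 0]]) auto
  from extends_trans[OF assms this] show ?thesis by simp
qed

text \<open>The transform is computed on each of the \<open>2 * Suc (k + j)\<close> cosets, then one
  stage is run for every live column; by \<open>sum_live\<close> the degrees, weighted with the
  numbers of live columns, add up to at most \<open>index k j\<close>.\<close>

primrec total_cost :: "nat \<Rightarrow> nat \<Rightarrow> nat" where
  "total_cost k 0 = 0"
| "total_cost k (Suc j) = 2 * Suc (k + j) * total_cost k j + stage_cost (k + j) * index k j"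

text \<open>Divided by \<open>index k j\<close>, the cost grows by \<open>4 * (k + j) + 1\<close> in
  each step, and the arithmetic progression is summed.\<close>

lemma total_cost_eq:
  "real (total_cost k j) = real (index k j) * (real j * (4 * real (k + j) - 2 * real j - 1))"
proof (induction j)
  case (Suc j)
  have "real (total_cost k (Suc j)) = 2 * real (Suc (k + j)) * real (total_cost k j) +
      2 * real (Suc (k + j)) * (4 * real (k + j) + 1) * real (index k j)"
    by (simp add: stage_cost_def algebra_simps)
  also have "\<dots> = real (index k (Suc j)) * (real (Suc j) * (4 * real (k + Suc j) - 2 * real (Suc j) - 1))"
    unfolding Suc.IH by (simp add: algebra_simps)
  finally show ?case .
qed simp

lemma transform_cost:
  assumes kn: "k \<le> n" and le: "k + j \<le> n" and w: "w \<in> signed_perms n"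
  shows "extends (lcosets\<^bsub>weyl_B n\<^esub> signed_perms k) ((\<lambda>c x. x c) ` (lcosets\<^bsub>weyl_B n\<^esub> signed_perms k))
    (transform_set n k (k + j) w) (total_cost k j) (total_cost k j)"
  using le w
proof (induction j arbitrary: w)
  case 0
  let ?I = "lcosets\<^bsub>weyl_B n\<^esub> signed_perms k"
  let ?in = "(\<lambda>c x. x c) ` ?I :: (((int \<Rightarrow> int) set \<Rightarrow> complex) \<Rightarrow> complex) set"
  let ?C = "w <#\<^bsub>weyl_B n\<^esub> signed_perms k"
  have "?C \<in> ?I" using 0 by (auto simp: LCOSETS_def carrier_weyl_B)
  then have "extends ?I ?in {\<lambda>x. x ?C} 0 0" by (intro extends_subset) auto
  then have "extends ?I ?in (insert (\<lambda>x. 0) {\<lambda>x. x ?C}) 0 0" by (rule extends_zero_insert)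
  moreover have "transform_set n k (k + 0) w \<subseteq> insert (\<lambda>x. 0) {\<lambda>x. x ?C}"
    using partial_transform_0[OF kn _ 0(2)] by (auto simp: transform_set_def fun_eq_iff)
  ultimately show ?case by (auto elim: extends_mono)
next
  case (Suc j)
  let ?I = "lcosets\<^bsub>weyl_B n\<^esub> signed_perms k" and ?i = "k + j"
  let ?in = "(\<lambda>c x. x c) ` ?I :: (((int \<Rightarrow> int) set \<Rightarrow> complex) \<Rightarrow> complex) set"
  let ?mid = "\<Union>y\<in>coset_reps ?i. transform_set n k ?i (w \<circ> y)"
  have wy: "w \<circ> y \<in> signed_perms n" if "y \<in> coset_reps ?i" for y
    using that coset_reps_subset signed_perms_mono[of "Suc ?i" n] Suc.prems by (intro signed_perms_comp) auto
  have "extends ?I ?in (transform_set n k ?i (w \<circ> y)) (total_cost k j) (total_cost k j)"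
    if "y \<in> coset_reps ?i" for y
    by (rule Suc.IH[OF _ wy[OF that]]) (use Suc.prems in simp)
  then have "extends ?I ?in ?mid (\<Sum>y\<in>coset_reps ?i. total_cost k j) (\<Sum>y\<in>coset_reps ?i. total_cost k j)"
    by (rule extends_UN[OF finite_coset_reps])
  then have 1: "extends ?I ?in ?mid (2 * Suc ?i * total_cost k j) (2 * Suc ?i * total_cost k j)"
    by (simp add: card_coset_reps)
  \<comment> \<open>Pairs of a representation and one of its live columns. One run of the stage for
    such a pair serves all \<open>\<rho>\<close> above \<open>\<sigma>\<close>, because their
    corresponding columns are computed from the same data.\<close>
  let ?S = "SIGMA \<sigma>:R ?i. live k j \<sigma>"
  let ?v = "\<lambda>\<sigma> q y p. partial_transform n k ?i \<sigma> (w \<circ> y) p q"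
  let ?outs = "\<lambda>(\<sigma>, q). {out ?i \<sigma> \<rho> (?v \<sigma> q) a |\<rho> a. \<rho> \<in> ups ?i \<sigma> \<and> a < d \<rho>}"
  let ?cost = "\<lambda>(\<sigma>, q :: nat). stage_cost ?i * d \<sigma>"
  have "extends ?I (?in \<union> ?mid) (?outs p) (?cost p) (?cost p)" if p: "p \<in> ?S" for p
  proof -
    obtain \<sigma> q where sq: "p = (\<sigma>, q)" "\<sigma> \<in> R ?i" "q \<in> live k j \<sigma>" using p by auto
    have q: "q < d \<sigma>" using sq(3) live_subset by auto
    have "extends ?I (?in \<union> ?mid) {out ?i \<sigma> \<rho> (?v \<sigma> q) a |\<rho> a. \<rho> \<in> ups ?i \<sigma> \<and> a < d \<rho>}
        (stage_cost ?i * d \<sigma>) (stage_cost ?i * d \<sigma>)"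
    proof (rule extends_mono[OF extends_stage[OF sq(2), where v = "?v \<sigma> q"]])
      have "?v \<sigma> q y b \<in> ?mid" if "y \<in> coset_reps ?i" "b < d \<sigma>" for y b
        unfolding transform_set_def using sq(2) q that by blast
      then show "{?v \<sigma> q y b |y b. y \<in> coset_reps ?i \<and> b < d \<sigma>} \<subseteq> ?in \<union> ?mid" by blast
    qed (rule subset_refl order_refl)+
    then show ?thesis by (simp add: sq(1))
  qed
  then have "extends ?I (?in \<union> ?mid) (\<Union>p\<in>?S. ?outs p) (\<Sum>p\<in>?S. ?cost p) (\<Sum>p\<in>?S. ?cost p)"
    using finite_R by (intro extends_UN) auto
  then have "extends ?I (?in \<union> ?mid) (insert (\<lambda>x. 0) (\<Union>p\<in>?S. ?outs p)) (\<Sum>p\<in>?S. ?cost p) (\<Sum>p\<in>?S. ?cost p)"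
    by (rule extends_zero_insert)
  from extends_trans[OF 1 this]
  show ?case
  proof (rule extends_mono)
    have "(\<Sum>p\<in>?S. ?cost p) = (\<Sum>\<sigma>\<in>R ?i. stage_cost ?i * (d \<sigma> * card (live k j \<sigma>)))"
      using finite_R by (subst sum.Sigma[symmetric]) (auto simp: mult_ac)
    also have "\<dots> = stage_cost ?i * (\<Sum>\<sigma>\<in>R ?i. d \<sigma> * card (live k j \<sigma>))" by (simp only: sum_distrib_left)
    also have "\<dots> \<le> stage_cost ?i * index k j" using sum_live by (rule mult_le_mono2)
    finally show "2 * Suc ?i * total_cost k j + (\<Sum>p\<in>?S. ?cost p) \<le> total_cost k (Suc j)"
      "2 * Suc ?i * total_cost k j + (\<Sum>p\<in>?S. ?cost p) \<le> total_cost k (Suc j)" by simp_all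
    show "transform_set n k (k + Suc j) w \<subseteq> ?mid \<union> insert (\<lambda>x. 0) (\<Union>p\<in>?S. ?outs p)"
    proof
      fix f assume "f \<in> transform_set n k (k + Suc j) w"
      then obtain \<rho> a b where f: "f = partial_transform n k (Suc ?i) \<rho> w a b"
        and r: "\<rho> \<in> R (Suc ?i)" and ab: "a < d \<rho>" "b < d \<rho>" by (auto simp: transform_set_def)
      show "f \<in> ?mid \<union> insert (\<lambda>x. 0) (\<Union>p\<in>?S. ?outs p)"
      proof (cases "b \<in> live k (Suc j) \<rho>")
        case True
        let ?\<sigma> = "kid ?i \<rho> b" and ?q = "loc ?i \<rho> b"
        have "f = out ?i ?\<sigma> \<rho> (?v ?\<sigma> ?q) a" unfolding f by (rule ext) (rule partial_transform_Suc[OF r ab])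
        moreover have "(?\<sigma>, ?q) \<in> ?S" using True block_bounds(3)[OF r ab(2)] by simp
        moreover have "\<rho> \<in> ups ?i ?\<sigma>" using r kid_down[OF r ab(2)] by (simp add: ups_def)
        ultimately have "f \<in> (\<Union>p\<in>?S. ?outs p)" using ab(1) by (intro UN_I[of "(?\<sigma>, ?q)"]) auto
        then show ?thesis by blast
      next
        case False
        then have "f = (\<lambda>x. 0)"
          using partial_transform_not_live[OF kn _ Suc.prems(2,1) ab, of x for x] r by (auto simp: f fun_eq_iff)
        then show ?thesis by blast
      qed
    qed
  qed auto
qed

lemma fourier_entries_subset: "fourier_entries (weyl_B n) (signed_perms k) (R n) \<subseteq> transform_set n k n id"
proof
  fix \<phi> assume "\<phi> \<in> fourier_entries (weyl_B n) (signed_perms k) (R n)"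
  then obtain \<rho> i j where r: "\<rho> \<in> R n" "i < d \<rho>" "j < d \<rho>"
    and f: "\<phi> = (\<lambda>f. fourier_transform (weyl_B n) (R n) (coset_lift (weyl_B n) (signed_perms k) f) \<rho> $$ (i, j))"
    by (auto simp: fourier_entries_def rep_degree_eq)
  have "\<phi> = partial_transform n k n \<rho> id i j"
    unfolding f using r
    by (simp add: fun_eq_iff fourier_transform_def partial_transform_def rep_degree_eq carrier_weyl_B)
  then show "\<phi> \<in> transform_set n k n id" using r by (auto simp: transform_set_def)
qed

lemma space_complexity_le:
  assumes kn: "k \<le> n"
  shows "space_complexity (weyl_B n) (signed_perms k) \<le> enat (total_cost k (n - k))"
proof -
  let ?I = "lcosets\<^bsub>weyl_B n\<^esub> signed_perms k" and ?c = "total_cost k (n - k)"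
  have "extends ?I ((\<lambda>c x. x c) ` ?I) (transform_set n k n id) ?c ?c"
    using transform_cost[OF kn, of "n - k" id] kn by simp
  from extendsD[OF this subset_refl computable_inputs]
  have "computable ?I ?c ?c ((\<lambda>c x. x c) ` ?I \<union> transform_set n k n id)" by simp
  then have "computable ?I ?c ?c (fourier_entries (weyl_B n) (signed_perms k) (R n))"
    by (rule computable_subset) (use fourier_entries_subset in blast)
  then obtain p where p: "p \<in> fourier_programs (weyl_B n) (signed_perms k) (R n)"
    "add_count p \<le> ?c" "mult_count p \<le> ?c"
    by (auto simp: computable_def fourier_programs_def)
  have "arith_complexity (weyl_B n) (signed_perms k) (R n) \<le> enat ?c"
    unfolding arith_complexity_def using p by (intro max.boundedI INF_lower2[OF p(1)]) auto
  moreover have "adapted_irreps (weyl_B n) (signed_perms k) (R n)"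
    using adapted[OF kn] by (simp add: carrier_weyl_B)
  ultimately show ?thesis unfolding space_complexity_def by (intro INF_lower2[of "R n"]) auto
qed

end

theorem theorem1p4:
  fixes n k :: nat
  assumes "1 \<le> k" and "k \<le> n"
  shows "ereal_of_enat (space_complexity (weyl_B n) (carrier (weyl_B (n - k))))
    \<le> ereal (real k * (4 * real n - 2 * real k - 1)
        * (real (card (carrier (weyl_B n))) / real (card (carrier (weyl_B (n - k))))))"
proof -
  obtain R kids where "branching R kids" using ex_branching by blast
  then interpret branching R kids .
  \<comment> \<open>The lemmas above count from the small group: their base level is
    \<open>n - k\<close>, and the number of steps is \<open>k\<close>.\<close>
  let ?j = "n - k"
  have nk: "?j + k = n" "n - ?j = k" using assms by auto
  have "card (signed_perms ?j) \<noteq> 0"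
    using finite_signed_perms signed_perms_id by (metis card_eq_0_iff empty_iff)
  then have idx: "real (index ?j k) = real (card (signed_perms n)) / real (card (signed_perms ?j))"
    using index_eq[of ?j k] nk by (simp add: field_simps)
  have "space_complexity (weyl_B n) (signed_perms ?j) \<le> enat (total_cost ?j k)"
    using space_complexity_le[of ?j n] nk by simp
  then have "ereal_of_enat (space_complexity (weyl_B n) (signed_perms ?j)) \<le> ereal (real (total_cost ?j k))"
    using ereal_of_enat_le_iff[of _ "enat (total_cost ?j k)"] by simp
  also have "real (total_cost ?j k) = real k * (4 * real n - 2 * real k - 1) *
      (real (card (signed_perms n)) / real (card (signed_perms ?j)))"
    using total_cost_eq[of ?j k] unfolding idx nk by (simp add: mult.commute)
  finally show ?thesis by (simp add: carrier_weyl_B)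
qed

end
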